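(* The even (respectively odd) spectrum together with the restriction of the potential to $\left[\frac14,1\right]$ determines the potential on $[0,1]$. That is, let $q_1,q_2\in L^1([0,1])$ be real-valued and let $h_1,h_2,H\in\mathbb{R}$. Suppose that $q_1=q_2$ almost everywhere on $\left[\frac14,1\right]$ and that either (i) $\lambda_{2j}(q_1,h_1,H)=\lambda_{2j}(q_2,h_2,H)$ for all integers $j\ge 0$, or (ii) $\lambda_{2j+1}(q_1,h_1,H)=\lambda_{2j+1}(q_2,h_2,H)$ for all integers $j\ge 0$. Then $q_1=q_2$ almost everywhere on $[0,1]$.
   Context: For a real-valued $q\in L^1([0,1])$ and $h,H\in\mathbb{R}$, $A_{q,h,H}$ denotes the Schrödinger operator $-\frac{d^2}{dx^2}+q$ on $[0,1]$ with boundary conditions $u'(0)+hu(0)=0$ and $u'(1)+Hu(1)=0$. Its spectrum is a sequence of simple real eigenvalues, and $(\lambda_j(q,h,H))_{j\ge 0}$ denotes the increasing sequence of these eigenvalues, indexed from $j=0$. *)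

theory Defs
  imports "HOL-Analysis.Analysis"
begin

text \<open>
  \<open>f\<close> is absolutely continuous on \<open>[0,1]\<close> and \<open>g\<close> is a version of its almost everywhere derivative:
  by the Lebesgue fundamental theorem of calculus the absolutely continuous functions are exactly
  the indefinite integrals of \<open>L\<^sup>1\<close> functions, and \<open>g\<close> is unique up to null sets.
\<close>

definition has_ac_derivative :: "(real \<Rightarrow> complex) \<Rightarrow> (real \<Rightarrow> complex) \<Rightarrow> bool" where
  "has_ac_derivative f g \<longleftrightarrow>
     g absolutely_integrable_on {0..1} \<and>
     (\<forall>x\<in>{0..1}. f x = f 0 + integral {0..x} g)"

definition square_integrable_01 :: "(real \<Rightarrow> complex) \<Rightarrow> bool" where
  "square_integrable_01 f \<longleftrightarrow>
     f \<in> borel_measurable (lebesgue_on {0..1}) \<and>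
     integrable (lebesgue_on {0..1}) (\<lambda>x. (cmod (f x))\<^sup>2)"

text \<open>
  The graph of the operator \<open>-d\<^sup>2/dx\<^sup>2 + q\<close> in complex \<open>L\<^sup>2([0,1])\<close>, on its maximal domain subject
  to the boundary conditions \<open>u'(0) + h u(0) = 0\<close> and \<open>u'(1) + H u(1) = 0\<close>: it relates \<open>u\<close>
  (the continuous representative) to every version \<open>w\<close> of its image.
  The witness \<open>u'\<close> is itself absolutely continuous, hence is the
  continuous, everywhere defined derivative of \<open>u\<close>, so its values at the end points are meaningful.
\<close>

definition schroedinger_operator ::
  "(real \<Rightarrow> real) \<Rightarrow> real \<Rightarrow> real \<Rightarrow> (real \<Rightarrow> complex) \<Rightarrow> (real \<Rightarrow> complex) \<Rightarrow> bool" where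
  "schroedinger_operator q h H u w \<longleftrightarrow>
     square_integrable_01 u \<and> square_integrable_01 w \<and>
     (\<exists>u' u''. has_ac_derivative u u' \<and> has_ac_derivative u' u'' \<and>
        (AE x in lebesgue_on {0..1}. w x = - u'' x + complex_of_real (q x) * u x) \<and>
        u' 0 + complex_of_real h * u 0 = 0 \<and>
        u' 1 + complex_of_real H * u 1 = 0)"

definition schroedinger_eigenvalue ::
  "(real \<Rightarrow> real) \<Rightarrow> real \<Rightarrow> real \<Rightarrow> complex \<Rightarrow> bool" where
  "schroedinger_eigenvalue q h H z \<longleftrightarrow>
     (\<exists>u. schroedinger_operator q h H u (\<lambda>x. z * u x) \<and>
          \<not> (AE x in lebesgue_on {0..1}. u x = 0))"

text \<open>
  The increasing enumeration of the spectrum from index \<open>0\<close>. All eigenvalues are real and simple,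
  they are bounded below and accumulate only at infinity, so for \<open>q \<in> L\<^sup>1([0,1])\<close> exactly one
  strictly increasing real sequence has the set of all (a priori complex) eigenvalues as its range.
\<close>

definition schroedinger_lambda :: "(real \<Rightarrow> real) \<Rightarrow> real \<Rightarrow> real \<Rightarrow> nat \<Rightarrow> real" where
  "schroedinger_lambda q h H =
     (THE l. strict_mono l \<and>
        range (\<lambda>j. complex_of_real (l j)) = {z. schroedinger_eigenvalue q h H z})"

end

theory Submission
  imports Defs "HOL-Complex_Analysis.Complex_Analysis"
begin

text \<open>
  For a potential \<open>q\<close> let \<open>\<phi>(x,z)\<close> be the solution of \<open>- y'' + q y = z y\<close> with \<open>y(0) = 1\<close> and
  \<open>y'(0) = - h\<close>. The eigenvalues are the zeros of \<open>\<Delta>(z) = \<phi>'(1,z) + H \<phi>(1,z)\<close>. Given two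
  problems with the same \<open>H\<close>, the Wronskian \<open>W(z) = \<phi>\<^sub>1 \<phi>\<^sub>2' - \<phi>\<^sub>1' \<phi>\<^sub>2\<close>, taken at \<open>x = 1\<close>, vanishes at
  every common eigenvalue, because there both solutions satisfy the same boundary condition at \<open>1\<close>.
  As the potentials agree on \<open>[1/4,1]\<close>, the Wronskian is constant on that interval, so that \<open>W(z)\<close> is
  also its value at \<open>1/4\<close>, namely \<open>h\<^sub>1 - h\<^sub>2 + \<integral> (q\<^sub>2 - q\<^sub>1) \<phi>\<^sub>1 \<phi>\<^sub>2\<close> over \<open>[0,1/4]\<close>. The proof has two
  halves: \<open>W\<close> vanishes identically, and this forces \<open>q\<^sub>1 = q\<^sub>2\<close> on \<open>[0,1/4]\<close>.

  Write \<open>z = k\<^sup>2\<close>. A solution grows like \<open>exp (\<bar>Im k\<bar> x)\<close>, so \<open>W(k\<^sup>2)\<close> is \<open>O(exp (\<bar>Im k\<bar> / 2))\<close>, and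
  even \<open>o(exp (\<bar>Im k\<bar> / 2))\<close> as \<open>\<bar>Im k\<bar>\<close> grows, since an integrable function puts little mass near the
  point \<open>1/4\<close> (\<open>cross_wronskian_growth\<close>). On the other hand
  \<open>\<Delta>(k\<^sup>2) = - k sin k + O(exp \<bar>Im k\<bar>)\<close>, and by Rouche's theorem the eigenvalues satisfy
  \<open>\<lambda>\<^sub>n \<le> (n \<pi>)\<^sup>2 + O(1)\<close> (\<open>schroedinger_lambda_properties\<close>); the eigenvalues of odd index, and still
  more those of even index, are therefore at least as dense as the squares of the zeros of \<open>cos (k/2)\<close>, a
  function whose growth is exactly \<open>exp (\<bar>Im k\<bar> / 2)\<close>. The interval length \<open>1/4\<close> is the borderline at
  which these two rates meet, and the gain from \<open>O\<close> to \<open>o\<close> decides: in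
  \<open>half_type_with_odd_pi_zeros\<close> the quotient \<open>W(k\<^sup>2) / cos (k/2)\<close>, with the zeros of the denominator
  exchanged for those of the numerator by Blaschke factors, is bounded on large circles and small there
  away from the real axis; multiplied by its own rotation through a right angle it is small on the whole
  circle, and the maximum principle gives \<open>W = 0\<close> (\<open>cross_wronskian_vanishes\<close>).

  If \<open>W = 0\<close>, the two problems on \<open>[0,a]\<close> with \<open>a = 1/4\<close> have the same Weyl function
  \<open>\<phi>'(a,z) / \<phi>(a,z)\<close>, and a Borg-Marchenko argument applies. Let \<open>C\<^sub>i\<close>, \<open>S\<^sub>i\<close> be the
  solutions started at \<open>a\<close> and running backwards with data \<open>(1,0)\<close> and \<open>(0,1)\<close>. Then
  \<open>C\<^sub>1 S\<^sub>2 - C\<^sub>2 S\<^sub>1\<close> is entire in \<open>z\<close>, and the equality of the Weyl functions lets one replace each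
  \<open>C\<^sub>i\<close> in it by the solution \<open>\<phi>\<^sub>i / \<phi>\<^sub>i(a)\<close>, which decays away from \<open>a\<close>; this shows that it is
  \<open>O(1/\<bar>k\<bar>)\<close> on large circles, hence zero (\<open>backward_solutions_agree\<close>). Differentiating
  \<open>C\<^sub>1 S\<^sub>2 = C\<^sub>2 S\<^sub>1\<close> and using that Wronskians are constant gives \<open>S\<^sub>1\<^sup>2 = S\<^sub>2\<^sup>2\<close>, and two more derivatives
  give \<open>q\<^sub>1 = q\<^sub>2\<close> almost everywhere where \<open>S\<^sub>1\<close> does not vanish, which for nonreal \<open>z\<close> is everywhere
  except at \<open>a\<close> (\<open>potential_eq_if_cross_wronskian_zero\<close>).

  Since the potentials are merely integrable, the differential equation holds only almost everywhere.
  All calculus is therefore done with indefinite integrals (\<open>ac_deriv\<close>), for which the product rule and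
  Gronwall's inequality are derived from one lemma on small increments, and existence, growth and
  analytic dependence on \<open>z\<close> of the solutions follow from these.
\<close>

section \<open>Calculus of absolutely continuous functions\<close>

text \<open>
  Unqualified, these names denote the facts on Bochner integrals.
\<close>

lemmas hk_integral_norm_bound_integral = Henstock_Kurzweil_Integration.integral_norm_bound_integral
lemmas hk_integral_nonneg = Henstock_Kurzweil_Integration.integral_nonneg
lemmas hk_integral_add = Henstock_Kurzweil_Integration.integral_add
lemmas hk_integral_cong = Henstock_Kurzweil_Integration.integral_cong
lemmas hk_integral_diff = Henstock_Kurzweil_Integration.integral_diff
lemmas hk_integral_mult_right = Henstock_Kurzweil_Integration.integral_mult_right
lemmas hk_integral_neg = Henstock_Kurzweil_Integration.integral_neg
lemmas hk_integral_sum = Henstock_Kurzweil_Integration.integral_sum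

text \<open>
  This replaces the mean value theorem, which is not available for functions that are differentiable
  only almost everywhere: increments of second order, compared with those of a reference
  function \<open>B\<close>, add up to nothing over a fine partition.
\<close>

lemma le_start_if_small_increments:
  fixes D B :: "real \<Rightarrow> real"
  assumes small: "\<And>e. e > 0 \<Longrightarrow> \<exists>d>0. \<forall>s t. 0 \<le> s \<longrightarrow> s \<le> t \<longrightarrow> t \<le> b \<longrightarrow> t - s \<le> d \<longrightarrow>
                      D t - D s \<le> e * (B t - B s)"
    and x: "0 \<le> x" "x \<le> b"
  shows "D x \<le> D 0"
proof -
  have le: "D x - D 0 \<le> e * (B x - B 0)" if e: "e > 0" for e
  proof -
    obtain d where d: "d > 0" and inc: "\<And>s t. 0 \<le> s \<Longrightarrow> s \<le> t \<Longrightarrow> t \<le> b \<Longrightarrow> t - s \<le> d \<Longrightarrow>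
                      D t - D s \<le> e * (B t - B s)"
      using small[OF e] by blast
    obtain n :: nat where n: "x / d < real n" "n > 0"
      by (metis gr0I less_trans of_nat_0 reals_Archimedean2 zero_less_one of_nat_1 not_less_iff_gr_or_eq)
    have step: "x / n \<le> d" using n d by (simp add: field_simps)
    have "i \<le> n \<Longrightarrow> D (x * i / n) - D 0 \<le> e * (B (x * i / n) - B 0)" for i
    proof (induction i)
      case (Suc i)
      have ub: "x * Suc i / n \<le> b"
      proof -
        have "x * Suc i / n \<le> x * n / n" using Suc.prems x by (intro divide_right_mono mult_left_mono) auto
        also have "\<dots> = x" using n by simp
        finally show ?thesis using x by simp
      qed
      have "x * Suc i / n - x * i / n = x / n" by (simp add: add_divide_distrib algebra_simps)
      with inc[of "x * i / n" "x * Suc i / n"] step ub x n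
      have "D (x * Suc i / n) - D (x * i / n) \<le> e * (B (x * Suc i / n) - B (x * i / n))"
        by (simp add: divide_right_mono mult_left_mono)
      with Suc show ?case by (simp add: algebra_simps)
    qed simp
    from this[of n] n show ?thesis by simp
  qed
  show ?thesis
  proof (rule ccontr)
    assume "\<not> D x \<le> D 0"
    then have pos: "D x - D 0 > 0" by simp
    define e where "e = (D x - D 0) / (2 * (\<bar>B x - B 0\<bar> + 1))"
    have "e > 0" using pos by (simp add: e_def divide_pos_pos add_nonneg_pos)
    have "e * (B x - B 0) \<le> e * (\<bar>B x - B 0\<bar> + 1)" using \<open>e > 0\<close> by (intro mult_left_mono) auto
    also have "\<dots> = (D x - D 0) / 2"
    proof -
      have "d / (2 * w) * w = d / 2" if "w > 0" for d w :: real using that by simp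
      from this[of "\<bar>B x - B 0\<bar> + 1"] show ?thesis unfolding e_def by (simp only: add_nonneg_pos abs_ge_zero zero_less_one)
    qed
    finally show False using le[OF \<open>e > 0\<close>] pos by simp
  qed
qed

lemma abs_integrable_mult_continuous:
  fixes q f :: "real \<Rightarrow> 'a::{euclidean_space, real_normed_field}"
  assumes q: "q absolutely_integrable_on {a..b}" and f: "continuous_on {a..b} f"
  shows "(\<lambda>x. q x * f x) absolutely_integrable_on {a..b}"
proof -
  have "(\<lambda>x. f x * q x) absolutely_integrable_on {a..b}"
  proof (rule absolutely_integrable_bounded_measurable_product[where h="(*)" and f=f and g=q, OF _ _ _ _ q])
    show "bilinear ((*) :: 'a \<Rightarrow> 'a \<Rightarrow> 'a)"
      using bounded_bilinear_mult bilinear_conv_bounded_bilinear by blast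
    show "f \<in> borel_measurable (lebesgue_on {a..b})"
      using f by (intro continuous_imp_measurable_on_sets_lebesgue) auto
    show "bounded (f ` {a..b})"
      using f by (intro compact_imp_bounded compact_continuous_image) auto
  qed auto
  then show ?thesis by (simp add: mult.commute)
qed

text \<open>
  The notion of \<open>has_ac_derivative\<close> on an interval \<open>[0,b]\<close> of variable length, as is
  required for the problem on \<open>[0,1/4]\<close>.
\<close>

definition ac_deriv :: "real \<Rightarrow> (real \<Rightarrow> complex) \<Rightarrow> (real \<Rightarrow> complex) \<Rightarrow> bool" where
  "ac_deriv b f g \<longleftrightarrow> g absolutely_integrable_on {0..b} \<and> (\<forall>x\<in>{0..b}. f x = f 0 + integral {0..x} g)"

lemma has_ac_derivative_iff: "has_ac_derivative f g \<longleftrightarrow> ac_deriv 1 f g"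
  by (simp add: has_ac_derivative_def ac_deriv_def)

text \<open>
  The defining equation loops as a rewrite rule (its right-hand side contains \<open>f 0\<close>), hence the
  introduction and destruction rules.
\<close>

lemma ac_derivD: "ac_deriv b f g \<Longrightarrow> 0 \<le> x \<Longrightarrow> x \<le> b \<Longrightarrow> f x = f 0 + integral {0..x} g"
  by (drule ac_deriv_def[THEN iffD1], drule conjunct2, erule bspec) simp

lemma ac_derivI:
  assumes "g absolutely_integrable_on {0..b}"
    and "\<And>x. 0 \<le> x \<Longrightarrow> x \<le> b \<Longrightarrow> f x = f 0 + integral {0..x} g"
  shows "ac_deriv b f g"
  unfolding ac_deriv_def by (intro conjI ballI assms) simp_all

lemma ac_deriv_integrable: "ac_deriv b f g \<Longrightarrow> g absolutely_integrable_on {0..b}"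
  by (simp add: ac_deriv_def)

lemma abs_integrable_sub:
  fixes g :: "real \<Rightarrow> 'a::euclidean_space"
  assumes "g absolutely_integrable_on {0..b}" "0 \<le> s" "t \<le> b"
  shows "g absolutely_integrable_on {s..t}" "g integrable_on {s..t}" "(\<lambda>x. norm (g x)) integrable_on {s..t}"
proof -
  show *: "g absolutely_integrable_on {s..t}"
    using assms by (intro absolutely_integrable_on_subinterval[OF assms(1)]) auto
  then show "g integrable_on {s..t}" "(\<lambda>x. norm (g x)) integrable_on {s..t}"
    by (auto simp: absolutely_integrable_on_def)
qed

lemma integral_diff_eq:
  fixes g :: "real \<Rightarrow> 'a::euclidean_space"
  assumes g: "g absolutely_integrable_on {0..b}" and st: "0 \<le> s" "s \<le> t" "t \<le> b"
  shows "integral {0..t} g - integral {0..s} g = integral {s..t} g"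
proof -
  have "g integrable_on {0..t}" using abs_integrable_sub(2)[OF g] st by auto
  from Henstock_Kurzweil_Integration.integral_combine[OF _ _ this, of s] st show ?thesis
    by (simp add: algebra_simps)
qed

lemma integral_upper_mono:
  fixes f :: "real \<Rightarrow> real"
  assumes f: "f absolutely_integrable_on {0..b}" and nn: "\<And>x. x \<in> {0..b} \<Longrightarrow> 0 \<le> f x"
    and st: "0 \<le> s" "s \<le> t" "t \<le> b"
  shows "integral {0..s} f \<le> integral {0..t} f"
proof -
  have "0 \<le> integral {s..t} f"
    using st nn abs_integrable_sub(2)[OF f] by (intro hk_integral_nonneg) auto
  then show ?thesis using integral_diff_eq[OF f st] by simp
qed

lemma ac_deriv_diff:
  assumes "ac_deriv b f g" "0 \<le> s" "s \<le> t" "t \<le> b"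
  shows "f t - f s = integral {s..t} g"
proof -
  have "f t = f 0 + integral {0..t} g" "f s = f 0 + integral {0..s} g"
    by (rule ac_derivD[OF assms(1)]; use assms(2-4) in simp)+
  then show ?thesis using integral_diff_eq[OF ac_deriv_integrable[OF assms(1)] assms(2-4)] by simp
qed

lemma ac_deriv_continuous:
  assumes "ac_deriv b f g"
  shows "continuous_on {0..b} f"
proof -
  have "continuous_on {0..b} (\<lambda>x. f 0 + integral {0..x} g)"
    using ac_deriv_integrable[OF assms] by (intro continuous_intros indefinite_integral_continuous_1)
       (simp add: absolutely_integrable_on_def)
  moreover have "f x = f 0 + integral {0..x} g" if "x \<in> {0..b}" for x
    by (rule ac_derivD[OF assms]) (use that in auto)
  ultimately show ?thesis by (subst continuous_on_cong[OF refl, of _ f "\<lambda>x. f 0 + integral {0..x} g"])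
qed

lemma ac_deriv_restrict: "ac_deriv b f g \<Longrightarrow> a \<le> b \<Longrightarrow> ac_deriv a f g"
  by (rule ac_derivI, rule absolutely_integrable_on_subinterval[OF ac_deriv_integrable], assumption, simp,
      rule ac_derivD, assumption, simp_all)

lemma ac_deriv_cong:
  assumes "ac_deriv b f g" "\<And>x. x \<in> {0..b} \<Longrightarrow> f x = f' x" "\<And>x. x \<in> {0..b} \<Longrightarrow> g x = g' x"
  shows "ac_deriv b f' g'"
proof (rule ac_derivI)
  fix x assume x: "0 \<le> x" "x \<le> b"
  have "integral {0..x} g = integral {0..x} g'"
    using x assms(3) by (intro hk_integral_cong) auto
  then show "f' x = f' 0 + integral {0..x} g'"
    using ac_derivD[OF assms(1) x] assms(2)[of x] assms(2)[of 0] x by simp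
next
  show "g' absolutely_integrable_on {0..b}"
    using assms(3) by (intro absolutely_integrable_spike[OF ac_deriv_integrable[OF assms(1)], of "{}"]) auto
qed

lemma AE_lebesgue_on_negligible:
  assumes "AE x in lebesgue_on S. P x" "S \<in> sets lebesgue"
  obtains N where "negligible N" "\<And>x. x \<in> S - N \<Longrightarrow> P x"
proof -
  have "AE x in lebesgue. x \<in> S \<longrightarrow> P x" using assms by (simp add: AE_restrict_space_iff)
  then obtain N where "N \<in> null_sets lebesgue" "{x \<in> space lebesgue. \<not> (x \<in> S \<longrightarrow> P x)} \<subseteq> N"
    unfolding eventually_ae_filter by blast
  then show ?thesis using that[of N] by (auto simp: negligible_iff_null_sets)
qed

lemma negligible_imp_AE_lebesgue_on:
  assumes "negligible N" "\<And>x. x \<in> S - N \<Longrightarrow> P x" "S \<in> sets lebesgue"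
  shows "AE x in lebesgue_on S. P x"
proof -
  have "AE x in lebesgue. x \<notin> N" using assms(1) by (intro AE_not_in) (simp add: negligible_iff_null_sets)
  then show ?thesis using assms by (auto simp: AE_restrict_space_iff elim!: eventually_mono)
qed

lemma ac_deriv_cong_AE:
  assumes "ac_deriv b f g" "AE x in lebesgue_on {0..b}. g x = g' x"
  shows "ac_deriv b f g'"
proof -
  obtain N where N: "negligible N" "\<And>x. x \<in> {0..b} - N \<Longrightarrow> g x = g' x"
    using AE_lebesgue_on_negligible[OF assms(2)] by auto
  show ?thesis
  proof (rule ac_derivI)
    fix x assume x: "0 \<le> x" "x \<le> b"
    have "integral {0..x} g = integral {0..x} g'"
      using x N by (intro integral_spike[OF N(1)]) auto
    then show "f x = f 0 + integral {0..x} g'" using ac_derivD[OF assms(1) x] by simp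
  next
    show "g' absolutely_integrable_on {0..b}"
      using N by (intro absolutely_integrable_spike[OF ac_deriv_integrable[OF assms(1)] N(1)]) auto
  qed
qed

lemma ac_deriv_linear:
  assumes "ac_deriv b f f'" "ac_deriv b g g'"
  shows "ac_deriv b (\<lambda>x. c * f x + d * g x) (\<lambda>x. c * f' x + d * g' x)"
proof (rule ac_derivI)
  fix x assume x: "0 \<le> x" "x \<le> b"
  have "f' integrable_on {0..x}" "g' integrable_on {0..x}"
    using x abs_integrable_sub(2)[OF ac_deriv_integrable[OF assms(1)], of 0 x]
      abs_integrable_sub(2)[OF ac_deriv_integrable[OF assms(2)], of 0 x] by auto
  then have "integral {0..x} (\<lambda>x. c * f' x + d * g' x) = c * integral {0..x} f' + d * integral {0..x} g'"
    by (simp add: hk_integral_add integrable_on_mult_right)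
  then show "c * f x + d * g x = c * f 0 + d * g 0 + integral {0..x} (\<lambda>x. c * f' x + d * g' x)"
    using ac_derivD[OF assms(1) x] ac_derivD[OF assms(2) x] by (simp add: algebra_simps)
next
  show "(\<lambda>x. c * f' x + d * g' x) absolutely_integrable_on {0..b}"
    using ac_deriv_integrable[OF assms(1)] ac_deriv_integrable[OF assms(2)]
    by (intro set_integral_add set_integrable_mult_right) auto
qed

lemma ac_deriv_C1:
  assumes "\<And>x. x \<in> {0..b} \<Longrightarrow> (f has_vector_derivative g x) (at x within {0..b})" "continuous_on {0..b} g"
  shows "ac_deriv b f g"
proof (rule ac_derivI)
  show "g absolutely_integrable_on {0..b}" by (rule absolutely_integrable_continuous_real[OF assms(2)])
  fix x assume x: "0 \<le> x" "x \<le> b"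
  have "(g has_integral (f x - f 0)) {0..x}"
    using x by (intro fundamental_theorem_of_calculus)
      (auto intro: has_vector_derivative_within_subset[OF assms(1)])
  then show "f x = f 0 + integral {0..x} g" by (simp add: integral_unique)
qed

lemma ac_deriv_cnj:
  assumes "ac_deriv b f g"
  shows "ac_deriv b (\<lambda>x. cnj (f x)) (\<lambda>x. cnj (g x))"
proof (rule ac_derivI)
  fix x assume x: "0 \<le> x" "x \<le> b"
  have "integral {0..x} (\<lambda>x. cnj (g x)) = cnj (integral {0..x} g)"
    using integral_linear[OF abs_integrable_sub(2)[OF ac_deriv_integrable[OF assms], of 0 x] bounded_linear_cnj] x
    by (simp add: o_def)
  then show "cnj (f x) = cnj (f 0) + integral {0..x} (\<lambda>x. cnj (g x))"
    using ac_derivD[OF assms x] by simp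
next
  show "(\<lambda>x. cnj (g x)) absolutely_integrable_on {0..b}"
    using absolutely_integrable_linear[OF ac_deriv_integrable[OF assms] bounded_linear_cnj] by (simp add: o_def)
qed

lemma ac_deriv_reflect:
  assumes "ac_deriv b f g" "0 \<le> b"
  shows "ac_deriv b (\<lambda>x. f (b - x)) (\<lambda>x. - g (b - x))"
proof -
  have refl: "((\<lambda>x. g (b - x)) has_integral (f b - f (b - t))) {0..t}" if "t \<in> {0..b}" for t
  proof -
    have "(g has_integral (f b - f (b - t))) {b-t..b}"
      using ac_deriv_diff[OF assms(1), of "b - t" b] that abs_integrable_sub[OF ac_deriv_integrable[OF assms(1)], of "b - t" b]
      by (simp add: has_integral_integrable_integral)
    then have "((\<lambda>x. g ((-1) *\<^sub>R x + b)) has_integral (f b - f (b - t))) ((\<lambda>x. - x + b) ` {b-t..b})"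
      using has_integral_affinity[of g "f b - f (b-t)" "b-t" b "-1" b] by (simp add: cbox_interval)
    moreover have "(\<lambda>x. - x + b) ` {b-t..b} = {0..t}"
    proof -
      have "y \<in> (\<lambda>x. - x + b) ` {b-t..b}" if "y \<in> {0..t}" for y
        using that by (intro image_eqI[of _ _ "b - y"]) auto
      then show ?thesis by auto
    qed
    ultimately show ?thesis by simp
  qed
  have "(\<lambda>x. g (b - x)) absolutely_integrable_on {0..b}"
  proof -
    have "((\<lambda>x. cmod (g x)) integrable_on {0..b})"
      using ac_deriv_integrable[OF assms(1)] by (auto simp: absolutely_integrable_on_def)
    then obtain I where "((\<lambda>x. cmod (g x)) has_integral I) (cbox 0 b)" by (auto simp: integrable_on_def)
    from has_integral_affinity[OF this, of "-1" b]
    have "((\<lambda>x. cmod (g (b - x))) has_integral I) ((\<lambda>x. - x + b) ` {0..b})" by (simp add: cbox_interval)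
    moreover have "(\<lambda>x. - x + b) ` {0..b} = {0..b}"
    proof -
      have "y \<in> (\<lambda>x. - x + b) ` {0..b}" if "y \<in> {0..b}" for y
        using that by (intro image_eqI[of _ _ "b - y"]) auto
      then show ?thesis by auto
    qed
    ultimately show ?thesis using refl[of b] assms
      by (auto simp: absolutely_integrable_on_def integrable_on_def)
  qed
  then have "(\<lambda>x. - g (b - x)) absolutely_integrable_on {0..b}" by (auto simp: absolutely_integrable_on_def dest: integrable_neg)
  moreover have "f (b - x) = f b + integral {0..x} (\<lambda>x. - g (b - x))" if "x \<in> {0..b}" for x
    using refl[OF that] by (simp add: integral_unique)
  ultimately show ?thesis by (intro ac_derivI) simp_all
qed

text \<open>
  The increment of \<open>f g\<close> over \<open>[s,t]\<close> differs from the integral of the claimed derivative by terms of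
  the form \<open>\<integral> f'(r) (g t - g r) dr\<close>, which uniform continuity makes small against the increment
  of \<open>\<integral> \<bar>f'\<bar>\<close>.
\<close>

lemma ac_deriv_mult:
  assumes f: "ac_deriv b f f'" and g: "ac_deriv b g g'"
  shows "ac_deriv b (\<lambda>x. f x * g x) (\<lambda>x. f' x * g x + g' x * f x)"
proof -
  define h where "h = (\<lambda>x. f' x * g x + g' x * f x)"
  have fi: "f' absolutely_integrable_on {0..b}" and gi: "g' absolutely_integrable_on {0..b}"
    using f g ac_deriv_integrable by auto
  have cf: "continuous_on {0..b} f" and cg: "continuous_on {0..b} g"
    using f g ac_deriv_continuous by auto
  have h: "h absolutely_integrable_on {0..b}"
    unfolding h_def by (intro set_integral_add abs_integrable_mult_continuous fi gi cf cg)
  define F where "F t = integral {0..t} (\<lambda>x. cmod (f' x))" for t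
  define G where "G t = integral {0..t} (\<lambda>x. cmod (g' x))" for t
  define D where "D t = f t * g t - integral {0..t} h" for t
  have inc: "\<exists>d>0. \<forall>s t. 0 \<le> s \<longrightarrow> s \<le> t \<longrightarrow> t \<le> b \<longrightarrow> t - s \<le> d \<longrightarrow>
      cmod (D t - D 0) - cmod (D s - D 0) \<le> e * ((F t + G t) - (F s + G s))" if e: "e > 0" for e
  proof -
    have "uniformly_continuous_on {0..b} f" "uniformly_continuous_on {0..b} g"
      using cf cg by (auto intro: compact_uniformly_continuous)
    then obtain d1 d2 where d: "d1 > 0" "d2 > 0"
       and d1: "\<And>s t. s \<in> {0..b} \<Longrightarrow> t \<in> {0..b} \<Longrightarrow> dist t s < d1 \<Longrightarrow> dist (f t) (f s) < e"
       and d2: "\<And>s t. s \<in> {0..b} \<Longrightarrow> t \<in> {0..b} \<Longrightarrow> dist t s < d2 \<Longrightarrow> dist (g t) (g s) < e"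
      unfolding uniformly_continuous_on_def using e by metis
    show ?thesis
    proof (intro exI[of _ "min d1 d2 / 2"] conjI allI impI)
      show "0 < min d1 d2 / 2" using d by simp
      fix s t assume st: "0 \<le> s" "s \<le> t" "t \<le> b" "t - s \<le> min d1 d2 / 2"
      have sub: "{s..t} \<subseteq> {0..b}" using st by auto
      have fi': "f' absolutely_integrable_on {s..t}" and gi': "g' absolutely_integrable_on {s..t}"
        using abs_integrable_sub fi gi st by blast+
      have i1: "(\<lambda>r. f' r * (g t - g r)) integrable_on {s..t}" "(\<lambda>r. g' r * (f s - f r)) integrable_on {s..t}"
        using abs_integrable_mult_continuous[OF fi', of "\<lambda>r. g t - g r"] abs_integrable_mult_continuous[OF gi', of "\<lambda>r. f s - f r"]
          continuous_on_subset[OF cf sub] continuous_on_subset[OF cg sub]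
        by (auto simp: absolutely_integrable_on_def continuous_on_diff continuous_on_const)
      have hint: "h integrable_on {s..t}" using abs_integrable_sub h st by blast
      have "D t - D s = f t * g t - f s * g s - integral {s..t} h"
        using integral_diff_eq[OF h st(1-3)] unfolding D_def by (simp add: algebra_simps)
      also have "f t * g t - f s * g s = (f t - f s) * g t + (g t - g s) * f s"
        by (simp add: algebra_simps)
      also have "\<dots> = integral {s..t} (\<lambda>r. f' r * g t + g' r * f s)"
        using ac_deriv_diff[OF f st(1-3)] ac_deriv_diff[OF g st(1-3)] fi' gi'
        by (simp add: hk_integral_add integrable_on_mult_left absolutely_integrable_on_def)
      also have "\<dots> - integral {s..t} h = integral {s..t} (\<lambda>r. f' r * (g t - g r) + g' r * (f s - f r))"
        unfolding h_def using fi' gi' hint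
        by (subst hk_integral_diff [symmetric])
           (auto intro!: integrable_add integrable_on_mult_left integrable_on_mult_right simp: h_def absolutely_integrable_on_def algebra_simps)
      also have "cmod \<dots> \<le> integral {s..t} (\<lambda>r. e * cmod (f' r) + e * cmod (g' r))"
      proof (rule hk_integral_norm_bound_integral)
        show "(\<lambda>r. f' r * (g t - g r) + g' r * (f s - f r)) integrable_on {s..t}"
          using i1 by (rule integrable_add)
        show "(\<lambda>r. e * cmod (f' r) + e * cmod (g' r)) integrable_on {s..t}"
          using fi' gi' by (auto intro!: integrable_add integrable_on_mult_right simp: absolutely_integrable_on_def)
        fix r assume r: "r \<in> {s..t}"
        then have "dist t r < d2" "dist s r < d1" using st d by (auto simp: dist_real_def)
        then have "cmod (g t - g r) \<le> e" "cmod (f s - f r) \<le> e"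
          using d1[of r s] d2[of r t] r st by (auto simp: dist_norm)
        then have "cmod (f' r) * cmod (g t - g r) \<le> cmod (f' r) * e" "cmod (g' r) * cmod (f s - f r) \<le> cmod (g' r) * e"
          by (auto intro: mult_left_mono)
        then show "cmod (f' r * (g t - g r) + g' r * (f s - f r)) \<le> e * cmod (f' r) + e * cmod (g' r)"
          using norm_triangle_ineq[of "f' r * (g t - g r)" "g' r * (f s - f r)"]
          by (simp add: norm_mult mult.commute)
      qed
      also have "\<dots> = e * ((F t + G t) - (F s + G s))"
        using integral_diff_eq[OF absolutely_integrable_norm[OF fi] st(1-3)]
          integral_diff_eq[OF absolutely_integrable_norm[OF gi] st(1-3)] fi' gi' unfolding F_def G_def o_def
        by (simp add: hk_integral_add integrable_on_mult_right absolutely_integrable_on_def algebra_simps)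
      finally have "cmod (D t - D s) \<le> e * ((F t + G t) - (F s + G s))" .
      moreover have "cmod (D t - D 0) \<le> cmod (D t - D s) + cmod (D s - D 0)"
        using norm_triangle_ineq[of "D t - D s" "D s - D 0"] by simp
      ultimately show "cmod (D t - D 0) - cmod (D s - D 0) \<le> e * ((F t + G t) - (F s + G s))" by linarith
    qed
  qed
  have D0: "D x = D 0" if "x \<in> {0..b}" for x
    using le_start_if_small_increments[of b "\<lambda>t. cmod (D t - D 0)" "\<lambda>t. F t + G t" x] inc that by auto
  show ?thesis
  proof (fold h_def, rule ac_derivI[OF h])
    fix x assume "0 \<le> x" "x \<le> b"
    then have "D x = D 0" by (intro D0) simp
    then show "f x * g x = f 0 * g 0 + integral {0..x} h" by (simp add: D_def algebra_simps)
  qed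
qed

text \<open>
  With \<open>R\<close> the right-hand side of the hypothesis and \<open>B = \<integral> \<beta>\<close>, one has \<open>R t - R s \<le> R t (B t - B s)\<close>.
  Hence \<open>exp (- B) R\<close> can increase only to second order in the increments of \<open>B\<close>, that is, not at all.
\<close>

lemma gronwall:
  fixes \<beta> \<psi> :: "real \<Rightarrow> real"
  assumes \<beta>: "\<beta> absolutely_integrable_on {0..b}" "\<And>x. x \<in> {0..b} \<Longrightarrow> \<beta> x \<ge> 0"
    and \<psi>: "continuous_on {0..b} \<psi>"
    and le: "\<And>x. x \<in> {0..b} \<Longrightarrow> \<psi> x \<le> A + integral {0..x} (\<lambda>t. \<beta> t * \<psi> t)"
    and A: "A \<ge> 0" and pos: "\<And>x. x \<in> {0..b} \<Longrightarrow> \<psi> x \<ge> 0" and x: "x \<in> {0..b}"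
  shows "\<psi> x \<le> A * exp (integral {0..x} \<beta>)"
proof -
  define R where "R t = A + integral {0..t} (\<lambda>t. \<beta> t * \<psi> t)" for t
  define B where "B t = integral {0..t} \<beta>" for t
  have bp: "(\<lambda>t. \<beta> t * \<psi> t) absolutely_integrable_on {0..b}"
    by (intro abs_integrable_mult_continuous \<beta> \<psi>)
  have Rd: "R t - R s = integral {s..t} (\<lambda>t. \<beta> t * \<psi> t)" if "0 \<le> s" "s \<le> t" "t \<le> b" for s t
    using integral_diff_eq[OF bp that] by (simp add: R_def)
  have Bd: "B t - B s = integral {s..t} \<beta>" if "0 \<le> s" "s \<le> t" "t \<le> b" for s t
    using integral_diff_eq[OF \<beta>(1) that] by (simp add: B_def)
  have Rm: "R s \<le> R t" if "0 \<le> s" "s \<le> t" "t \<le> b" for s t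
    using integral_upper_mono[OF bp _ that] \<beta>(2) pos by (simp add: R_def)
  have Bm: "B s \<le> B t" if "0 \<le> s" "s \<le> t" "t \<le> b" for s t
    using integral_upper_mono[OF \<beta> that] by (simp add: B_def)
  have R0: "R 0 = A" and B0: "B 0 = 0" by (auto simp: R_def B_def)
  have Rinc: "R t - R s \<le> R t * (B t - B s)" if st: "0 \<le> s" "s \<le> t" "t \<le> b" for s t
  proof -
    have "integral {s..t} (\<lambda>r. \<beta> r * \<psi> r) \<le> integral {s..t} (\<lambda>r. R t * \<beta> r)"
    proof (rule integral_le)
      show "(\<lambda>r. \<beta> r * \<psi> r) integrable_on {s..t}" using abs_integrable_sub[OF bp] st by auto
      show "(\<lambda>r. R t * \<beta> r) integrable_on {s..t}"
        using abs_integrable_sub[OF \<beta>(1)] st by (auto intro: integrable_on_mult_right)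
      fix r assume r: "r \<in> {s..t}"
      have "\<psi> r \<le> R t" using le[of r] Rm[of r t] r st by (auto simp: R_def)
      then show "\<beta> r * \<psi> r \<le> R t * \<beta> r" using \<beta>(2)[of r] r st by (metis atLeastAtMost_iff mult.commute mult_right_mono order_trans)
    qed
    then show ?thesis using Rd[OF st] Bd[OF st] by simp
  qed
  have cB: "continuous_on {0..b} B"
    unfolding B_def using \<beta> by (intro indefinite_integral_continuous_1) (simp add: absolutely_integrable_on_def)
  have *: "\<exists>d>0. \<forall>s t. 0 \<le> s \<longrightarrow> s \<le> t \<longrightarrow> t \<le> b \<longrightarrow> t - s \<le> d \<longrightarrow>
      exp (- B t) * R t - exp (- B s) * R s \<le> e * (B t - B s)" if e: "e > 0" for e
  proof -
    define K where "K = \<bar>R b\<bar> + 1"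
    have Kp: "K > 0" by (simp add: K_def)
    have "uniformly_continuous_on {0..b} B" using cB by (auto intro: compact_uniformly_continuous)
    then obtain d where d: "d > 0"
       and d1: "\<And>s t. s \<in> {0..b} \<Longrightarrow> t \<in> {0..b} \<Longrightarrow> dist t s < d \<Longrightarrow> dist (B t) (B s) < min 1 (e / K)"
      unfolding uniformly_continuous_on_def using e Kp by (metis divide_pos_pos min_less_iff_conj zero_less_one)
    show ?thesis
    proof (intro exI[of _ "d/2"] conjI allI impI)
      fix s t assume st: "0 \<le> s" "s \<le> t" "t \<le> b" "t - s \<le> d / 2"
      define u where "u = B t - B s"
      have u: "u \<ge> 0" using Bm st by (simp add: u_def)
      have ue: "u \<le> e / K" and u1: "u \<le> 1" using d1[of s t] st d by (auto simp: u_def dist_real_def)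
      have Rt: "0 \<le> R t" "R t \<le> K" using Rm[of 0 t] Rm[of t b] st A R0 by (auto simp: K_def)
      have "exp (- B t) \<le> 1" using Bm[of 0 t] st B0 by simp
      have "(1 + u) * (1 - u) \<le> exp u * (1 - u)"
        using exp_ge_add_one_self[of u] u1 by (intro mult_right_mono) auto
      then have eu: "1 - exp u * (1 - u) \<le> u * u" by (simp add: algebra_simps)
      have es: "exp (- B s) = exp (- B t) * exp u" by (simp add: u_def flip: exp_add)
      have "R t * (1 - u) \<le> R s" using Rinc[OF st(1-3)] by (simp add: u_def algebra_simps)
      then have "exp (- B s) * (R t * (1 - u)) \<le> exp (- B s) * R s" by simp
      then have "exp (- B t) * R t - exp (- B s) * R s \<le> exp (- B t) * R t - exp (- B s) * (R t * (1 - u))"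
        by simp
      also have "\<dots> = exp (- B t) * (R t * (1 - exp u * (1 - u)))"
        by (simp add: algebra_simps es)
      also have "\<dots> \<le> exp (- B t) * (R t * (u * u))" using eu Rt by (intro mult_left_mono) auto
      also have "\<dots> \<le> 1 * (K * (u * u))"
        using Rt \<open>exp (- B t) \<le> 1\<close> by (intro mult_mono mult_right_mono) auto
      also have "\<dots> \<le> e * u" 
        using mult_right_mono[OF ue u] Kp by (simp add: field_simps)
      finally show "exp (- B t) * R t - exp (- B s) * R s \<le> e * (B t - B s)" unfolding u_def .
    qed (use d in simp)
  qed
  have "exp (- B x) * R x \<le> exp (- B 0) * R 0"
    using le_start_if_small_increments[of b "\<lambda>t. exp (- B t) * R t" B x] * x by auto
  then have "R x \<le> A * exp (B x)" by (simp add: R0 B0 exp_minus field_simps)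
  moreover have "\<psi> x \<le> R x" using le[OF x] by (simp add: R_def)
  ultimately show ?thesis by (simp add: B_def)
qed

section \<open>Second order linear equations with integrable coefficients\<close>

text \<open>
  The weight \<open>exp (2 \<integral> \<beta>)\<close> makes the Picard iteration for a coefficient of size \<open>\<beta>\<close> contract
  by a factor \<open>1/2\<close>, uniformly on the interval.
\<close>

lemma integral_exp_weight_le:
  fixes \<beta> :: "real \<Rightarrow> real"
  assumes \<beta>: "\<beta> absolutely_integrable_on {0..b}" "\<And>x. x \<in> {0..b} \<Longrightarrow> \<beta> x \<ge> 0"
    and x: "x \<in> {0..b}"
  shows "integral {0..x} (\<lambda>t. \<beta> t * exp (2 * integral {0..t} \<beta>)) \<le> exp (2 * integral {0..x} \<beta>) / 2"
proof -
  define P where "P t = integral {0..t} \<beta>" for t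
  define D where "D t = integral {0..t} (\<lambda>t. \<beta> t * exp (2 * P t)) - exp (2 * P t) / 2" for t
  have cP: "continuous_on {0..b} P"
    unfolding P_def using \<beta> by (intro indefinite_integral_continuous_1) (simp add: absolutely_integrable_on_def)
  then have cE: "continuous_on {0..b} (\<lambda>t. exp (2 * P t))" by (intro continuous_intros)
  have bE: "(\<lambda>t. \<beta> t * exp (2 * P t)) absolutely_integrable_on {0..b}"
    by (intro abs_integrable_mult_continuous \<beta> cE)
  have Pd: "P t - P s = integral {s..t} \<beta>" if "0 \<le> s" "s \<le> t" "t \<le> b" for s t
    using integral_diff_eq[OF \<beta>(1) that] by (simp add: P_def)
  have Pm: "P s \<le> P t" if "0 \<le> s" "s \<le> t" "t \<le> b" for s t
    using integral_upper_mono[OF \<beta> that] by (simp add: P_def)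
  have *: "\<exists>d>0. \<forall>s t. 0 \<le> s \<longrightarrow> s \<le> t \<longrightarrow> t \<le> b \<longrightarrow> t - s \<le> d \<longrightarrow> D t - D s \<le> e * (P t - P s)"
    if e: "e > 0" for e
  proof -
    have "uniformly_continuous_on {0..b} (\<lambda>t. exp (2 * P t))" using cE by (auto intro: compact_uniformly_continuous)
    then obtain d where d: "d > 0"
       and d1: "\<And>s t. s \<in> {0..b} \<Longrightarrow> t \<in> {0..b} \<Longrightarrow> dist t s < d \<Longrightarrow> dist (exp (2 * P t)) (exp (2 * P s)) < e"
      unfolding uniformly_continuous_on_def using e by metis
    show ?thesis
    proof (intro exI[of _ "d/2"] conjI allI impI)
      fix s t assume st: "0 \<le> s" "s \<le> t" "t \<le> b" "t - s \<le> d / 2"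
      define u where "u = P t - P s"
      have u: "u \<ge> 0" using Pm st by (simp add: u_def)
      have le: "exp (2 * P t) - exp (2 * P s) \<le> e" using d1[of s t] st d by (auto simp: dist_real_def)
      have "D t - D s = integral {s..t} (\<lambda>t. \<beta> t * exp (2 * P t)) - (exp (2 * P t) - exp (2 * P s)) / 2"
        using integral_diff_eq[OF bE st(1-3)] by (simp add: D_def diff_divide_distrib)
      also have "integral {s..t} (\<lambda>t. \<beta> t * exp (2 * P t)) \<le> integral {s..t} (\<lambda>r. exp (2 * P t) * \<beta> r)"
      proof (rule integral_le)
        show "(\<lambda>r. \<beta> r * exp (2 * P r)) integrable_on {s..t}" using abs_integrable_sub[OF bE] st by auto
        show "(\<lambda>r. exp (2 * P t) * \<beta> r) integrable_on {s..t}"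
          using abs_integrable_sub[OF \<beta>(1)] st by (auto intro: integrable_on_mult_right)
        fix r assume r: "r \<in> {s..t}"
        have "exp (2 * P r) \<le> exp (2 * P t)" using Pm[of r t] r st by simp
        then show "\<beta> r * exp (2 * P r) \<le> exp (2 * P t) * \<beta> r"
          using \<beta>(2)[of r] r st by (simp add: mult.commute mult_left_mono)
      qed
      also have "\<dots> = exp (2 * P t) * u" using Pd[OF st(1-3)] by (simp add: u_def)
      also have "exp (2 * P t) * u - (exp (2 * P t) - exp (2 * P s)) / 2 \<le> (exp (2 * P t) - exp (2 * P s)) * u"
      proof -
        have "exp (2 * P t) = exp (2 * P s) * exp (2 * u)" by (simp add: u_def algebra_simps flip: exp_add)
        moreover have "exp (2 * P s) * (2 * u) \<le> exp (2 * P s) * (exp (2 * u) - 1)"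
          using exp_ge_add_one_self[of "2 * u"] by (intro mult_left_mono) (linarith, simp)
        ultimately show ?thesis by (simp add: algebra_simps)
      qed
      also have "\<dots> \<le> e * u" using le u by (rule mult_right_mono)
      finally show "D t - D s \<le> e * (P t - P s)" by (simp add: u_def)
    qed (use d in simp)
  qed
  have "D x \<le> D 0"
    using le_start_if_small_increments[of b D P x] * x by auto
  then show ?thesis by (simp add: D_def P_def)
qed

lemma double_integral_bound:
  fixes g :: "real \<Rightarrow> complex"
  assumes "g integrable_on {0..x}" "0 \<le> x" "x \<le> 1"
    and "\<And>s. 0 \<le> s \<Longrightarrow> s \<le> x \<Longrightarrow> cmod (integral {0..s} g) \<le> C"
  shows "cmod (integral {0..x} (\<lambda>s. integral {0..s} g)) \<le> C"
proof -
  have C: "C \<ge> 0" using assms(4)[of 0] assms(2) by simp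
  have "cmod (integral {0..x} (\<lambda>s. integral {0..s} g)) \<le> integral {0..x} (\<lambda>s. C)"
    using assms indefinite_integral_continuous_1[OF assms(1)]
    by (intro hk_integral_norm_bound_integral) (auto intro: integrable_continuous_real)
  also have "\<dots> \<le> C" using assms C by (simp add: mult_left_le_one_le mult_right_le_one_le)
  finally show ?thesis .
qed

text \<open>
  Picard iteration: \<open>y\<close> is the sum of the series \<open>f0 + K f0 + K (K f0) + \<dots>\<close>, where \<open>K\<close> integrates \<open>p g\<close> twice
  and \<open>f0\<close> collects the initial data and the forcing. By \<open>integral_exp_weight_le\<close> the series is dominated by
  a geometric one. A forcing term is allowed because the derivative of a solution with respect to the
  spectral parameter solves a forced equation.
\<close>

lemma forced_ivp_exists:
  fixes p r :: "real \<Rightarrow> complex"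
  assumes p: "p absolutely_integrable_on {0..b}" and r: "r absolutely_integrable_on {0..b}"
    and b: "0 \<le> b" "b \<le> 1"
  shows "\<exists>y y'. ac_deriv b y y' \<and> ac_deriv b y' (\<lambda>x. p x * y x + r x) \<and> y 0 = \<alpha> \<and> y' 0 = \<gamma>"
proof -
  define K where "K g x = integral {0..x} (\<lambda>s. integral {0..s} (\<lambda>t. p t * g t))" for g x
  define f0 where "f0 x = \<alpha> + \<gamma> * of_real x + integral {0..x} (\<lambda>s. integral {0..s} r)" for x
  define F where "F = rec_nat f0 (\<lambda>_. K)"
  have F0: "F 0 = f0" and FS: "F (Suc n) = K (F n)" for n by (auto simp: F_def)
  define P where "P t = integral {0..t} (\<lambda>t. cmod (p t))" for t
  have pn: "(\<lambda>t. cmod (p t)) absolutely_integrable_on {0..b}" using p by (simp add: absolutely_integrable_norm[unfolded o_def])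
  have Pm: "P s \<le> P t" if "0 \<le> s" "s \<le> t" "t \<le> b" for s t
    unfolding P_def by (rule integral_upper_mono[OF pn _ that]) simp
  have pg: "(\<lambda>t. p t * g t) absolutely_integrable_on {0..b}" if "continuous_on {0..b} g" for g
    by (intro abs_integrable_mult_continuous p that)
  have ci: "continuous_on {0..b} (\<lambda>s. integral {0..s} g)" if "g absolutely_integrable_on {0..b}" for g :: "real \<Rightarrow> complex"
    using that by (intro indefinite_integral_continuous_1) (simp add: absolutely_integrable_on_def)
  have cci: "continuous_on {0..b} (\<lambda>x. integral {0..x} (\<lambda>s. integral {0..s} g))" if "g absolutely_integrable_on {0..b}" for g :: "real \<Rightarrow> complex"
    using ci[OF absolutely_integrable_continuous_real[OF ci[OF that]]] .
  have cK: "continuous_on {0..b} (K g)" if "continuous_on {0..b} g" for g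
    using cci[OF pg[OF that]] by (simp add: K_def[abs_def])
  have cf0: "continuous_on {0..b} f0"
    unfolding f0_def using cci[OF r] by (intro continuous_intros) auto
  have cF: "continuous_on {0..b} (F n)" for n
    by (induction n) (auto simp: F0 FS cf0 cK)
  obtain M where M: "M > 0" "\<And>x. x \<in> {0..b} \<Longrightarrow> cmod (f0 x) \<le> M"
    using compact_imp_bounded[OF compact_continuous_image[OF cf0]] by (auto simp: bounded_pos)
  have bound: "cmod (F n x) \<le> M * exp (2 * P x) / 2 ^ n" if "x \<in> {0..b}" for n x
    using that
  proof (induction n arbitrary: x)
    case 0
    have "1 \<le> exp (2 * P x)" using Pm[of 0 x] 0 by (simp add: P_def)
    then have "M * 1 \<le> M * exp (2 * P x)" using M by (intro mult_left_mono) auto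
    with M(2)[OF 0] show ?case by (simp add: F0)
  next
    case (Suc n)
    have "cmod (integral {0..s} (\<lambda>t. p t * F n t)) \<le> M * exp (2 * P x) / 2 ^ Suc n" if s: "0 \<le> s" "s \<le> x" for s
    proof -
      have sb: "s \<le> b" using s Suc.prems by auto
      have i1: "(\<lambda>t. cmod (p t) * exp (2 * P t)) integrable_on {0..s}"
      proof -
        have "continuous_on {0..b} (\<lambda>t. exp (2 * P t))"
          unfolding P_def using pn by (intro continuous_intros indefinite_integral_continuous_1) (simp add: absolutely_integrable_on_def)
        from abs_integrable_mult_continuous[OF pn this] show ?thesis using abs_integrable_sub sb by blast
      qed
      have "cmod (integral {0..s} (\<lambda>t. p t * F n t)) \<le> integral {0..s} (\<lambda>t. M / 2 ^ n * (cmod (p t) * exp (2 * P t)))"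
      proof (rule hk_integral_norm_bound_integral)
        show "(\<lambda>t. p t * F n t) integrable_on {0..s}" using abs_integrable_sub[OF pg[OF cF]] sb by auto
        show "(\<lambda>t. M / 2 ^ n * (cmod (p t) * exp (2 * P t))) integrable_on {0..s}" using i1 by (rule integrable_on_mult_right)
        fix t assume "t \<in> {0..s}"
        then have "cmod (F n t) \<le> M * exp (2 * P t) / 2 ^ n" using Suc.IH[of t] sb by auto
        then have "cmod (p t) * cmod (F n t) \<le> cmod (p t) * (M * exp (2 * P t) / 2 ^ n)" by (rule mult_left_mono) simp
        then show "cmod (p t * F n t) \<le> M / 2 ^ n * (cmod (p t) * exp (2 * P t))" by (simp add: norm_mult mult_ac)
      qed
      also have "\<dots> = M / 2 ^ n * integral {0..s} (\<lambda>t. cmod (p t) * exp (2 * P t))" by simp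
      also have "\<dots> \<le> M / 2 ^ n * (exp (2 * P s) / 2)"
        using integral_exp_weight_le[OF pn, of s] s sb M unfolding P_def by (intro mult_left_mono) auto
      also have "\<dots> \<le> M / 2 ^ n * (exp (2 * P x) / 2)"
        using Pm[of s x] s Suc.prems M by (intro mult_left_mono divide_right_mono) auto
      finally show ?thesis by (simp add: field_simps)
    qed
    moreover have "(\<lambda>t. p t * F n t) integrable_on {0..x}"
      using abs_integrable_sub[OF pg[OF cF]] Suc.prems by auto
    ultimately show ?case unfolding FS K_def
      using Suc.prems b by (intro double_integral_bound) auto
  qed
  define C where "C = M * exp (2 * P b)"
  have C: "cmod (F n x) \<le> C * (1/2) ^ n" if "x \<in> {0..b}" for n x
  proof -
    have "M * exp (2 * P x) / 2 ^ n \<le> M * exp (2 * P b) / 2 ^ n"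
      using Pm[of x b] that M by (intro mult_left_mono divide_right_mono) auto
    with bound[OF that, of n] show ?thesis by (simp add: C_def power_divide)
  qed
  define y where "y x = (\<Sum>n. F n x)" for x
  have sm: "summable (\<lambda>n. C * (1/2) ^ n)" by (intro summable_mult summable_geometric) auto
  define S where "S N x = (\<Sum>n<N. F n x)" for N x
  have ul: "uniform_limit {0..b} S y sequentially"
    unfolding S_def y_def using Weierstrass_m_test[OF C sm] .
  have cS: "continuous_on {0..b} (S N)" for N unfolding S_def by (intro continuous_on_sum cF)
  have cy: "continuous_on {0..b} y"
    by (rule uniform_limit_theorem[OF _ ul]) (auto simp: cS)
  have Slim: "(\<lambda>N. S N x) \<longlonglongrightarrow> y x" if "x \<in> {0..b}" for x
    using tendsto_uniform_limitI[OF ul that] .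
  have Sb: "cmod (S N x) \<le> 2 * C" if "x \<in> {0..b}" for N x
  proof -
    have "cmod (S N x) \<le> (\<Sum>n<N. cmod (F n x))" unfolding S_def by (rule norm_sum)
    also have "\<dots> \<le> (\<Sum>n<N. C * (1/2) ^ n)" using C[OF that] by (intro sum_mono)
    also have "\<dots> \<le> (\<Sum>n. C * (1/2) ^ n)" using sm M by (intro sum_le_suminf) (auto simp: C_def)
    also have "\<dots> = 2 * C" using suminf_mult[of "\<lambda>n. (1/2)^n" C] suminf_geometric[of "1/2::real"] by (simp add: summable_geometric)
    finally show ?thesis .
  qed
  \<comment> \<open>the partial sums satisfy the recursion, and \<open>K\<close> passes to the limit by dominated convergence\<close>
  have KS: "S (Suc N) x = f0 x + K (S N) x" if x: "x \<in> {0..b}" for N x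
  proof -
    have inner: "integral {0..s} (\<lambda>t. p t * S N t) = (\<Sum>n<N. integral {0..s} (\<lambda>t. p t * F n t))" if "s \<in> {0..x}" for s
      unfolding S_def sum_distrib_left
      using abs_integrable_sub[OF pg[OF cF]] that x by (intro hk_integral_sum) auto
    have "K (S N) x = integral {0..x} (\<lambda>s. \<Sum>n<N. integral {0..s} (\<lambda>t. p t * F n t))"
      unfolding K_def using inner by (intro hk_integral_cong) auto
    also have "\<dots> = (\<Sum>n<N. K (F n) x)"
      unfolding K_def
      using x by (intro hk_integral_sum) (auto intro!: integrable_continuous_real continuous_on_subset[OF ci[OF pg[OF cF]]])
    finally show ?thesis unfolding S_def sum.lessThan_Suc_shift by (simp add: F0 FS)
  qed
  have K1: "(\<lambda>N. integral {0..s} (\<lambda>t. p t * S N t)) \<longlonglongrightarrow> integral {0..s} (\<lambda>t. p t * y t)" if s: "s \<in> {0..b}" for s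
  proof (rule dominated_convergence(2)[where h="\<lambda>t. 2 * C * cmod (p t)"])
    show "(\<lambda>t. p t * S k t) integrable_on {0..s}" for k using abs_integrable_sub[OF pg[OF cS]] s by auto
    show "(\<lambda>t. 2 * C * cmod (p t)) integrable_on {0..s}"
      using abs_integrable_sub[OF pn, of 0 s] s by (intro integrable_on_mult_right) auto
    show "cmod (p t * S k t) \<le> 2 * C * cmod (p t)" if "t \<in> {0..s}" for k t
      using mult_left_mono[OF Sb[of t k], of "cmod (p t)"] that s by (simp add: norm_mult mult_ac)
    show "(\<lambda>k. p t * S k t) \<longlonglongrightarrow> p t * y t" if "t \<in> {0..s}" for t
      using Slim[of t] s that by (auto intro!: tendsto_intros)
  qed
  have K2: "(\<lambda>N. K (S N) x) \<longlonglongrightarrow> K y x" if x: "x \<in> {0..b}" for x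
    unfolding K_def
  proof (rule dominated_convergence(2)[where h="\<lambda>t. 2 * C * P b"])
    show "(\<lambda>s. integral {0..s} (\<lambda>t. p t * S k t)) integrable_on {0..x}" for k
      using x by (auto intro!: integrable_continuous_real continuous_on_subset[OF ci[OF pg[OF cS]]])
    show "cmod (integral {0..s} (\<lambda>t. p t * S k t)) \<le> 2 * C * P b" if s: "s \<in> {0..x}" for s k
    proof -
      have sb: "0 \<le> s" "s \<le> b" using s x by auto
      have "cmod (integral {0..s} (\<lambda>t. p t * S k t)) \<le> integral {0..s} (\<lambda>t. 2 * C * cmod (p t))"
      proof (rule hk_integral_norm_bound_integral)
        show "(\<lambda>t. p t * S k t) integrable_on {0..s}" using abs_integrable_sub[OF pg[OF cS]] sb by auto
        show "(\<lambda>t. 2 * C * cmod (p t)) integrable_on {0..s}"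
          using abs_integrable_sub[OF pn, of 0 s] sb by (intro integrable_on_mult_right) auto
        show "cmod (p t * S k t) \<le> 2 * C * cmod (p t)" if "t \<in> {0..s}" for t
          using mult_left_mono[OF Sb[of t k], of "cmod (p t)"] that sb by (simp add: norm_mult mult_ac)
      qed
      also have "\<dots> = 2 * C * P s" by (simp add: P_def)
      also have "\<dots> \<le> 2 * C * P b" using Pm[of s b] sb M by (intro mult_left_mono) (auto simp: C_def)
      finally show ?thesis .
    qed
    show "(\<lambda>k. integral {0..s} (\<lambda>t. p t * S k t)) \<longlonglongrightarrow> integral {0..s} (\<lambda>t. p t * y t)" if "s \<in> {0..x}" for s
      using K1[of s] x that by auto
  qed auto
  have y_eq: "y x = f0 x + K y x" if x: "x \<in> {0..b}" for x
  proof (rule LIMSEQ_unique)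
    show "(\<lambda>N. S (Suc N) x) \<longlonglongrightarrow> y x" using Slim[OF x] by (rule LIMSEQ_Suc)
    show "(\<lambda>N. S (Suc N) x) \<longlonglongrightarrow> f0 x + K y x"
      unfolding KS[OF x] by (intro tendsto_intros K2 x)
  qed
  define y' where "y' x = \<gamma> + integral {0..x} (\<lambda>t. p t * y t + r t)" for x
  have pyr: "(\<lambda>t. p t * y t + r t) absolutely_integrable_on {0..b}"
    by (intro set_integral_add pg cy r)
  have y'0: "y' 0 = \<gamma>" by (simp add: y'_def)
  have 2: "ac_deriv b y' (\<lambda>x. p x * y x + r x)"
    by (rule ac_derivI[OF pyr]) (simp add: y'_def)
  have 1: "ac_deriv b y y'"
  proof (rule ac_derivI)
    show "y' absolutely_integrable_on {0..b}"
      by (rule absolutely_integrable_continuous_real[OF ac_deriv_continuous[OF 2]])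
    fix x assume x: "0 \<le> x" "x \<le> b"
    have i1: "(\<lambda>s. integral {0..s} (\<lambda>t. p t * y t)) integrable_on {0..x}"
      "(\<lambda>s. integral {0..s} r) integrable_on {0..x}"
      using x by (auto intro!: integrable_continuous_real continuous_on_subset[OF ci] pg cy r)
    have "integral {0..x} y' = integral {0..x} (\<lambda>s. \<gamma> + (integral {0..s} (\<lambda>t. p t * y t) + integral {0..s} r))"
    proof (rule hk_integral_cong)
      fix s assume "s \<in> {0..x}"
      then show "y' s = \<gamma> + (integral {0..s} (\<lambda>t. p t * y t) + integral {0..s} r)"
        unfolding y'_def using x abs_integrable_sub(2)[OF pg[OF cy], of 0 s] abs_integrable_sub(2)[OF r, of 0 s]
        by (simp add: hk_integral_add)
    qed
    also have "\<dots> = \<gamma> * of_real x + (K y x + integral {0..x} (\<lambda>s. integral {0..s} r))"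
    proof -
      have "integral {0..x} (\<lambda>s. \<gamma> + (integral {0..s} (\<lambda>t. p t * y t) + integral {0..s} r))
        = integral {0..x} (\<lambda>s. \<gamma>) + integral {0..x} (\<lambda>s. integral {0..s} (\<lambda>t. p t * y t) + integral {0..s} r)"
        by (intro hk_integral_add integrable_add i1) auto
      also have "integral {0..x} (\<lambda>s. integral {0..s} (\<lambda>t. p t * y t) + integral {0..s} r) = K y x + integral {0..x} (\<lambda>s. integral {0..s} r)"
        unfolding K_def by (intro hk_integral_add i1)
      finally show ?thesis using x by (simp add: scaleR_conv_of_real mult.commute)
    qed
    finally show "y x = y 0 + integral {0..x} y'"
      using y_eq[of x] y_eq[of 0] x b by (simp add: f0_def K_def)
  qed
  have "y 0 = \<alpha>" using y_eq[of 0] b by (simp add: f0_def K_def)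
  with 1 2 y'0 show ?thesis by blast
qed

text \<open>
  Gronwall's inequality for the equation integrated twice. With \<open>r = 0\<close> and zero initial data this is
  uniqueness; with small \<open>r\<close> it is continuous dependence.
\<close>

lemma forced_bound:
  assumes y: "ac_deriv b y y'" and y': "ac_deriv b y' (\<lambda>x. p x * y x + r x)"
    and p: "p absolutely_integrable_on {0..b}" and r: "r absolutely_integrable_on {0..b}"
    and b: "b \<le> 1" and x: "x \<in> {0..b}"
  defines "M \<equiv> (cmod (y 0) + cmod (y' 0) + integral {0..b} (\<lambda>t. cmod (r t))) * exp (integral {0..b} (\<lambda>t. cmod (p t)))"
  shows "cmod (y x) \<le> M"
    and "cmod (y' x) \<le> cmod (y' 0) + integral {0..b} (\<lambda>t. cmod (r t)) + integral {0..b} (\<lambda>t. cmod (p t)) * M"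
proof -
  have pn: "(\<lambda>t. cmod (p t)) absolutely_integrable_on {0..b}" using p by (simp add: absolutely_integrable_norm[unfolded o_def])
  have rn: "(\<lambda>t. cmod (r t)) absolutely_integrable_on {0..b}" using r by (simp add: absolutely_integrable_norm[unfolded o_def])
  have cy: "continuous_on {0..b} y" by (rule ac_deriv_continuous[OF y])
  have py: "(\<lambda>t. cmod (p t) * cmod (y t)) absolutely_integrable_on {0..b}"
    by (intro abs_integrable_mult_continuous pn continuous_intros cy)
  define A where "A = integral {0..b} (\<lambda>t. cmod (r t))"
  have mono: "integral {0..s} f \<le> integral {0..t} f"
    if "0 \<le> s" "s \<le> t" "t \<le> b" "f absolutely_integrable_on {0..b}" "\<And>x. f x \<ge> 0" for f :: "real \<Rightarrow> real" and s t
    by (rule integral_upper_mono[OF that(4,5,1,2,3)])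
  have y'b: "cmod (y' s) \<le> cmod (y' 0) + A + integral {0..s} (\<lambda>t. cmod (p t) * cmod (y t))" if s: "0 \<le> s" "s \<le> b" for s
  proof -
    have "cmod (y' s) \<le> cmod (y' 0) + cmod (integral {0..s} (\<lambda>x. p x * y x + r x))"
      by (subst ac_derivD[OF y' s]) (rule norm_triangle_ineq)
    moreover have "cmod (integral {0..s} (\<lambda>x. p x * y x + r x)) \<le> integral {0..s} (\<lambda>t. cmod (p t) * cmod (y t) + cmod (r t))"
    proof (rule hk_integral_norm_bound_integral)
      show "(\<lambda>x. p x * y x + r x) integrable_on {0..s}"
        using s abs_integrable_sub(2)[OF ac_deriv_integrable[OF y'], of 0 s] by auto
      show "(\<lambda>t. cmod (p t) * cmod (y t) + cmod (r t)) integrable_on {0..s}"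
        using s abs_integrable_sub(2)[OF py, of 0 s] abs_integrable_sub(2)[OF rn, of 0 s] by (intro integrable_add) auto
    qed (auto simp: norm_mult[symmetric] norm_triangle_ineq)
    moreover have "integral {0..s} (\<lambda>t. cmod (p t) * cmod (y t) + cmod (r t)) = integral {0..s} (\<lambda>t. cmod (p t) * cmod (y t)) + integral {0..s} (\<lambda>t. cmod (r t))"
      using s abs_integrable_sub(2)[OF py, of 0 s] abs_integrable_sub(2)[OF rn, of 0 s]
      by (intro hk_integral_add) auto
    moreover have "integral {0..s} (\<lambda>t. cmod (r t)) \<le> A" unfolding A_def by (intro mono s rn) auto
    ultimately show ?thesis by linarith
  qed
  have yb: "cmod (y x) \<le> (cmod (y 0) + cmod (y' 0) + A) + integral {0..x} (\<lambda>t. cmod (p t) * cmod (y t))" if x: "x \<in> {0..b}" for x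
  proof -
    have "cmod (integral {0..x} y') \<le> integral {0..x} (\<lambda>s. cmod (y' 0) + A + integral {0..x} (\<lambda>t. cmod (p t) * cmod (y t)))"
    proof (rule hk_integral_norm_bound_integral)
      show "y' integrable_on {0..x}" using abs_integrable_sub(2)[OF ac_deriv_integrable[OF y], of 0 x] x by auto
      fix s assume s: "s \<in> {0..x}"
      show "cmod (y' s) \<le> cmod (y' 0) + A + integral {0..x} (\<lambda>t. cmod (p t) * cmod (y t))"
        using y'b[of s] mono[of s x "\<lambda>t. cmod (p t) * cmod (y t)"] s x py by auto
    qed auto
    also have "\<dots> = x * (cmod (y' 0) + A + integral {0..x} (\<lambda>t. cmod (p t) * cmod (y t)))" using x by simp
    also have "\<dots> \<le> 1 * (cmod (y' 0) + A + integral {0..x} (\<lambda>t. cmod (p t) * cmod (y t)))"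
      using x b y'b[of x] norm_ge_zero[of "y' x"] by (intro mult_right_mono) (auto intro: order_trans simp del: norm_ge_zero)
    finally show ?thesis using ac_derivD[OF y, of x] x norm_triangle_ineq[of "y 0" "integral {0..x} y'"] by auto
  qed
  have A0: "A \<ge> 0" unfolding A_def using rn
    by (intro hk_integral_nonneg) (auto simp: absolutely_integrable_on_def)
  have M: "cmod (y x) \<le> M" if x: "x \<in> {0..b}" for x
  proof -
    have "cmod (y x) \<le> (cmod (y 0) + cmod (y' 0) + A) * exp (integral {0..x} (\<lambda>t. cmod (p t)))"
      using A0 by (intro gronwall[OF pn _ _ yb _ _ x] continuous_intros cy) auto
    also have "\<dots> \<le> M" unfolding M_def A_def[symmetric]
      using A0 mono[of x b "\<lambda>t. cmod (p t)"] x pn by (intro mult_left_mono) auto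
    finally show ?thesis .
  qed
  then show "cmod (y x) \<le> M" using x .
  have "integral {0..x} (\<lambda>t. cmod (p t) * cmod (y t)) \<le> integral {0..b} (\<lambda>t. cmod (p t) * cmod (y t))"
    using mono[of x b "\<lambda>t. cmod (p t) * cmod (y t)"] x py by auto
  also have "\<dots> \<le> integral {0..b} (\<lambda>t. cmod (p t) * M)"
    using py pn M by (intro integral_le integrable_on_mult_left mult_left_mono) (auto simp: absolutely_integrable_on_def)
  also have "\<dots> = integral {0..b} (\<lambda>t. cmod (p t)) * M" by simp
  finally show "cmod (y' x) \<le> cmod (y' 0) + integral {0..b} (\<lambda>t. cmod (r t)) + integral {0..b} (\<lambda>t. cmod (p t)) * M"
    using y'b[of x] x by (simp add: A_def)
qed

section \<open>Solutions of the Schroedinger equation and their dependence on the spectral parameter\<close>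

text \<open>
  The equation \<open>y'' = p y\<close>. The Schroedinger equation with spectral parameter \<open>z\<close> is the case
  \<open>p = q - z\<close>, and adding a constant to \<open>q\<close> and to \<open>z\<close> does not change it.
\<close>

definition sl_solution :: "real \<Rightarrow> (real \<Rightarrow> complex) \<Rightarrow> (real \<Rightarrow> complex) \<Rightarrow> (real \<Rightarrow> complex) \<Rightarrow> bool" where
  "sl_solution b p y y' \<longleftrightarrow> ac_deriv b y y' \<and> ac_deriv b y' (\<lambda>x. p x * y x)"

definition ivp :: "real \<Rightarrow> (real \<Rightarrow> complex) \<Rightarrow> complex \<Rightarrow> complex \<Rightarrow> (real \<Rightarrow> complex) \<times> (real \<Rightarrow> complex)" where
  "ivp b p \<alpha> \<gamma> = (SOME Y. sl_solution b p (fst Y) (snd Y) \<and> fst Y 0 = \<alpha> \<and> snd Y 0 = \<gamma>)"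

abbreviation "ivp_val b p \<alpha> \<gamma> \<equiv> fst (ivp b p \<alpha> \<gamma>)"
abbreviation "ivp_der b p \<alpha> \<gamma> \<equiv> snd (ivp b p \<alpha> \<gamma>)"

lemma ivp_solution:
  assumes p: "p absolutely_integrable_on {0..b}" and b: "0 \<le> b" "b \<le> 1"
  shows "sl_solution b p (ivp_val b p \<alpha> \<gamma>) (ivp_der b p \<alpha> \<gamma>)"
    and "ivp_val b p \<alpha> \<gamma> 0 = \<alpha>" and "ivp_der b p \<alpha> \<gamma> 0 = \<gamma>"
proof -
  obtain y y' where "ac_deriv b y y'" "ac_deriv b y' (\<lambda>x. p x * y x + 0)" "y 0 = \<alpha>" "y' 0 = \<gamma>"
    using forced_ivp_exists[OF p _ b, of "\<lambda>_. 0" \<alpha> \<gamma>] by auto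
  then have "\<exists>Y. sl_solution b p (fst Y) (snd Y) \<and> fst Y 0 = \<alpha> \<and> snd Y 0 = \<gamma>"
    by (intro exI[of _ "(y, y')"]) (simp add: sl_solution_def)
  from someI_ex[OF this] show "sl_solution b p (ivp_val b p \<alpha> \<gamma>) (ivp_der b p \<alpha> \<gamma>)"
    "ivp_val b p \<alpha> \<gamma> 0 = \<alpha>" "ivp_der b p \<alpha> \<gamma> 0 = \<gamma>"
    by (auto simp: ivp_def)
qed

lemma sl_solution_continuous:
  assumes "sl_solution b p y y'"
  shows "continuous_on {0..b} y" "continuous_on {0..b} y'"
  using assms ac_deriv_continuous unfolding sl_solution_def by blast+

lemma sl_solution_linear:
  assumes "sl_solution b p y y'" "sl_solution b p u u'"
  shows "sl_solution b p (\<lambda>x. c * y x + d * u x) (\<lambda>x. c * y' x + d * u' x)"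
  unfolding sl_solution_def
proof
  show "ac_deriv b (\<lambda>x. c * y x + d * u x) (\<lambda>x. c * y' x + d * u' x)"
    using assms by (intro ac_deriv_linear) (auto simp: sl_solution_def)
  show "ac_deriv b (\<lambda>x. c * y' x + d * u' x) (\<lambda>x. p x * (c * y x + d * u x))"
  proof (rule ac_deriv_cong)
    show "ac_deriv b (\<lambda>x. c * y' x + d * u' x) (\<lambda>x. c * (p x * y x) + d * (p x * u x))"
      using assms by (intro ac_deriv_linear) (auto simp: sl_solution_def)
  qed (auto simp: algebra_simps)
qed

lemma sl_solution_cnj:
  assumes "sl_solution b p y y'"
  shows "sl_solution b (\<lambda>x. cnj (p x)) (\<lambda>x. cnj (y x)) (\<lambda>x. cnj (y' x))"
  using assms ac_deriv_cnj[of b y y'] ac_deriv_cnj[of b y' "\<lambda>x. p x * y x"]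
  by (simp add: sl_solution_def)

lemma sl_solution_unique:
  assumes y: "sl_solution b p y y'" and u: "sl_solution b p u u'"
    and p: "p absolutely_integrable_on {0..b}" and b: "b \<le> 1" and init: "y 0 = u 0" "y' 0 = u' 0"
    and x: "x \<in> {0..b}"
  shows "y x = u x" "y' x = u' x"
proof -
  have s: "sl_solution b p (\<lambda>x. 1 * y x + (-1) * u x) (\<lambda>x. 1 * y' x + (-1) * u' x)"
    by (rule sl_solution_linear[OF y u])
  have z: "(\<lambda>x. 0 :: complex) absolutely_integrable_on {0..b}" by simp
  from s have "ac_deriv b (\<lambda>x. y x - u x) (\<lambda>x. y' x - u' x)" "ac_deriv b (\<lambda>x. y' x - u' x) (\<lambda>x. p x * (y x - u x) + 0)"
    by (auto simp: sl_solution_def)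
  from forced_bound[OF this p z b x] init show "y x = u x" "y' x = u' x" by auto
qed

text \<open>
  The common source of the conservation of the Wronskian (equal coefficients), of the variation of
  constants formula (one coefficient constant), of the Lagrange identity (coefficients differing by a
  constant), and of the formula comparing two potentials.
\<close>

lemma wronskian_deriv:
  assumes y: "sl_solution b p y y'" and u: "sl_solution b q u u'"
  shows "ac_deriv b (\<lambda>x. y x * u' x - y' x * u x) (\<lambda>x. (q x - p x) * (y x * u x))"
proof -
  have 1: "ac_deriv b (\<lambda>x. y x * u' x) (\<lambda>x. y' x * u' x + (q x * u x) * y x)"
    using y u by (intro ac_deriv_mult) (auto simp: sl_solution_def)
  have 2: "ac_deriv b (\<lambda>x. y' x * u x) (\<lambda>x. (p x * y x) * u x + u' x * y' x)"
    using y u by (intro ac_deriv_mult) (auto simp: sl_solution_def)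
  show ?thesis
    by (rule ac_deriv_cong[OF ac_deriv_linear[OF 1 2, of 1 "-1"]]) (auto simp: algebra_simps)
qed

lemma wronskian_const:
  assumes y: "sl_solution b p y y'" and u: "sl_solution b p u u'" and x: "x \<in> {0..b}"
  shows "y x * u' x - y' x * u x = y 0 * u' 0 - y' 0 * u 0"
  using ac_derivD[OF wronskian_deriv[OF y u], of x] x by simp

lemma sl_solution_restrict: "sl_solution b p y y' \<Longrightarrow> a \<le> b \<Longrightarrow> sl_solution a p y y'"
  unfolding sl_solution_def by (auto intro: ac_deriv_restrict)

lemma sl_solution_reflect:
  assumes "sl_solution b p y y'" "0 \<le> b"
  shows "sl_solution b (\<lambda>t. p (b - t)) (\<lambda>t. y (b - t)) (\<lambda>t. - y' (b - t))"
proof -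
  have 1: "ac_deriv b (\<lambda>x. y (b - x)) (\<lambda>x. - y' (b - x))"
    and 2: "ac_deriv b (\<lambda>x. y' (b - x)) (\<lambda>x. - (p (b - x) * y (b - x)))"
    using assms ac_deriv_reflect unfolding sl_solution_def by blast+
  have "ac_deriv b (\<lambda>x. - y' (b - x)) (\<lambda>x. p (b - x) * y (b - x))"
    by (rule ac_deriv_cong[OF ac_deriv_linear[OF 2 2, of "-1" 0]]) auto
  with 1 show ?thesis by (simp add: sl_solution_def)
qed

lemma abs_integrable_minus_const:
  fixes q :: "real \<Rightarrow> complex"
  assumes "q absolutely_integrable_on {0..b}"
  shows "(\<lambda>x. q x - z) absolutely_integrable_on {0..b}"
  using assms by (intro set_integral_diff) (auto intro: absolutely_integrable_continuous_real)

lemma tendsto_if_linear_bound: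
  fixes g :: "complex \<Rightarrow> complex"
  assumes "\<And>z. z \<noteq> w \<Longrightarrow> cmod (z - w) \<le> 1 \<Longrightarrow> cmod (g z - L) \<le> C * cmod (z - w)"
  shows "(g \<longlongrightarrow> L) (at w)"
proof -
  have "((\<lambda>z. g z - L) \<longlongrightarrow> 0) (at w)"
  proof (rule Lim_null_comparison)
    have "eventually (\<lambda>z. dist z w < 1 \<and> z \<noteq> w) (at w)" by (auto simp: eventually_at intro!: exI[of _ 1])
    then show "eventually (\<lambda>z. cmod (g z - L) \<le> C * cmod (z - w)) (at w)"
      by eventually_elim (auto simp: dist_norm intro!: assms)
    show "((\<lambda>z. C * cmod (z - w)) \<longlongrightarrow> 0) (at w)" by (auto intro!: tendsto_eq_intros)
  qed
  then show ?thesis by (simp add: LIM_zero_iff)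
qed

text \<open>
  The difference of the solutions for \<open>z\<close> and \<open>w\<close> solves the equation for \<open>w\<close> with a forcing term of
  size \<open>\<bar>z - w\<bar>\<close>.
\<close>

lemma ivp_lipschitz_in_z:
  fixes q :: "real \<Rightarrow> complex"
  assumes q: "q absolutely_integrable_on {0..b}" and b: "0 \<le> b" "b \<le> 1"
  obtains C where "C \<ge> 0" "\<And>z x. cmod (z - w) \<le> 1 \<Longrightarrow> x \<in> {0..b} \<Longrightarrow>
     cmod (ivp_val b (\<lambda>x. q x - z) \<alpha> \<gamma> x - ivp_val b (\<lambda>x. q x - w) \<alpha> \<gamma> x) \<le> C * cmod (z - w)"
proof -
  define Y where "Y z = ivp_val b (\<lambda>x. q x - z) \<alpha> \<gamma>" for z
  define Y' where "Y' z = ivp_der b (\<lambda>x. q x - z) \<alpha> \<gamma>" for z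
  have qz: "(\<lambda>x. q x - z) absolutely_integrable_on {0..b}" for z by (rule abs_integrable_minus_const[OF q])
  have Y: "sl_solution b (\<lambda>x. q x - z) (Y z) (Y' z)" "Y z 0 = \<alpha>" "Y' z 0 = \<gamma>" for z
    using ivp_solution[OF qz b] by (auto simp: Y_def Y'_def)
  define Q where "Q = integral {0..b} (\<lambda>t. cmod (q t))"
  have Qz: "integral {0..b} (\<lambda>t. cmod (q t - z)) \<le> Q + cmod z" for z
  proof -
    have "integral {0..b} (\<lambda>t. cmod (q t - z)) \<le> integral {0..b} (\<lambda>t. cmod (q t) + cmod z)"
      using q qz[of z] by (intro integral_le integrable_add) (auto simp: absolutely_integrable_on_def norm_triangle_ineq4)
    also have "\<dots> = Q + b * cmod z" unfolding Q_def using q b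
      by (subst hk_integral_add) (auto simp: absolutely_integrable_on_def)
    also have "b * cmod z \<le> cmod z" using b by (simp add: mult_left_le_one_le)
    finally show ?thesis by simp
  qed
  define M where "M = (cmod \<alpha> + cmod \<gamma>) * exp (Q + (cmod w + 1))"
  have M: "cmod (Y z x) \<le> M" if "cmod (z - w) \<le> 1" "x \<in> {0..b}" for z x
  proof -
    have "cmod (Y z x) \<le> (cmod \<alpha> + cmod \<gamma>) * exp (integral {0..b} (\<lambda>t. cmod (q t - z)))"
      using forced_bound(1)[of b "Y z" "Y' z" "\<lambda>x. q x - z" "\<lambda>_. 0" x] Y[of z] qz b that by (simp add: sl_solution_def)
    also have "\<dots> \<le> M" unfolding M_def
    proof (intro mult_left_mono)
      have "cmod z \<le> cmod w + 1" using that norm_triangle_ineq2[of z w] by linarith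
      then show "exp (integral {0..b} (\<lambda>t. cmod (q t - z))) \<le> exp (Q + (cmod w + 1))" using Qz[of z] by simp
    qed auto
    finally show ?thesis .
  qed
  define C where "C = M * exp (Q + cmod w)"
  have M0: "M \<ge> 0" by (simp add: M_def)
  show ?thesis
  proof (rule that[of C])
    show "C \<ge> 0" using M0 by (simp add: C_def)
    fix z x assume zx: "cmod (z - w) \<le> 1" "x \<in> {0..b}"
    define d where "d x = Y z x - Y w x" for x
    define d' where "d' x = Y' z x - Y' w x" for x
    define r where "r x = (w - z) * Y z x" for x
    have cr: "continuous_on {0..b} r" unfolding r_def by (intro continuous_intros sl_solution_continuous(1)[OF Y(1)])
    have ri: "r absolutely_integrable_on {0..b}" by (rule absolutely_integrable_continuous_real[OF cr])
    have 1: "ac_deriv b d d'"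
      using Y(1)[of z] Y(1)[of w] unfolding sl_solution_def d_def d'_def
      by (auto intro: ac_deriv_cong[OF ac_deriv_linear[of b "Y z" "Y' z" "Y w" "Y' w" 1 "-1"]])
    have 2: "ac_deriv b d' (\<lambda>x. (q x - w) * d x + r x)"
    proof (rule ac_deriv_cong)
      show "ac_deriv b (\<lambda>x. 1 * Y' z x + (-1) * Y' w x) (\<lambda>x. 1 * ((q x - z) * Y z x) + (-1) * ((q x - w) * Y w x))"
        using Y(1)[of z] Y(1)[of w] unfolding sl_solution_def by (intro ac_deriv_linear) auto
    qed (auto simp: d_def d'_def r_def algebra_simps)
    have "integral {0..b} (\<lambda>t. cmod (r t)) \<le> integral {0..b} (\<lambda>t. cmod (z - w) * M)"
      using cr M[OF zx(1)] sl_solution_continuous(1)[OF Y(1)]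
      by (intro integral_le) (auto simp: r_def norm_mult norm_minus_commute intro!: mult_left_mono integrable_continuous_real continuous_intros)
    also have "\<dots> = b * (cmod (z - w) * M)" using b by simp
    also have "\<dots> \<le> 1 * (cmod (z - w) * M)" using b M0 by (intro mult_right_mono) auto
    finally have R: "integral {0..b} (\<lambda>t. cmod (r t)) \<le> cmod (z - w) * M" by simp
    have "cmod (d x) \<le> integral {0..b} (\<lambda>t. cmod (r t)) * exp (integral {0..b} (\<lambda>t. cmod (q t - w)))"
      using forced_bound(1)[OF 1 2 qz ri b(2) zx(2)] by (simp add: d_def d'_def Y)
    also have "\<dots> \<le> (cmod (z - w) * M) * exp (Q + cmod w)"
      using R Qz[of w] M0 by (intro mult_mono) auto
    finally show "cmod (ivp_val b (\<lambda>x. q x - z) \<alpha> \<gamma> x - ivp_val b (\<lambda>x. q x - w) \<alpha> \<gamma> x) \<le> C * cmod (z - w)"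
      by (simp add: C_def d_def Y_def mult_ac)
  qed
qed

text \<open>
  The derivative at \<open>w\<close> is the solution \<open>D\<close> of \<open>D'' = (q - w) D - y\<^sub>w\<close> with zero initial data: the
  difference quotient minus \<open>D\<close> solves the same equation with the forcing \<open>y\<^sub>w - y\<^sub>z\<close>, which is
  \<open>O(\<bar>z - w\<bar>)\<close>.
\<close>

lemma ivp_holomorphic:
  fixes q :: "real \<Rightarrow> complex"
  assumes q: "q absolutely_integrable_on {0..b}" and b: "0 \<le> b" "b \<le> 1" and x: "x \<in> {0..b}"
  shows "(\<lambda>z. ivp_val b (\<lambda>x. q x - z) \<alpha> \<gamma> x) holomorphic_on A"
    and "(\<lambda>z. ivp_der b (\<lambda>x. q x - z) \<alpha> \<gamma> x) holomorphic_on A"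
proof -
  define Y where "Y z = ivp_val b (\<lambda>x. q x - z) \<alpha> \<gamma>" for z
  define Y' where "Y' z = ivp_der b (\<lambda>x. q x - z) \<alpha> \<gamma>" for z
  have qz: "(\<lambda>x. q x - z) absolutely_integrable_on {0..b}" for z by (rule abs_integrable_minus_const[OF q])
  have Y: "sl_solution b (\<lambda>x. q x - z) (Y z) (Y' z)" "Y z 0 = \<alpha>" "Y' z 0 = \<gamma>" for z
    using ivp_solution[OF qz b] by (auto simp: Y_def Y'_def)
  have "\<exists>D. ((\<lambda>z. Y z x) has_field_derivative fst D) (at w) \<and> ((\<lambda>z. Y' z x) has_field_derivative snd D) (at w)" for w
  proof -
    have cY: "continuous_on {0..b} (Y z)" for z using sl_solution_continuous Y by blast
    have "(\<lambda>x. - Y w x) absolutely_integrable_on {0..b}"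
      by (intro absolutely_integrable_continuous_real continuous_intros cY)
    then obtain D D' where D: "ac_deriv b D D'" "ac_deriv b D' (\<lambda>x. (q x - w) * D x + - Y w x)" "D 0 = 0" "D' 0 = 0"
      using forced_ivp_exists[OF qz[of w] _ b] by blast
    obtain C where C: "C \<ge> 0" "\<And>z x. cmod (z - w) \<le> 1 \<Longrightarrow> x \<in> {0..b} \<Longrightarrow> cmod (Y z x - Y w x) \<le> C * cmod (z - w)"
      using ivp_lipschitz_in_z[OF q b, of w \<alpha> \<gamma>] unfolding Y_def by blast
    define I where "I = integral {0..b} (\<lambda>t. cmod (q t - w))"
    have I0: "I \<ge> 0" unfolding I_def using qz[of w]
      by (intro hk_integral_nonneg) (auto simp: absolutely_integrable_on_def)
    have est: "cmod ((Y z x - Y w x) / (z - w) - D x) \<le> (C * exp I) * cmod (z - w) \<and>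
               cmod ((Y' z x - Y' w x) / (z - w) - D' x) \<le> (C + I * (C * exp I)) * cmod (z - w)"
      if zw: "z \<noteq> w" "cmod (z - w) \<le> 1" for z
    proof -
      define c where "c = 1 / (z - w)"
      have c: "c * (z - w) = 1" using zw by (simp add: c_def)
      define E where "E x = c * Y z x + (- c) * Y w x - D x" for x
      define E' where "E' x = c * Y' z x + (- c) * Y' w x - D' x" for x
      define r where "r x = Y w x - Y z x" for x
      have cr: "continuous_on {0..b} r" unfolding r_def by (intro continuous_intros cY)
      have ri: "r absolutely_integrable_on {0..b}" by (rule absolutely_integrable_continuous_real[OF cr])
      have l1: "ac_deriv b (\<lambda>x. c * Y z x + (- c) * Y w x) (\<lambda>x. c * Y' z x + (- c) * Y' w x)"
        using Y(1)[of z] Y(1)[of w] unfolding sl_solution_def by (intro ac_deriv_linear) auto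
      have 1: "ac_deriv b E E'"
        by (rule ac_deriv_cong[OF ac_deriv_linear[OF l1 D(1), of 1 "-1"]]) (auto simp: E_def E'_def)
      have l2: "ac_deriv b (\<lambda>x. c * Y' z x + (- c) * Y' w x) (\<lambda>x. c * ((q x - z) * Y z x) + (- c) * ((q x - w) * Y w x))"
        using Y(1)[of z] Y(1)[of w] unfolding sl_solution_def by (intro ac_deriv_linear) auto
      have 2: "ac_deriv b E' (\<lambda>x. (q x - w) * E x + r x)"
      proof (rule ac_deriv_cong[OF ac_deriv_linear[OF l2 D(2), of 1 "-1"]])
        fix x
        have "c * ((q x - z) * Y z x) = (q x - w) * (c * Y z x) - (c * (z - w)) * Y z x" by (simp add: algebra_simps)
        then show "1 * (c * ((q x - z) * Y z x) + - c * ((q x - w) * Y w x)) + - 1 * ((q x - w) * D x + - Y w x) = (q x - w) * E x + r x"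
          unfolding c E_def r_def by (simp add: algebra_simps)
      qed (auto simp: E'_def)
      have "integral {0..b} (\<lambda>t. cmod (r t)) \<le> integral {0..b} (\<lambda>t. C * cmod (z - w))"
        using cr C(2)[OF zw(2)]
        by (intro integral_le) (auto simp: r_def norm_minus_commute intro!: integrable_continuous_real continuous_intros)
      also have "\<dots> = b * (C * cmod (z - w))" using b by simp
      also have "\<dots> \<le> 1 * (C * cmod (z - w))" using b C(1) by (intro mult_right_mono) auto
      finally have R: "integral {0..b} (\<lambda>t. cmod (r t)) \<le> C * cmod (z - w)" by simp
      have E0: "E 0 = 0" "E' 0 = 0" by (auto simp: E_def E'_def Y D)
      have R2: "integral {0..b} (\<lambda>t. cmod (r t)) * exp I \<le> (C * cmod (z - w)) * exp I"
        using R by (intro mult_right_mono) auto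
      have "cmod (E x) \<le> integral {0..b} (\<lambda>t. cmod (r t)) * exp I"
        using forced_bound(1)[OF 1 2 qz ri b(2) x] E0 by (simp add: I_def)
      moreover have "cmod (E' x) \<le> integral {0..b} (\<lambda>t. cmod (r t)) + I * (integral {0..b} (\<lambda>t. cmod (r t)) * exp I)"
        using forced_bound(2)[OF 1 2 qz ri b(2) x] E0 by (simp add: I_def)
      moreover have "I * (integral {0..b} (\<lambda>t. cmod (r t)) * exp I) \<le> I * ((C * cmod (z - w)) * exp I)"
        using I0 R2 by (intro mult_left_mono)
      moreover have "(C * exp I) * cmod (z - w) = (C * cmod (z - w)) * exp I"
        "(C + I * (C * exp I)) * cmod (z - w) = C * cmod (z - w) + I * ((C * cmod (z - w)) * exp I)"
        by (auto simp: algebra_simps)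
      ultimately have "cmod (E x) \<le> (C * exp I) * cmod (z - w) \<and> cmod (E' x) \<le> (C + I * (C * exp I)) * cmod (z - w)"
        using R R2 by (intro conjI) linarith+
      moreover have "E x = (Y z x - Y w x) / (z - w) - D x" "E' x = (Y' z x - Y' w x) / (z - w) - D' x"
        by (auto simp: E_def E'_def c_def diff_divide_distrib)
      ultimately show ?thesis by (simp only:)
    qed
    have "((\<lambda>z. Y z x) has_field_derivative D x) (at w)"
      unfolding has_field_derivative_iff using est by (intro tendsto_if_linear_bound) blast
    moreover have "((\<lambda>z. Y' z x) has_field_derivative D' x) (at w)"
      unfolding has_field_derivative_iff using est by (intro tendsto_if_linear_bound) blast
    ultimately show ?thesis by (intro exI[of _ "(D x, D' x)"]) auto
  qed
  then have "(\<lambda>z. Y z x) field_differentiable (at w)" "(\<lambda>z. Y' z x) field_differentiable (at w)" for w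
    by (auto simp: field_differentiable_def)
  then show "(\<lambda>z. ivp_val b (\<lambda>x. q x - z) \<alpha> \<gamma> x) holomorphic_on A"
     "(\<lambda>z. ivp_der b (\<lambda>x. q x - z) \<alpha> \<gamma> x) holomorphic_on A"
    by (auto simp: holomorphic_on_def Y_def Y'_def intro: field_differentiable_at_within)
qed

section \<open>Growth in the spectral parameter\<close>

lemma norm_sin_cos_le_exp_Im:
  shows "cmod (sin w) \<le> exp \<bar>Im w\<bar>" "cmod (cos w) \<le> exp \<bar>Im w\<bar>"
proof -
  have e: "cmod (exp (\<i> * w)) \<le> exp \<bar>Im w\<bar>" "cmod (exp (- (\<i> * w))) \<le> exp \<bar>Im w\<bar>" by auto
  have "cmod (exp (\<i> * w) - exp (- (\<i> * w))) \<le> exp \<bar>Im w\<bar> + exp \<bar>Im w\<bar>"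
    by (rule order_trans[OF norm_triangle_ineq4]) (use e in linarith)
  then show "cmod (sin w) \<le> exp \<bar>Im w\<bar>" by (simp add: sin_exp_eq norm_divide norm_mult)
  have "cmod (exp (\<i> * w) + exp (- (\<i> * w))) \<le> exp \<bar>Im w\<bar> + exp \<bar>Im w\<bar>"
    by (rule order_trans[OF norm_triangle_ineq]) (use e in linarith)
  then show "cmod (cos w) \<le> exp \<bar>Im w\<bar>" by (simp add: cos_exp_eq norm_divide)
qed

text \<open>
  Variation of constants: the Wronskian with the free solutions \<open>sin (k (x - t)) / k\<close> and
  \<open>cos (k (x - t))\<close>, as functions of \<open>t\<close>, integrated from \<open>0\<close> to \<open>x\<close>.
\<close>

lemma
  assumes k: "k \<noteq> 0" and y: "sl_solution b (\<lambda>t. q t - k\<^sup>2) y y'" and x: "0 \<le> x" "x \<le> b"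
  shows solution_volterra: "y x = y 0 * cos (k * of_real x) + y' 0 * sin (k * of_real x) / k
            + integral {0..x} (\<lambda>t. q t * y t * (sin (k * of_real (x - t)) / k))"
    and solution_deriv_volterra: "y' x = y' 0 * cos (k * of_real x) - y 0 * k * sin (k * of_real x)
            + integral {0..x} (\<lambda>t. q t * y t * cos (k * of_real (x - t)))"
proof -
  have yx: "sl_solution x (\<lambda>t. q t - k\<^sup>2) y y'" by (rule sl_solution_restrict[OF y x(2)])
  define S where "S t = sin (k * of_real (x - t)) / k" for t
  define C where "C t = cos (k * of_real (x - t))" for t
  have dS: "ac_deriv x S (\<lambda>t. - C t)"
    unfolding S_def C_def
  proof (rule ac_deriv_C1)
    fix t
    have "((\<lambda>s. sin (k * (of_real x - s)) / k) has_field_derivative - cos (k * (of_real x - of_real t))) (at (of_real t))"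
      using k by (auto intro!: derivative_eq_intros)
    from has_vector_derivative_real_field[OF this]
    show "((\<lambda>t. sin (k * of_real (x - t)) / k) has_vector_derivative - cos (k * complex_of_real (x - t))) (at t within {0..x})"
      by (simp add: o_def)
  qed (use k in \<open>auto intro!: continuous_intros\<close>)
  have dC: "ac_deriv x C (\<lambda>t. k\<^sup>2 * S t)"
    unfolding S_def C_def
  proof (rule ac_deriv_C1)
    fix t
    have "((\<lambda>s. cos (k * (of_real x - s))) has_field_derivative (k\<^sup>2 * (sin (k * (of_real x - of_real t)) / k))) (at (of_real t))"
      using k by (auto intro!: derivative_eq_intros simp: power2_eq_square)
    from has_vector_derivative_real_field[OF this]
    show "((\<lambda>t. cos (k * of_real (x - t))) has_vector_derivative (k\<^sup>2 * (sin (k * complex_of_real (x - t)) / k))) (at t within {0..x})"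
      by (simp add: o_def)
  qed (use k in \<open>auto intro!: continuous_intros\<close>)
  have S: "sl_solution x (\<lambda>t. - (k\<^sup>2)) S (\<lambda>t. - C t)"
    unfolding sl_solution_def using dS ac_deriv_cong[OF ac_deriv_linear[OF dC dC, of "-1" 0], of "\<lambda>t. - C t" "\<lambda>t. - (k\<^sup>2) * S t"] by simp
  have C: "sl_solution x (\<lambda>t. - (k\<^sup>2)) C (\<lambda>t. k\<^sup>2 * S t)"
    unfolding sl_solution_def using dC ac_deriv_cong[OF ac_deriv_linear[OF dS dS, of "k\<^sup>2" 0], of "\<lambda>t. k\<^sup>2 * S t" "\<lambda>t. - (k\<^sup>2) * C t"] by simp
  have "y x * (- C x) - y' x * S x = y 0 * (- C 0) - y' 0 * S 0 + integral {0..x} (\<lambda>t. (- (k\<^sup>2) - (q t - k\<^sup>2)) * (y t * S t))"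
    by (rule ac_derivD[OF wronskian_deriv[OF yx S]]) (use x in auto)
  moreover have "integral {0..x} (\<lambda>t. (- (k\<^sup>2) - (q t - k\<^sup>2)) * (y t * S t)) = - integral {0..x} (\<lambda>t. q t * y t * S t)"
    by (simp add: mult_ac flip: hk_integral_neg)
  ultimately show "y x = y 0 * cos (k * of_real x) + y' 0 * sin (k * of_real x) / k
            + integral {0..x} (\<lambda>t. q t * y t * (sin (k * of_real (x - t)) / k))"
    by (simp add: S_def C_def algebra_simps)
  have "y x * (k\<^sup>2 * S x) - y' x * C x = y 0 * (k\<^sup>2 * S 0) - y' 0 * C 0 + integral {0..x} (\<lambda>t. (- (k\<^sup>2) - (q t - k\<^sup>2)) * (y t * C t))"
    by (rule ac_derivD[OF wronskian_deriv[OF yx C]]) (use x in auto)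
  moreover have "integral {0..x} (\<lambda>t. (- (k\<^sup>2) - (q t - k\<^sup>2)) * (y t * C t)) = - integral {0..x} (\<lambda>t. q t * y t * C t)"
    by (simp add: mult_ac flip: hk_integral_neg)
  ultimately show "y' x = y' 0 * cos (k * of_real x) - y 0 * k * sin (k * of_real x)
            + integral {0..x} (\<lambda>t. q t * y t * cos (k * of_real (x - t)))"
    using k by (simp add: S_def C_def algebra_simps power2_eq_square)
qed

text \<open>
  Gronwall's inequality for \<open>\<psi>(x) = \<bar>y(x)\<bar> exp (- \<bar>Im k\<bar> x)\<close>: the free solutions occurring in the Volterra
  equation grow no faster than \<open>exp (\<bar>Im k\<bar> (x - t))\<close>. Inserting the bound into the equation once more
  shows how far \<open>y\<close> and \<open>y'\<close> are from the free solution.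
\<close>

lemma
  assumes q: "q absolutely_integrable_on {0..b}" and k: "cmod k \<ge> 1"
    and y: "sl_solution b (\<lambda>t. q t - k\<^sup>2) y y'" and x: "x \<in> {0..b}"
  defines "Q \<equiv> integral {0..b} (\<lambda>t. cmod (q t))"
  defines "M \<equiv> (cmod (y 0) + cmod (y' 0) / cmod k) * exp Q"
  shows solution_growth: "cmod (y x) \<le> M * exp (\<bar>Im k\<bar> * x)"
    and solution_near_cos: "cmod (y x - y 0 * cos (k * of_real x)) \<le> (cmod (y' 0) + Q * M) / cmod k * exp (\<bar>Im k\<bar> * x)"
    and solution_deriv_near_sin: "cmod (y' x + y 0 * k * sin (k * of_real x)) \<le> (cmod (y' 0) + Q * M) * exp (\<bar>Im k\<bar> * x)"
proof -
  define \<tau> where "\<tau> = \<bar>Im k\<bar>"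
  have k0: "k \<noteq> 0" "cmod k > 0" using k by auto
  have cy: "continuous_on {0..b} y" using sl_solution_continuous y by blast
  have qn: "(\<lambda>t. cmod (q t)) absolutely_integrable_on {0..b}" using q by (simp add: absolutely_integrable_norm[unfolded o_def])
  have cnk: "cmod (cos (k * of_real s)) \<le> exp (\<tau> * s)" "cmod (sin (k * of_real s)) \<le> exp (\<tau> * s)"
    "cmod (sin (k * of_real s) / k) \<le> exp (\<tau> * s) / cmod k" "cmod (sin (k * of_real s) / k) \<le> exp (\<tau> * s)"
    if "s \<ge> 0" for s
  proof -
    show *: "cmod (cos (k * of_real s)) \<le> exp (\<tau> * s)" "cmod (sin (k * of_real s)) \<le> exp (\<tau> * s)"
      using norm_sin_cos_le_exp_Im[of "k * of_real s"] that by (auto simp: \<tau>_def abs_mult)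
    then show "cmod (sin (k * of_real s) / k) \<le> exp (\<tau> * s) / cmod k"
      by (simp add: norm_divide divide_right_mono)
    also have "\<dots> \<le> exp (\<tau> * s) / 1" using k by (intro divide_left_mono) auto
    finally show "cmod (sin (k * of_real s) / k) \<le> exp (\<tau> * s)" by simp
  qed
  define \<psi> where "\<psi> t = cmod (y t) * exp (- \<tau> * t)" for t
  have c\<psi>: "continuous_on {0..b} \<psi>" unfolding \<psi>_def by (intro continuous_intros cy)
  have q\<psi>: "(\<lambda>t. cmod (q t) * \<psi> t) absolutely_integrable_on {0..b}"
    by (intro abs_integrable_mult_continuous qn c\<psi>)
  have qyT: "cmod (integral {0..x} (\<lambda>t. q t * y t * T (x - t))) \<le> c * exp (\<tau> * x) * integral {0..x} (\<lambda>t. cmod (q t) * \<psi> t)"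
    if T: "\<And>s. s \<ge> 0 \<Longrightarrow> cmod (T s) \<le> exp (\<tau> * s) * c" and cT: "continuous_on UNIV T" and x: "x \<in> {0..b}" for T :: "real \<Rightarrow> complex" and c x
  proof -
    have "cmod (integral {0..x} (\<lambda>t. q t * y t * T (x - t))) \<le> integral {0..x} (\<lambda>t. c * exp (\<tau> * x) * (cmod (q t) * \<psi> t))"
    proof (rule hk_integral_norm_bound_integral)
      have "continuous_on {0..b} (\<lambda>t. y t * T (x - t))"
        by (intro continuous_intros cy continuous_on_compose2[OF cT]) auto
      from abs_integrable_mult_continuous[OF q this]
      show "(\<lambda>t. q t * y t * T (x - t)) integrable_on {0..x}"
        using abs_integrable_sub(2)[of b "\<lambda>t. q t * (y t * T (x - t))" 0 x] x by (simp add: mult.assoc)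
      show "(\<lambda>t. c * exp (\<tau> * x) * (cmod (q t) * \<psi> t)) integrable_on {0..x}"
        using abs_integrable_sub(2)[OF q\<psi>, of 0 x] x by (intro integrable_on_mult_right) auto
      fix t assume t: "t \<in> {0..x}"
      have "cmod (q t * y t * T (x - t)) = cmod (q t) * cmod (y t) * cmod (T (x - t))" by (simp add: norm_mult)
      also have "\<dots> \<le> cmod (q t) * cmod (y t) * (exp (\<tau> * (x - t)) * c)"
        using T[of "x - t"] t by (intro mult_left_mono) auto
      also have "\<dots> = c * exp (\<tau> * x) * (cmod (q t) * \<psi> t)"
        by (simp add: \<psi>_def exp_diff exp_minus right_diff_distrib divide_inverse mult_ac)
      finally show "cmod (q t * y t * T (x - t)) \<le> c * exp (\<tau> * x) * (cmod (q t) * \<psi> t)" .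
    qed
    then show ?thesis by simp
  qed
  define A where "A = cmod (y 0) + cmod (y' 0) / cmod k"
  have cont_sin: "continuous_on UNIV (\<lambda>s::real. sin (k * of_real s) / k)" using k0 by (intro continuous_intros) auto
  have cont_cos: "continuous_on UNIV (\<lambda>s::real. cos (k * of_real s))" by (intro continuous_intros)
  have \<psi>le: "\<psi> x \<le> A + integral {0..x} (\<lambda>t. cmod (q t) * \<psi> t)" if x: "x \<in> {0..b}" for x
  proof -
    have xx: "0 \<le> x" "x \<le> b" using x by auto
    have "cmod (y x) \<le> cmod (y 0 * cos (k * of_real x)) + cmod (y' 0 * (sin (k * of_real x) / k))
       + cmod (integral {0..x} (\<lambda>t. q t * y t * (sin (k * of_real (x - t)) / k)))"
      by (subst solution_volterra[OF k0(1) y xx]) (auto intro!: order_trans[OF norm_triangle_ineq] add_mono simp: norm_triangle_ineq)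
    also have "cmod (y 0 * cos (k * of_real x)) \<le> cmod (y 0) * exp (\<tau> * x)"
      using cnk xx by (simp add: norm_mult mult_left_mono)
    also have "cmod (y' 0 * (sin (k * of_real x) / k)) \<le> cmod (y' 0) * (exp (\<tau> * x) / cmod k)"
      unfolding norm_mult using cnk(3)[of x] xx by (intro mult_left_mono) auto
    also have "cmod (integral {0..x} (\<lambda>t. q t * y t * (sin (k * of_real (x - t)) / k))) \<le> 1 * exp (\<tau> * x) * integral {0..x} (\<lambda>t. cmod (q t) * \<psi> t)"
      using qyT[of "\<lambda>s. sin (k * of_real s) / k" 1 x] cnk(4) cont_sin x by simp
    finally have "cmod (y x) \<le> exp (\<tau> * x) * (A + integral {0..x} (\<lambda>t. cmod (q t) * \<psi> t))"
      by (simp add: A_def algebra_simps)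
    then have "exp (- \<tau> * x) * cmod (y x) \<le> exp (- \<tau> * x) * (exp (\<tau> * x) * (A + integral {0..x} (\<lambda>t. cmod (q t) * \<psi> t)))"
      by (intro mult_left_mono) auto
    also have "\<dots> = A + integral {0..x} (\<lambda>t. cmod (q t) * \<psi> t)"
      by (simp add: exp_minus field_simps)
    finally show ?thesis by (simp add: \<psi>_def mult.commute)
  qed
  have A0: "A \<ge> 0" by (simp add: A_def)
  have mono: "integral {0..s} (\<lambda>t. cmod (q t)) \<le> Q" if "s \<in> {0..b}" for s
    unfolding Q_def using that by (intro integral_upper_mono[OF qn]) auto
  have \<psi>M: "\<psi> s \<le> M" if s: "s \<in> {0..b}" for s
  proof -
    have "\<psi> s \<le> A * exp (integral {0..s} (\<lambda>t. cmod (q t)))"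
      by (rule gronwall[OF qn _ c\<psi> \<psi>le A0 _ s]) (auto simp: \<psi>_def)
    also have "\<dots> \<le> M" unfolding M_def A_def[symmetric] using A0 mono[OF s] by (intro mult_left_mono) auto
    finally show ?thesis .
  qed
  have conv: "cmod (y s) \<le> M * exp (\<tau> * s)" if s: "s \<in> {0..b}" for s
  proof -
    have "cmod (y s) = \<psi> s * exp (\<tau> * s)" by (simp add: \<psi>_def exp_minus field_simps)
    also have "\<dots> \<le> M * exp (\<tau> * s)" by (intro mult_right_mono \<psi>M s) auto
    finally show ?thesis .
  qed
  show "cmod (y x) \<le> M * exp (\<bar>Im k\<bar> * x)" using conv[OF x] by (simp add: \<tau>_def)
  have M0: "M \<ge> 0" using A0 by (simp add: M_def A_def[symmetric])
  have QM: "integral {0..x} (\<lambda>t. cmod (q t) * \<psi> t) \<le> Q * M"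
  proof -
    have "integral {0..x} (\<lambda>t. cmod (q t) * \<psi> t) \<le> integral {0..x} (\<lambda>t. cmod (q t) * M)"
      using \<psi>M x abs_integrable_sub(2)[OF q\<psi>, of 0 x] abs_integrable_sub(2)[OF qn, of 0 x]
      by (intro integral_le integrable_on_mult_left mult_left_mono) auto
    also have "\<dots> \<le> Q * M" using mono[OF x] M0 by (simp add: mult_right_mono)
    finally show ?thesis .
  qed
  have xx: "0 \<le> x" "x \<le> b" using x by auto
  have "cmod (y x - y 0 * cos (k * of_real x)) = cmod (y' 0 * (sin (k * of_real x) / k) + integral {0..x} (\<lambda>t. q t * y t * (sin (k * of_real (x - t)) / k)))"
    using solution_volterra[OF k0(1) y xx] by (simp add: algebra_simps)
  also have "\<dots> \<le> cmod (y' 0 * (sin (k * of_real x) / k)) + cmod (integral {0..x} (\<lambda>t. q t * y t * (sin (k * of_real (x - t)) / k)))"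
    by (rule norm_triangle_ineq)
  also have "cmod (y' 0 * (sin (k * of_real x) / k)) \<le> cmod (y' 0) * (exp (\<tau> * x) / cmod k)"
    unfolding norm_mult using cnk(3)[of x] xx by (intro mult_left_mono) auto
  also have "cmod (integral {0..x} (\<lambda>t. q t * y t * (sin (k * of_real (x - t)) / k))) \<le> (1 / cmod k) * exp (\<tau> * x) * integral {0..x} (\<lambda>t. cmod (q t) * \<psi> t)"
    using qyT[of "\<lambda>s. sin (k * of_real s) / k" "1 / cmod k" x] cnk(3) cont_sin x by simp
  also have "\<dots> \<le> (1 / cmod k) * exp (\<tau> * x) * (Q * M)" using QM by (intro mult_left_mono) auto
  finally show "cmod (y x - y 0 * cos (k * of_real x)) \<le> (cmod (y' 0) + Q * M) / cmod k * exp (\<bar>Im k\<bar> * x)"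
    by (simp add: \<tau>_def add_divide_distrib algebra_simps)
  have "cmod (y' x + y 0 * k * sin (k * of_real x)) = cmod (y' 0 * cos (k * of_real x) + integral {0..x} (\<lambda>t. q t * y t * cos (k * of_real (x - t))))"
    using solution_deriv_volterra[OF k0(1) y xx] by (simp add: algebra_simps)
  also have "\<dots> \<le> cmod (y' 0 * cos (k * of_real x)) + cmod (integral {0..x} (\<lambda>t. q t * y t * cos (k * of_real (x - t))))"
    by (rule norm_triangle_ineq)
  also have "cmod (y' 0 * cos (k * of_real x)) \<le> cmod (y' 0) * exp (\<tau> * x)"
    unfolding norm_mult using cnk(1)[of x] xx by (intro mult_left_mono) auto
  also have "cmod (integral {0..x} (\<lambda>t. q t * y t * cos (k * of_real (x - t)))) \<le> 1 * exp (\<tau> * x) * integral {0..x} (\<lambda>t. cmod (q t) * \<psi> t)"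
    using qyT[of "\<lambda>s. cos (k * of_real s)" 1 x] cnk(1) cont_cos x by simp
  also have "\<dots> \<le> 1 * exp (\<tau> * x) * (Q * M)" using QM by (intro mult_left_mono) auto
  finally show "cmod (y' x + y 0 * k * sin (k * of_real x)) \<le> (cmod (y' 0) + Q * M) * exp (\<bar>Im k\<bar> * x)"
    by (simp add: \<tau>_def algebra_simps)
qed

section \<open>Eigenvalues as the zeros of an entire function\<close>

lemma zero_if_integral_norm_square_zero:
  fixes u :: "real \<Rightarrow> complex"
  assumes u: "continuous_on {0..b} u" and z: "integral {0..b} (\<lambda>x. (cmod (u x))\<^sup>2) = 0" and b: "0 < b"
    and x: "x \<in> {0..b}"
  shows "u x = 0"
proof -
  have c: "continuous_on {0..b} (\<lambda>x. (cmod (u x))\<^sup>2)" by (intro continuous_intros u)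
  then have "((\<lambda>x. (cmod (u x))\<^sup>2) has_integral 0) (cbox 0 b)"
    using integrable_integral[OF integrable_continuous_real[OF c]] z by simp
  then have "(cmod (u x))\<^sup>2 = 0"
    using c b x by (intro has_integral_0_cbox_imp_0[of 0 b "\<lambda>x. (cmod (u x))\<^sup>2" x]) auto
  then show ?thesis by simp
qed

lemma integral_complex_of_real:
  "f integrable_on S \<Longrightarrow> integral S (\<lambda>x. complex_of_real (f x)) = complex_of_real (integral S f)"
  using integral_linear[OF _ bounded_linear_of_real, of f S] by (simp add: o_def)

text \<open>
  The Lagrange identity for \<open>u\<close> and its conjugate: \<open>(z - cnj z) \<integral> \<bar>u\<bar>\<^sup>2\<close> is a difference of boundary
  terms, and both vanish by the hypotheses on the ends. It shows both that eigenvalues are real and that a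
  solution for nonreal \<open>z\<close> which vanishes at one point has no further zero.
\<close>

lemma solution_zero_if_nonreal:
  fixes q :: "real \<Rightarrow> real"
  assumes u: "sl_solution b (\<lambda>x. of_real (q x) - z) u u'" and b: "0 < b" and z: "Im z \<noteq> 0"
    and ends: "Im (u' 0 * cnj (u 0)) = 0" "Im (u' b * cnj (u b)) = 0" and x: "x \<in> {0..b}"
  shows "u x = 0"
proof -
  have cu: "continuous_on {0..b} u" using sl_solution_continuous u by blast
  have w0: "u t * cnj (u' t) - u' t * cnj (u t) = - (2 * \<i> * of_real (Im (u' t * cnj (u t))))" for t
    by (simp add: complex_eq_iff)
  have "u b * cnj (u' b) - u' b * cnj (u b) = (u 0 * cnj (u' 0) - u' 0 * cnj (u 0))
      + integral {0..b} (\<lambda>x. (cnj (of_real (q x) - z) - (of_real (q x) - z)) * (u x * cnj (u x)))"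
    by (rule ac_derivD[OF wronskian_deriv[OF u sl_solution_cnj[OF u]]]) (use b in auto)
  then have "integral {0..b} (\<lambda>x. (cnj (of_real (q x) - z) - (of_real (q x) - z)) * (u x * cnj (u x))) = 0"
    unfolding w0 ends by simp
  moreover have "(\<lambda>x. (cnj (of_real (q x) - z) - (of_real (q x) - z)) * (u x * cnj (u x))) = (\<lambda>x. (z - cnj z) * of_real ((cmod (u x))\<^sup>2))"
    by (rule ext) (simp add: complex_norm_square del: of_real_power)
  ultimately have "(z - cnj z) * integral {0..b} (\<lambda>x. of_real ((cmod (u x))\<^sup>2)) = 0"
    by (simp only: hk_integral_mult_right)
  moreover have "z - cnj z \<noteq> 0" using z by (simp add: complex_eq_iff)
  moreover have "(\<lambda>x. (cmod (u x))\<^sup>2) integrable_on {0..b}"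
    by (intro integrable_continuous_real continuous_intros cu)
  ultimately have "integral {0..b} (\<lambda>x. (cmod (u x))\<^sup>2) = 0"
    by (simp add: integral_complex_of_real del: of_real_power)
  from zero_if_integral_norm_square_zero[OF cu this b x] show ?thesis .
qed

definition reg_sol :: "(real \<Rightarrow> real) \<Rightarrow> real \<Rightarrow> complex \<Rightarrow> real \<Rightarrow> complex" where
  "reg_sol q h z = ivp_val 1 (\<lambda>x. complex_of_real (q x) - z) 1 (- complex_of_real h)"

definition reg_der :: "(real \<Rightarrow> real) \<Rightarrow> real \<Rightarrow> complex \<Rightarrow> real \<Rightarrow> complex" where
  "reg_der q h z = ivp_der 1 (\<lambda>x. complex_of_real (q x) - z) 1 (- complex_of_real h)"

text \<open>
  The characteristic function of the eigenvalue problem, that is, the boundary condition at \<open>1\<close> evaluated on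
  the solution that satisfies the boundary condition at \<open>0\<close>.
\<close>

definition char_fun :: "(real \<Rightarrow> real) \<Rightarrow> real \<Rightarrow> real \<Rightarrow> complex \<Rightarrow> complex" where
  "char_fun q h H z = reg_der q h z 1 + of_real H * reg_sol q h z 1"

lemma abs_integrable_of_real:
  assumes "q absolutely_integrable_on S"
  shows "(\<lambda>x. complex_of_real (q x)) absolutely_integrable_on S"
  using absolutely_integrable_linear[OF assms bounded_linear_of_real] by (simp add: o_def)

lemma reg_solution:
  assumes q: "q absolutely_integrable_on {0..1}"
  shows "sl_solution 1 (\<lambda>x. complex_of_real (q x) - z) (reg_sol q h z) (reg_der q h z)"
    and "reg_sol q h z 0 = 1" and "reg_der q h z 0 = - of_real h"
  using ivp_solution[OF abs_integrable_minus_const[OF abs_integrable_of_real[OF q]], of z 1 "- of_real h"]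
  by (auto simp: reg_sol_def reg_der_def)

lemma reg_holomorphic:
  assumes q: "q absolutely_integrable_on {0..1}" and x: "x \<in> {0..1}"
  shows "(\<lambda>z. reg_sol q h z x) holomorphic_on A" "(\<lambda>z. reg_der q h z x) holomorphic_on A"
  using ivp_holomorphic[OF abs_integrable_of_real[OF q] _ _ x] by (auto simp: reg_sol_def reg_der_def)

lemma char_fun_holomorphic:
  assumes q: "q absolutely_integrable_on {0..1}"
  shows "char_fun q h H holomorphic_on A"
  unfolding char_fun_def[abs_def] by (intro holomorphic_intros reg_holomorphic[OF q]) auto

lemma reg_shift:
  "reg_sol (\<lambda>x. q x + c) h (z + of_real c) = reg_sol q h z"
  "reg_der (\<lambda>x. q x + c) h (z + of_real c) = reg_der q h z"
  "char_fun (\<lambda>x. q x + c) h H (z + of_real c) = char_fun q h H z"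
  by (simp_all add: reg_sol_def reg_der_def char_fun_def)

lemma continuous_zero_if_AE_zero:
  fixes u :: "real \<Rightarrow> complex"
  assumes u: "continuous_on {0..1} u" and ae: "AE x in lebesgue_on {0..1}. u x = 0" and x: "x \<in> {0..1}"
  shows "u x = 0"
proof -
  obtain N where N: "negligible N" "\<And>x. x \<in> {0..1} - N \<Longrightarrow> u x = 0"
    using AE_lebesgue_on_negligible[OF ae] by auto
  have "integral {0..1} (\<lambda>x. (cmod (u x))\<^sup>2) = integral {0..1} (\<lambda>x::real. 0::real)"
    by (rule integral_spike[OF N(1)]) (use N(2) in auto)
  then have "integral {0..1} (\<lambda>x. (cmod (u x))\<^sup>2) = 0" by simp
  from zero_if_integral_norm_square_zero[OF u this _ x] show ?thesis by simp
qed

lemma square_integrable_continuous: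
  assumes "continuous_on {0..1} u"
  shows "square_integrable_01 u"
  unfolding square_integrable_01_def
proof
  show "u \<in> borel_measurable (lebesgue_on {0..1})"
    using assms by (intro continuous_imp_measurable_on_sets_lebesgue) auto
  have "(\<lambda>x. (cmod (u x))\<^sup>2) absolutely_integrable_on {0..1}"
    by (intro absolutely_integrable_continuous_real continuous_intros assms)
  then show "integrable (lebesgue_on {0..1}) (\<lambda>x. (cmod (u x))\<^sup>2)"
    by (simp add: absolutely_integrable_imp_integrable)
qed

text \<open>
  By uniqueness, a solution that satisfies the boundary condition at \<open>0\<close> is a multiple of \<open>reg_sol\<close>.
\<close>

lemma eigenvalue_iff_char_fun:
  assumes q: "q absolutely_integrable_on {0..1}"
  shows "schroedinger_eigenvalue q h H z \<longleftrightarrow> char_fun q h H z = 0"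
proof
  have qz: "(\<lambda>x. complex_of_real (q x) - z) absolutely_integrable_on {0..1}"
    by (rule abs_integrable_minus_const[OF abs_integrable_of_real[OF q]])
  {
    assume "schroedinger_eigenvalue q h H z"
    then obtain u u' u'' where u: "ac_deriv 1 u u'" "ac_deriv 1 u' u''"
      and eq: "AE x in lebesgue_on {0..1}. z * u x = - u'' x + complex_of_real (q x) * u x"
      and bc: "u' 0 + of_real h * u 0 = 0" "u' 1 + of_real H * u 1 = 0"
      and nz: "\<not> (AE x in lebesgue_on {0..1}. u x = 0)"
      unfolding schroedinger_eigenvalue_def schroedinger_operator_def has_ac_derivative_iff by blast
    have "AE x in lebesgue_on {0..1}. u'' x = (complex_of_real (q x) - z) * u x"
      using eq by eventually_elim (simp add: algebra_simps)
    then have sol: "sl_solution 1 (\<lambda>x. complex_of_real (q x) - z) u u'"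
      using u ac_deriv_cong_AE[OF u(2)] by (simp add: sl_solution_def)
    have "sl_solution 1 (\<lambda>x. complex_of_real (q x) - z) (\<lambda>x. u 0 * reg_sol q h z x + 0 * reg_sol q h z x)
            (\<lambda>x. u 0 * reg_der q h z x + 0 * reg_der q h z x)"
      by (intro sl_solution_linear reg_solution q)
    then have sol0: "sl_solution 1 (\<lambda>x. complex_of_real (q x) - z) (\<lambda>x. u 0 * reg_sol q h z x) (\<lambda>x. u 0 * reg_der q h z x)"
      by simp
    have "u' 0 = - (of_real h * u 0)" using bc(1) by (simp only: eq_neg_iff_add_eq_0)
    then have init: "u 0 = u 0 * reg_sol q h z 0" "u' 0 = u 0 * reg_der q h z 0"
      by (simp_all add: reg_solution(2,3)[OF q])
    note eqs = sl_solution_unique[OF sol sol0 qz order_refl init]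
    have "u 0 \<noteq> 0"
    proof
      assume "u 0 = 0"
      then have "u x = 0" if "x \<in> {0..1}" for x using eqs(1)[OF that] by (simp only: mult_zero_left)
      then have "AE x in lebesgue_on {0..1}. u x = 0"
        by (intro negligible_imp_AE_lebesgue_on[of "{}"]) auto
      with nz show False by simp
    qed
    moreover have "u 0 * char_fun q h H z = 0"
      using bc(2) unfolding eqs(1)[of 1, simplified] eqs(2)[of 1, simplified]
      by (simp add: char_fun_def algebra_simps)
    ultimately show "char_fun q h H z = 0" by simp
  }
  {
    assume z: "char_fun q h H z = 0"
    have c: "continuous_on {0..1} (reg_sol q h z)" using sl_solution_continuous reg_solution(1)[OF q] by blast
    have "schroedinger_operator q h H (reg_sol q h z) (\<lambda>x. z * reg_sol q h z x)"
      unfolding schroedinger_operator_def has_ac_derivative_iff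
    proof (intro conjI exI)
      show "ac_deriv 1 (reg_sol q h z) (reg_der q h z)"
        "ac_deriv 1 (reg_der q h z) (\<lambda>x. (complex_of_real (q x) - z) * reg_sol q h z x)"
        using reg_solution(1)[OF q] by (auto simp: sl_solution_def)
      show "reg_der q h z 0 + complex_of_real h * reg_sol q h z 0 = 0" by (simp add: reg_solution[OF q])
      show "reg_der q h z 1 + complex_of_real H * reg_sol q h z 1 = 0" using z by (simp add: char_fun_def)
    qed (auto intro!: square_integrable_continuous c continuous_intros simp: algebra_simps)
    moreover have "\<not> (AE x in lebesgue_on {0..1}. reg_sol q h z x = 0)"
      using continuous_zero_if_AE_zero[OF c, of 0] reg_solution(2)[OF q] by auto
    ultimately show "schroedinger_eigenvalue q h H z" unfolding schroedinger_eigenvalue_def by blast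
  }
qed

lemma char_fun_zero_real:
  assumes q: "q absolutely_integrable_on {0..1}" and z: "char_fun q h H z = 0"
  shows "Im z = 0"
proof (rule ccontr)
  assume "Im z \<noteq> 0"
  have "reg_der q h z 1 = - of_real H * reg_sol q h z 1" using z by (simp add: char_fun_def eq_neg_iff_add_eq_0)
  then have "reg_der q h z 1 * cnj (reg_sol q h z 1) = of_real (- H * (cmod (reg_sol q h z 1))\<^sup>2)"
    by (simp only: of_real_mult complex_norm_square of_real_minus mult.assoc)
  then have "Im (reg_der q h z 1 * cnj (reg_sol q h z 1)) = 0" by (simp only: Im_complex_of_real)
  moreover have "Im (reg_der q h z 0 * cnj (reg_sol q h z 0)) = 0" by (simp add: reg_solution[OF q])
  ultimately have "reg_sol q h z 0 = 0"
    using \<open>Im z \<noteq> 0\<close> by (intro solution_zero_if_nonreal[OF reg_solution(1)[OF q]]) auto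
  then show False by (simp add: reg_solution[OF q])
qed

lemma reg_sol_real:
  assumes q: "q absolutely_integrable_on {0..1}" and z: "Im z = 0" and x: "x \<in> {0..1}"
  shows "cnj (reg_sol q h z x) = reg_sol q h z x"
proof -
  have "cnj z = z" using z by (simp add: complex_eq_iff)
  then have "sl_solution 1 (\<lambda>x. complex_of_real (q x) - z) (\<lambda>x. cnj (reg_sol q h z x)) (\<lambda>x. cnj (reg_der q h z x))"
    using sl_solution_cnj[OF reg_solution(1)[OF q, of z h]] by simp
  from sl_solution_unique(1)[OF this reg_solution(1)[OF q] abs_integrable_minus_const[OF abs_integrable_of_real[OF q]] _ _ _ x]
  show ?thesis by (simp add: reg_solution[OF q])
qed

text \<open>
  The Lagrange identity for \<open>\<phi>(\<cdot>,z)\<close> and \<open>\<phi>(\<cdot>,w)\<close> reads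
  \<open>- \<phi>(1,w) \<Delta>(z) = (z - w) \<integral> \<phi>(\<cdot>,z) \<phi>(\<cdot>,w)\<close>. If \<open>\<Delta>\<close> had a double zero at \<open>w\<close>, dividing by \<open>z - w\<close> and
  letting \<open>z\<close> tend to \<open>w\<close> would give \<open>\<integral> \<phi>(\<cdot>,w)\<^sup>2 = 0\<close> for the real function \<open>\<phi>(\<cdot>,w)\<close>.
\<close>

lemma char_fun_simple_zero:
  assumes q: "q absolutely_integrable_on {0..1}" and w: "char_fun q h H w = 0"
  shows "deriv (char_fun q h H) w \<noteq> 0"
proof
  assume d0: "deriv (char_fun q h H) w = 0"
  define \<phi> where "\<phi> z = reg_sol q h z" for z
  have real: "Im w = 0" by (rule char_fun_zero_real[OF q w])
  have c: "continuous_on {0..1} (\<phi> z)" for z using sl_solution_continuous reg_solution(1)[OF q] unfolding \<phi>_def by blast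
  have cc: "continuous_on {0..1} (\<lambda>x. \<phi> z x * \<phi> w x)" for z by (intro continuous_intros c)
  define I where "I z = integral {0..1} (\<lambda>x. \<phi> z x * \<phi> w x)" for z
  have lag: "- \<phi> w 1 * char_fun q h H z = (z - w) * I z" for z
  proof -
    have "\<phi> z 1 * reg_der q h w 1 - reg_der q h z 1 * \<phi> w 1 = \<phi> z 0 * reg_der q h w 0 - reg_der q h z 0 * \<phi> w 0
      + integral {0..1} (\<lambda>x. ((complex_of_real (q x) - w) - (complex_of_real (q x) - z)) * (\<phi> z x * \<phi> w x))"
      unfolding \<phi>_def by (rule ac_derivD[OF wronskian_deriv[OF reg_solution(1)[OF q] reg_solution(1)[OF q]]]) auto
    moreover have "reg_der q h w 1 = - of_real H * \<phi> w 1" using w by (simp add: char_fun_def eq_neg_iff_add_eq_0 \<phi>_def)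
    moreover have "integral {0..1} (\<lambda>x. ((complex_of_real (q x) - w) - (complex_of_real (q x) - z)) * (\<phi> z x * \<phi> w x)) = (z - w) * I z"
      unfolding I_def by (subst hk_integral_mult_right[symmetric]) simp
    ultimately have "\<phi> z 1 * (- of_real H * \<phi> w 1) - reg_der q h z 1 * \<phi> w 1 = (z - w) * I z"
      by (simp add: reg_solution[OF q] \<phi>_def)
    then show ?thesis by (simp add: char_fun_def \<phi>_def algebra_simps)
  qed
  have "(char_fun q h H has_field_derivative 0) (at w)"
    using holomorphic_derivI[OF char_fun_holomorphic[OF q, of h H UNIV], of w] d0 by simp
  then have lim0: "((\<lambda>z. char_fun q h H z / (z - w)) \<longlongrightarrow> 0) (at w)"
    by (simp add: has_field_derivative_iff w)
  have "((\<lambda>z. - \<phi> w 1 * (char_fun q h H z / (z - w))) \<longlongrightarrow> - \<phi> w 1 * 0) (at w)"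
    by (intro tendsto_intros lim0)
  moreover have "eventually (\<lambda>z. - \<phi> w 1 * (char_fun q h H z / (z - w)) = I z) (at w)"
    using lag by (intro eventually_at_filter[THEN iffD2] always_eventually) (auto simp: field_simps)
  ultimately have I0: "(I \<longlongrightarrow> 0) (at w)" by (auto dest: tendsto_cong)
  obtain C where C: "C \<ge> 0" "\<And>z x. cmod (z - w) \<le> 1 \<Longrightarrow> x \<in> {0..1} \<Longrightarrow> cmod (\<phi> z x - \<phi> w x) \<le> C * cmod (z - w)"
    using ivp_lipschitz_in_z[OF abs_integrable_of_real[OF q], of w 1 "- of_real h"] unfolding \<phi>_def reg_sol_def by auto
  obtain M where M: "M > 0" "\<And>x. x \<in> {0..1} \<Longrightarrow> cmod (\<phi> w x) \<le> M"
    using compact_imp_bounded[OF compact_continuous_image[OF c[of w]]] by (auto simp: bounded_pos)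
  have "(I \<longlongrightarrow> I w) (at w)"
  proof (rule tendsto_if_linear_bound)
    fix z assume z: "cmod (z - w) \<le> 1"
    have "I z - I w = integral {0..1} (\<lambda>x. (\<phi> z x - \<phi> w x) * \<phi> w x)"
      unfolding I_def using integrable_continuous_real[OF cc[of z]] integrable_continuous_real[OF cc[of w]]
      by (subst hk_integral_diff[symmetric]) (auto simp: left_diff_distrib)
    also have "cmod \<dots> \<le> integral {0..1} (\<lambda>x::real. C * cmod (z - w) * M)"
    proof (rule hk_integral_norm_bound_integral)
      show "(\<lambda>x. (\<phi> z x - \<phi> w x) * \<phi> w x) integrable_on {0..1}"
        by (intro integrable_continuous_real continuous_intros c)
      show "cmod ((\<phi> z x - \<phi> w x) * \<phi> w x) \<le> C * cmod (z - w) * M" if "x \<in> {0..1}" for x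
        unfolding norm_mult using C M that z by (intro mult_mono) auto
    qed auto
    finally show "cmod (I z - I w) \<le> C * M * cmod (z - w)" by (simp add: mult_ac)
  qed
  with I0 have "I w = 0" using tendsto_unique[of "at w" I "I w" 0] by simp
  have "I w = integral {0..1} (\<lambda>x. of_real ((cmod (\<phi> w x))\<^sup>2))"
    unfolding I_def
  proof (rule hk_integral_cong)
    fix x :: real assume "x \<in> {0..1}"
    then have "cnj (\<phi> w x) = \<phi> w x" unfolding \<phi>_def by (intro reg_sol_real[OF q real])
    then show "\<phi> w x * \<phi> w x = of_real ((cmod (\<phi> w x))\<^sup>2)" by (simp add: complex_norm_square del: of_real_power)
  qed
  then have "integral {0..1} (\<lambda>x. (cmod (\<phi> w x))\<^sup>2) = 0"
    using \<open>I w = 0\<close> by (subst (asm) integral_complex_of_real) (auto intro!: integrable_continuous_real continuous_intros c)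
  from zero_if_integral_norm_square_zero[OF c this, of 0] show False by (simp add: \<phi>_def reg_solution[OF q])
qed

lemma char_fun_asymp:
  assumes q: "q absolutely_integrable_on {0..1}"
  obtains C where "C > 0" "\<And>k. cmod k \<ge> 1 \<Longrightarrow> cmod (char_fun q h H (k\<^sup>2) + k * sin k) \<le> C * exp \<bar>Im k\<bar>"
proof -
  define Q where "Q = integral {0..1} (\<lambda>t. cmod (complex_of_real (q t)))"
  define M where "M = (1 + \<bar>h\<bar>) * exp Q"
  have Q0: "Q \<ge> 0" unfolding Q_def using q
    by (intro hk_integral_nonneg) (auto simp: absolutely_integrable_on_def)
  have M0: "M \<ge> 0" by (simp add: M_def)
  show ?thesis
  proof (rule that[of "\<bar>h\<bar> + Q * M + \<bar>H\<bar> * M + 1"])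
    show "\<bar>h\<bar> + Q * M + \<bar>H\<bar> * M + 1 > 0" using Q0 M0 by (simp add: add_nonneg_pos)
    fix k :: complex assume k: "cmod k \<ge> 1"
    define M' where "M' = (1 + \<bar>h\<bar> / cmod k) * exp Q"
    have MM: "0 \<le> M'" "M' \<le> M" unfolding M_def M'_def using k
      by (auto intro!: mult_right_mono simp: divide_le_eq mult_left_le order_trans[OF _ mult_left_mono[OF k]])
    note s = reg_solution(1)[OF q, of "k\<^sup>2" h]
    have 1: "cmod (reg_sol q h (k\<^sup>2) 1) \<le> M' * exp \<bar>Im k\<bar>"
      using solution_growth[OF abs_integrable_of_real[OF q] k s, of 1] by (simp add: reg_solution[OF q] M'_def Q_def)
    have 2: "cmod (reg_der q h (k\<^sup>2) 1 + k * sin k) \<le> (\<bar>h\<bar> + Q * M') * exp \<bar>Im k\<bar>"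
      using solution_deriv_near_sin[OF abs_integrable_of_real[OF q] k s, of 1] by (simp add: reg_solution[OF q] M'_def Q_def)
    have "cmod (char_fun q h H (k\<^sup>2) + k * sin k) = cmod ((reg_der q h (k\<^sup>2) 1 + k * sin k) + of_real H * reg_sol q h (k\<^sup>2) 1)"
      by (simp add: char_fun_def algebra_simps)
    also have "\<dots> \<le> (\<bar>h\<bar> + Q * M') * exp \<bar>Im k\<bar> + \<bar>H\<bar> * (M' * exp \<bar>Im k\<bar>)"
    proof (rule order_trans[OF norm_triangle_ineq], rule add_mono[OF 2])
      show "cmod (of_real H * reg_sol q h (k\<^sup>2) 1) \<le> \<bar>H\<bar> * (M' * exp \<bar>Im k\<bar>)"
        using mult_left_mono[OF 1, of "\<bar>H\<bar>"] by (simp add: norm_mult)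
    qed
    also have "\<dots> \<le> (\<bar>h\<bar> + Q * M) * exp \<bar>Im k\<bar> + \<bar>H\<bar> * (M * exp \<bar>Im k\<bar>)"
      using MM Q0 by (intro add_mono mult_left_mono mult_right_mono) auto
    also have "\<dots> \<le> (\<bar>h\<bar> + Q * M + \<bar>H\<bar> * M + 1) * exp \<bar>Im k\<bar>" by (simp add: algebra_simps)
    finally show "cmod (char_fun q h H (k\<^sup>2) + k * sin k) \<le> (\<bar>h\<bar> + Q * M + \<bar>H\<bar> * M + 1) * exp \<bar>Im k\<bar>" .
  qed
qed

lemma exp_le_4_sinh: "x \<ge> 1 \<Longrightarrow> exp x / 4 \<le> sinh (x::real)"
proof -
  assume x: "x \<ge> 1"
  have "exp (- x) \<le> 1" using x by simp
  moreover have "exp x \<ge> 1 + x" by (rule exp_ge_add_one_self)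
  ultimately have "2 * exp (- x) \<le> exp x" using x by linarith
  then show ?thesis by (simp add: sinh_def)
qed

text \<open>
  At \<open>z = - \<kappa>\<^sup>2\<close>, that is \<open>k = \<i> \<kappa>\<close>, the main term \<open>k sin k\<close> of the characteristic function has modulus
  \<open>\<kappa> sinh \<kappa>\<close>, which dominates the error \<open>C exp \<kappa>\<close> as soon as \<open>\<kappa> > 4 C\<close>.
\<close>

lemma char_fun_zero_bounded_below:
  assumes q: "q absolutely_integrable_on {0..1}"
  obtains B where "\<And>z. char_fun q h H z = 0 \<Longrightarrow> Re z > - B"
proof -
  obtain C where C: "C > 0" "\<And>k. cmod k \<ge> 1 \<Longrightarrow> cmod (char_fun q h H (k\<^sup>2) + k * sin k) \<le> C * exp \<bar>Im k\<bar>"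
    by (rule char_fun_asymp[OF q, of h H]) blast
  show ?thesis
  proof (rule that[of "(4 * C + 1)\<^sup>2"])
    fix z assume z: "char_fun q h H z = 0"
    show "Re z > - ((4 * C + 1)\<^sup>2)"
    proof (rule ccontr)
      assume "\<not> Re z > - ((4 * C + 1)\<^sup>2)"
      then have le: "(4 * C + 1)\<^sup>2 \<le> - Re z" by simp
      define \<kappa> where "\<kappa> = sqrt (- Re z)"
      have \<kappa>: "\<kappa> \<ge> 4 * C + 1" unfolding \<kappa>_def using C(1) le by (intro real_le_rsqrt) auto
      have "- Re z \<ge> 0" using le by (meson order_trans zero_le_power2)
      then have zk: "z = (\<i> * of_real \<kappa>)\<^sup>2"
        using char_fun_zero_real[OF q z] by (simp add: \<kappa>_def complex_eq_iff power_mult_distrib flip: of_real_power)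
      have "cmod ((\<i> * of_real \<kappa>) * sin (\<i> * of_real \<kappa>)) \<le> C * exp \<kappa>"
        using C(2)[of "\<i> * of_real \<kappa>"] z[unfolded zk] \<kappa> C(1) by (simp add: norm_mult)
      moreover have "sin (\<i> * of_real \<kappa>) = \<i> * of_real (sinh \<kappa>)"
        by (simp add: complex_eq_iff Re_sin Im_sin sinh_def)
      ultimately have "\<kappa> * sinh \<kappa> \<le> C * exp \<kappa>" using \<kappa> C(1) by (simp add: norm_mult)
      moreover have "exp \<kappa> / 4 \<le> sinh \<kappa>" using \<kappa> C(1) by (intro exp_le_4_sinh) simp
      ultimately have "\<kappa> * (exp \<kappa> / 4) \<le> C * exp \<kappa>"
        using \<kappa> C(1) by (meson mult_left_mono order_trans add_nonneg_nonneg less_imp_le mult_nonneg_nonneg zero_le_numeral zero_le_one)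
      then have "\<kappa> / 4 \<le> C" by simp
      with \<kappa> show False by simp
    qed
  qed
qed

section \<open>Counting the eigenvalues\<close>

lemma cmod_sin_power2: "(cmod (sin z))\<^sup>2 = (sin (Re z))\<^sup>2 + (sinh (Im z))\<^sup>2"
  and cmod_cos_power2: "(cmod (cos z))\<^sup>2 = (cos (Re z))\<^sup>2 + (sinh (Im z))\<^sup>2"
proof -
  have r: "Re (sin z) = sin (Re z) * cosh (Im z)" "Im (sin z) = cos (Re z) * sinh (Im z)"
    "Re (cos z) = cos (Re z) * cosh (Im z)" "Im (cos z) = - sin (Re z) * sinh (Im z)"
    by (simp_all add: Re_sin Im_sin Re_cos Im_cos sinh_def cosh_def field_simps)
  have e: "(cosh (Im z))\<^sup>2 = (sinh (Im z))\<^sup>2 + 1" by (simp add: cosh_square_eq)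
  have s: "(sin (Re z))\<^sup>2 + (cos (Re z))\<^sup>2 = 1" by simp
  have "(cmod (sin z))\<^sup>2 = (sin (Re z))\<^sup>2 + ((sin (Re z))\<^sup>2 + (cos (Re z))\<^sup>2) * (sinh (Im z))\<^sup>2"
    unfolding cmod_power2 r power_mult_distrib e by (simp only: distrib_left distrib_right mult_1_right add_ac)
  then show "(cmod (sin z))\<^sup>2 = (sin (Re z))\<^sup>2 + (sinh (Im z))\<^sup>2" by (simp only: s mult_1)
  have "(cmod (cos z))\<^sup>2 = (cos (Re z))\<^sup>2 + ((sin (Re z))\<^sup>2 + (cos (Re z))\<^sup>2) * (sinh (Im z))\<^sup>2"
    unfolding cmod_power2 r power_mult_distrib e power2_minus by (simp only: distrib_left distrib_right mult_1_right add_ac)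
  then show "(cmod (cos z))\<^sup>2 = (cos (Re z))\<^sup>2 + (sinh (Im z))\<^sup>2" by (simp only: s mult_1)
qed

lemma abs_sinh_le_cmod_sin: "\<bar>sinh (Im z)\<bar> \<le> cmod (sin z)"
  and abs_sinh_le_cmod_cos: "\<bar>sinh (Im z)\<bar> \<le> cmod (cos z)"
  by (rule power2_le_imp_le; simp add: cmod_sin_power2 cmod_cos_power2)+

lemma half_exp_le_cosh: "exp \<bar>y\<bar> / 2 \<le> cosh (y::real)"
  by (cases "y \<ge> 0") (simp_all add: cosh_def)

lemma abs_sin_cosh_le_cmod_sin: "\<bar>sin (Re z)\<bar> * cosh (Im z) \<le> cmod (sin z)"
proof (rule power2_le_imp_le)
  have "(sin (Re z))\<^sup>2 * (sinh (Im z))\<^sup>2 \<le> 1 * (sinh (Im z))\<^sup>2"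
    by (intro mult_right_mono) (auto simp: abs_square_le_1)
  then show "(\<bar>sin (Re z)\<bar> * cosh (Im z))\<^sup>2 \<le> (cmod (sin z))\<^sup>2"
    by (simp add: cmod_sin_power2 power_mult_distrib cosh_square_eq distrib_left)
qed simp

lemma sin_ge_half: "0 \<le> x \<Longrightarrow> x \<le> 1 \<Longrightarrow> x / 2 \<le> sin (x::real)"
proof -
  assume x: "0 \<le> x" "x \<le> 1"
  have "sin 0 - 0 / 2 \<le> sin x - x / 2"
  proof (rule DERIV_nonneg_imp_nondecreasing[OF x(1)])
    fix t assume t: "0 \<le> t" "t \<le> x"
    have "cos (pi / 3) \<le> cos t" using t x pi_gt3 by (intro cos_monotone_0_pi_le) auto
    then have "0 \<le> cos t - 1 / 2" by (simp add: cos_60)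
    moreover have "((\<lambda>x. sin x - x / 2) has_real_derivative cos t - 1 / 2) (at t)"
      by (auto intro!: derivative_eq_intros)
    ultimately show "\<exists>y. ((\<lambda>x. sin x - x / 2) has_real_derivative y) (at t) \<and> 0 \<le> y" by blast
  qed
  then show ?thesis by simp
qed

text \<open>
  The half side \<open>N \<pi> + 2 C / N\<close> is chosen so that the square just encloses the zeros \<open>n \<pi>\<close> with
  \<open>\<bar>n\<bar> \<le> N\<close> of the sine. On the vertical sides \<open>sin k\<close> is only of relative size \<open>C / N\<close>, but there the
  factor \<open>k\<close> is at least \<open>N \<pi>\<close>.
\<close>

lemma k_sin_k_large_on_square:
  fixes N :: nat
  assumes C: "C > 0" and N: "real N \<ge> 2 * C" and N1: "N \<ge> 1"
  defines "b \<equiv> real N * pi + 2 * C / real N"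
  assumes k: "k \<in> path_image (rectpath (Complex (- b) (- b)) (Complex b b))"
  shows "C * exp \<bar>Im k\<bar> < cmod (k * sin k)" "1 \<le> cmod k"
proof -
  define \<delta> where "\<delta> = 2 * C / real N"
  have \<delta>: "0 < \<delta>" "\<delta> \<le> 1" using C N N1 by (auto simp: \<delta>_def)
  have Npi: "real N * pi \<ge> 3" using N1 pi_gt3 mult_mono[of 1 "real N" 3 pi] by simp
  have b: "b > 3" using Npi \<delta> by (simp add: b_def \<delta>_def[symmetric])
  have pim: "(Re k = - b \<or> Re k = b) \<or> (Im k = - b \<or> Im k = b)"
    using k b by (auto simp: path_image_rectpath)
  have kb: "b \<le> cmod k" using pim abs_Re_le_cmod[of k] abs_Im_le_cmod[of k] b by auto
  then show "1 \<le> cmod k" using b by simp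
  show "C * exp \<bar>Im k\<bar> < cmod (k * sin k)"
  proof (cases "Im k = - b \<or> Im k = b")
    case True
    have C4: "4 * C < b"
    proof -
      have "3 * (2 * C) \<le> pi * real N" using N C pi_gt3 by (intro mult_mono) auto
      moreover have "b = pi * real N + \<delta>" by (simp add: b_def \<delta>_def)
      ultimately show ?thesis using \<delta> C by linarith
    qed
    have "\<bar>Im k\<bar> = b" using True b by auto
    then have "\<bar>sinh (Im k)\<bar> = sinh b" using True b by auto
    then have "exp b / 4 \<le> cmod (sin k)" using exp_le_4_sinh[of b] abs_sinh_le_cmod_sin[of k] b by linarith
    then have "b * (exp b / 4) \<le> cmod k * cmod (sin k)" using kb b by (intro mult_mono) auto
    moreover have "C * exp b < b * (exp b / 4)" using C4 by simp
    ultimately show ?thesis unfolding norm_mult \<open>\<bar>Im k\<bar> = b\<close> by linarith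
  next
    case False
    then have "Re k = - b \<or> Re k = b" using pim by blast
    then have "\<bar>sin (Re k)\<bar> = \<bar>sin b\<bar>" by auto
    also have "\<dots> = \<bar>sin \<delta>\<bar>"
      by (simp add: b_def \<delta>_def[symmetric] sin_add cos_npi sin_npi abs_mult power_abs)
    finally have "\<delta> / 2 \<le> \<bar>sin (Re k)\<bar>" using sin_ge_half[of \<delta>] \<delta> by auto
    then have "\<delta> / 2 * (exp \<bar>Im k\<bar> / 2) \<le> \<bar>sin (Re k)\<bar> * cosh (Im k)"
      using half_exp_le_cosh[of "Im k"] by (intro mult_mono) auto
    then have 1: "\<delta> / 2 * (exp \<bar>Im k\<bar> / 2) \<le> cmod (sin k)" using abs_sin_cosh_le_cmod_sin[of k] by linarith
    have "real N * pi \<le> cmod k" using kb \<delta> by (simp add: b_def \<delta>_def[symmetric])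
    then have "real N * pi * (\<delta> / 2 * (exp \<bar>Im k\<bar> / 2)) \<le> cmod k * cmod (sin k)"
      using 1 \<delta> by (intro mult_mono) auto
    moreover have "real N * pi * (\<delta> / 2 * (exp \<bar>Im k\<bar> / 2)) = (pi / 2) * (C * exp \<bar>Im k\<bar>)"
      using N1 by (simp add: \<delta>_def)
    moreover have "1 * (C * exp \<bar>Im k\<bar>) < (pi / 2) * (C * exp \<bar>Im k\<bar>)"
      using C pi_gt3 by (intro mult_strict_right_mono) auto
    ultimately show ?thesis unfolding norm_mult by linarith
  qed
qed

lemma zorder_k_sin_k:
  "zorder (\<lambda>k. - k * sin k) (of_real (real_of_int n * pi)) = (if n = 0 then 2 else 1)"
proof -
  have d1: "deriv (\<lambda>k. - k * sin k) = (\<lambda>k::complex. - sin k - k * cos k)"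
    by (rule ext, rule DERIV_imp_deriv) (auto intro!: derivative_eq_intros)
  have d2: "deriv (\<lambda>k. - sin k - k * cos k) = (\<lambda>k::complex. - 2 * cos k + k * sin k)"
    by (rule ext, rule DERIV_imp_deriv) (auto intro!: derivative_eq_intros)
  have h: "(\<lambda>k::complex. - k * sin k) holomorphic_on UNIV" by (intro holomorphic_intros)
  show ?thesis
  proof (cases "n = 0")
    case True
    have "zorder (\<lambda>k::complex. - k * sin k) 0 = 2"
    proof (rule zorder_zero_eqI[OF h])
      show "(deriv ^^ i) (\<lambda>k::complex. - k * sin k) 0 = 0" if "i < nat 2" for i
      proof -
        have "i = 0 \<or> i = 1" using that by auto
        then show ?thesis using d1 by auto
      qed
      show "(deriv ^^ nat 2) (\<lambda>k::complex. - k * sin k) 0 \<noteq> 0"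
        by (simp only: numeral_2_eq_2 nat_2 funpow.simps o_apply id_apply d1 d2) simp
    qed auto
    then show ?thesis using True by simp
  next
    case False
    have s: "sin (complex_of_real (real_of_int n * pi)) = 0"
      by (simp only: sin_of_real) (simp add: sin_zero_iff_int2)
    have "w = 0 \<Longrightarrow> v = 0 \<Longrightarrow> w\<^sup>2 + v\<^sup>2 \<noteq> 1" for w v :: complex by simp
    then have "cos (complex_of_real (real_of_int n * pi)) \<noteq> 0"
      using sin_cos_squared_add[of "complex_of_real (real_of_int n * pi)"] s by metis
    with s have "zorder (\<lambda>k::complex. - k * sin k) (of_real (real_of_int n * pi)) = 1"
      using False by (intro zorder_zero_eqI[OF h]) (auto simp: d1[unfolded mult_minus_left])
    then show ?thesis using False by simp
  qed
qed

text \<open>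
  Rouche's theorem on that square, comparing \<open>\<Delta>(k\<^sup>2)\<close> with \<open>- k sin k\<close>, which has \<open>2 N + 2\<close> zeros inside,
  the one at \<open>0\<close> being double. The zeros of \<open>\<Delta>(k\<^sup>2)\<close> are simple and come in pairs
  \<open>\<plusminus> sqrt l\<close>, since all eigenvalues \<open>l\<close> are positive.
\<close>

lemma eigenvalue_count:
  assumes q: "q absolutely_integrable_on {0..1}"
    and pos: "\<And>z. char_fun q h H z = 0 \<Longrightarrow> Re z > 0"
    and C: "C > 0" "\<And>k. cmod k \<ge> 1 \<Longrightarrow> cmod (char_fun q h H (k\<^sup>2) + k * sin k) \<le> C * exp \<bar>Im k\<bar>"
    and N: "real N \<ge> 2 * C" "N \<ge> 1"
  defines "b \<equiv> real N * pi + 2 * C / real N"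
  defines "E \<equiv> {l::real. char_fun q h H (of_real l) = 0 \<and> l < b\<^sup>2}"
  shows "finite E" "N + 1 \<le> card E"
proof -
  define f where "f k = - k * sin k" for k :: complex
  define g where "g k = char_fun q h H (k\<^sup>2) + k * sin k" for k
  define F where "F k = char_fun q h H (k\<^sup>2)" for k
  have fg: "f p + g p = F p" for p by (simp add: f_def g_def F_def)
  define \<gamma> where "\<gamma> = rectpath (Complex (- b) (- b)) (Complex b b)"
  \<comment> \<open>a bounded region around the square, so that the zero sets in it are finite\<close>
  define s where "s = ball (0::complex) (3 * b)"
  have Npi: "real N * pi \<ge> 3" using N pi_gt3 mult_mono[of 1 "real N" 3 pi] by simp
  have \<delta>: "0 < 2 * C / real N" "2 * C / real N \<le> 1" using C N by auto
  have b: "b > 3" using Npi \<delta> by (simp add: b_def)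
  have f_holo: "f holomorphic_on A" for A unfolding f_def[abs_def] by (intro holomorphic_intros)
  have c_holo: "(\<lambda>k. char_fun q h H (k\<^sup>2)) holomorphic_on A" for A
  proof -
    have "(\<lambda>k::complex. k\<^sup>2) holomorphic_on A" by (intro holomorphic_intros)
    from holomorphic_on_compose[OF this char_fun_holomorphic[OF q]] show ?thesis by (simp add: o_def)
  qed
  have F_holo: "F holomorphic_on A" for A using c_holo by (simp add: F_def[abs_def])
  have g_holo: "g holomorphic_on A" for A
    unfolding g_def[abs_def] by (intro holomorphic_intros c_holo)
  have less: "cmod (g k) < cmod (f k)" if "k \<in> path_image \<gamma>" for k
    using k_sin_k_large_on_square[OF C(1) N, of k] that C(2)[of k] by (auto simp: \<gamma>_def b_def f_def g_def)
  have nzF: "F k \<noteq> 0" if "k \<in> path_image \<gamma>" for k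
    using less[OF that] fg[of k] by (metis add_eq_0_iff less_irrefl norm_minus_cancel)
  have nzf: "f k \<noteq> 0" if "k \<in> path_image \<gamma>" for k
    using less[OF that] by auto
  have sub: "path_image \<gamma> \<subseteq> cbox (Complex (- b) (- b)) (Complex b b)"
    unfolding \<gamma>_def using b by (intro path_image_rectpath_subset_cbox) auto
  have cs: "cbox (Complex (- b) (- b)) (Complex b b) \<subseteq> s"
  proof
    fix k assume "k \<in> cbox (Complex (- b) (- b)) (Complex b b)"
    then have "\<bar>Re k\<bar> \<le> b" "\<bar>Im k\<bar> \<le> b" by (auto simp: in_cbox_complex_iff)
    then show "k \<in> s" using cmod_le[of k] b by (simp add: s_def)
  qed
  have pim_ne: "path_image \<gamma> \<noteq> {}" by simp
  then obtain k0 where k0: "k0 \<in> path_image \<gamma>" by blast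
  have fin: "finite {p \<in> s. G p = 0}" if G: "G holomorphic_on UNIV" "G k0 \<noteq> 0" "G z0 = 0" for G z0
  proof -
    have "\<not> G constant_on UNIV" using G(2,3) by (metis UNIV_I constant_on_def)
    then have "finite {z \<in> cball 0 (3 * b). G z = 0}"
      by (intro holomorphic_compact_finite_zeros[OF G(1)]) auto
    then show ?thesis by (rule finite_subset[rotated]) (auto simp: s_def)
  qed
  have finf: "finite {p \<in> s. f p = 0}" by (rule fin[OF f_holo nzf[OF k0], of 0]) (simp add: f_def)
  have finF: "finite {p \<in> s. F p = 0}"
  proof (cases "\<exists>z. F z = 0")
    case True
    then show ?thesis using fin[OF F_holo nzF[OF k0]] by blast
  qed simp
  have wn_out: "winding_number \<gamma> z = 0" if "z \<notin> cbox (Complex (- b) (- b)) (Complex b b)" for z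
    unfolding \<gamma>_def using that b by (intro winding_number_rectpath_outside) auto
  have wn_in: "winding_number \<gamma> z = 1" if "z \<in> box (Complex (- b) (- b)) (Complex b b)" for z
    unfolding \<gamma>_def using that by (rule winding_number_rectpath)
  have pim: "path_image \<gamma> = cbox (Complex (- b) (- b)) (Complex b b) - box (Complex (- b) (- b)) (Complex b b)"
    unfolding \<gamma>_def using b by (intro path_image_rectpath_cbox_minus_box) auto
  define B where "B = box (Complex (- b) (- b)) (Complex b b)"
  have Bs: "B \<subseteq> s" using cs box_subset_cbox[of "Complex (- b) (- b)" "Complex b b"] by (auto simp: B_def)
  \<comment> \<open>in the sums of Rouche's theorem only the zeros inside the square count\<close>
  have sumB: "(\<Sum>p\<in>{p \<in> s. G p = 0}. winding_number \<gamma> p * of_int (zorder G p)) = (\<Sum>p\<in>{p \<in> B. G p = 0}. of_int (zorder G p))"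
    if "finite {p \<in> s. G p = 0}" "\<And>k. k \<in> path_image \<gamma> \<Longrightarrow> G k \<noteq> 0" for G
  proof (rule sum.mono_neutral_cong_right[OF that(1)])
    show "{p \<in> B. G p = 0} \<subseteq> {p \<in> s. G p = 0}" using Bs by auto
    show "\<forall>i\<in>{p \<in> s. G p = 0} - {p \<in> B. G p = 0}. winding_number \<gamma> i * of_int (zorder G i) = 0"
      using wn_out that(2) pim by (auto simp: B_def)
  qed (use wn_in in \<open>auto simp: B_def\<close>)
  have rouche: "(\<Sum>p\<in>{p \<in> s. f p + g p = 0}. winding_number \<gamma> p * of_int (zorder (\<lambda>p. f p + g p) p))
      = (\<Sum>p\<in>{p \<in> s. f p = 0}. winding_number \<gamma> p * of_int (zorder f p))"
  proof (rule Rouche_theorem)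
    show "\<forall>z. z \<notin> s \<longrightarrow> winding_number \<gamma> z = 0" using wn_out cs by auto
    show "path_image \<gamma> \<subseteq> s" using sub cs by auto
  qed (use f_holo g_holo less finf finF in \<open>auto simp: fg s_def \<gamma>_def\<close>)
  have F_simple: "zorder F p = 1" if p: "F p = 0" for p
  proof -
    have "Re (p\<^sup>2) > 0" using pos p by (simp add: F_def)
    then have p0: "p \<noteq> 0" by auto
    have "(char_fun q h H has_field_derivative deriv (char_fun q h H) (p\<^sup>2)) (at (p\<^sup>2))"
      using holomorphic_derivI[OF char_fun_holomorphic[OF q, of h H UNIV], of "p\<^sup>2"] by simp
    moreover have "((\<lambda>k. k\<^sup>2) has_field_derivative 2 * p) (at p)" by (auto intro!: derivative_eq_intros)
    ultimately have "(F has_field_derivative deriv (char_fun q h H) (p\<^sup>2) * (2 * p)) (at p)"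
      unfolding F_def[abs_def] by (rule DERIV_chain2[where g = "\<lambda>k. k\<^sup>2"])
    then have "deriv F p = deriv (char_fun q h H) (p\<^sup>2) * (2 * p)" by (rule DERIV_imp_deriv)
    then have "deriv F p \<noteq> 0" using char_fun_simple_zero[OF q, of h H "p\<^sup>2"] p p0 by (simp add: F_def)
    then show ?thesis using p by (intro zorder_zero_eqI[OF F_holo[of UNIV]]) auto
  qed
  define Zf where "Zf = {p \<in> B. f p = 0}"
  define ZF where "ZF = {p \<in> B. F p = 0}"
  have finZ: "finite Zf" "finite ZF"
    using finf finF Bs by (auto simp: Zf_def ZF_def intro: finite_subset[rotated])
  have "of_nat (card ZF) = (\<Sum>p\<in>ZF. complex_of_int (zorder F p))"
    using F_simple by (simp add: ZF_def)
  also have "\<dots> = (\<Sum>p\<in>Zf. of_int (zorder f p))"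
    using rouche sumB[of f, OF finf nzf] sumB[of F, OF finF nzF] unfolding fg Zf_def ZF_def by simp
  finally have "complex_of_int (int (card ZF)) = complex_of_int (\<Sum>p\<in>Zf. zorder f p)" by simp
  then have cardZ: "int (card ZF) = (\<Sum>p\<in>Zf. zorder f p)" by (simp only: of_int_eq_iff)
  define T where "T = (\<lambda>n. complex_of_real (real_of_int n * pi)) ` {- int N..int N}"
  have Tsub: "T \<subseteq> Zf"
  proof
    fix p assume "p \<in> T"
    then obtain n where n: "n \<in> {- int N..int N}" and p: "p = complex_of_real (real_of_int n * pi)" by (auto simp: T_def)
    have "\<bar>real_of_int n\<bar> \<le> real N" using n by auto
    then have "\<bar>real_of_int n * pi\<bar> \<le> real N * pi" by (simp add: abs_mult)
    then have "\<bar>real_of_int n * pi\<bar> < b" using \<delta> by (simp add: b_def)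
    moreover have "sin p = 0" unfolding p by (simp only: sin_of_real) (simp add: sin_zero_iff_int2)
    ultimately show "p \<in> Zf" using b by (auto simp: Zf_def B_def in_box_complex_iff p f_def abs_less_iff)
  qed
  have zf: "zorder f (of_real (real_of_int n * pi)) = (if n = 0 then 2 else 1)" for n
    using zorder_k_sin_k[of n] by (simp add: f_def[abs_def])
  have inj: "inj_on (\<lambda>n. complex_of_real (real_of_int n * pi)) A" for A by (auto simp: inj_on_def)
  have "2 * int N + 2 = (\<Sum>n\<in>{- int N..int N}. (if n = 0 then 2 else (1::int)))"
  proof -
    have "(\<Sum>n\<in>{- int N..int N}. (if n = 0 then 2 else (1::int))) = (\<Sum>n\<in>{- int N..int N}. 1 + (if n = 0 then 1 else 0))"
      by (intro sum.cong) auto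
    also have "\<dots> = 2 * int N + 2" by (simp add: sum.distrib)
    finally show ?thesis by simp
  qed
  also have "\<dots> = (\<Sum>p\<in>T. zorder f p)" unfolding T_def by (subst sum.reindex[OF inj]) (simp only: o_def zf)
  also have "\<dots> \<le> (\<Sum>p\<in>Zf. zorder f p)"
  proof (rule sum_mono2[OF finZ(1) Tsub])
    fix p assume "p \<in> Zf - T"
    then have "f p = 0" by (simp add: Zf_def)
    then have "p = 0 \<or> sin p = 0" by (simp add: f_def)
    then have "sin p = 0" by auto
    then obtain n :: int where "p = of_real (real_of_int n * pi)" using sin_eq_0 by blast
    then show "0 \<le> zorder f p" using zf[of n] by simp
  qed
  finally have big: "2 * N + 2 \<le> card ZF" using cardZ by linarith
  have E_eq: "l \<in> E \<Longrightarrow> l > 0 \<and> sqrt l < b" for l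
  proof -
    assume l: "l \<in> E"
    then have "l > 0" using pos[of "of_real l"] by (simp add: E_def)
    moreover have "sqrt l < sqrt (b\<^sup>2)" using l unfolding E_def by (intro real_sqrt_less_mono) simp
    ultimately show ?thesis using b by simp
  qed
  \<comment> \<open>each \<open>l\<close> in \<open>E\<close> accounts for at most two of the \<open>2 N + 2\<close> zeros\<close>
  have "E \<subseteq> (\<lambda>p. Re (p\<^sup>2)) ` ZF"
  proof
    fix l assume l: "l \<in> E"
    then have *: "l > 0" "sqrt l < b" using E_eq by auto
    have "of_real (sqrt l) \<in> ZF" using * l b by (auto simp: ZF_def B_def in_box_complex_iff F_def E_def simp flip: of_real_power intro: less_le_trans[of _ 0])
    then show "l \<in> (\<lambda>p. Re (p\<^sup>2)) ` ZF" using * by (intro image_eqI[of _ _ "of_real (sqrt l)"]) (auto simp flip: of_real_power)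
  qed
  then show finE: "finite E" using finZ(2) by (rule finite_surj[rotated])
  have "ZF \<subseteq> (\<lambda>l. of_real (sqrt l)) ` E \<union> (\<lambda>l. - of_real (sqrt l)) ` E"
  proof
    fix p assume p: "p \<in> ZF"
    define l where "l = Re (p\<^sup>2)"
    have "char_fun q h H (p\<^sup>2) = 0" using p by (simp add: ZF_def F_def)
    then have l: "l > 0" "p\<^sup>2 = of_real l" using pos[of "p\<^sup>2"] char_fun_zero_real[OF q, of h H "p\<^sup>2"]
      by (auto simp: l_def complex_eq_iff)
    then have "p\<^sup>2 = (of_real (sqrt l))\<^sup>2" by (simp flip: of_real_power)
    then have pp: "p = of_real (sqrt l) \<or> p = - of_real (sqrt l)" by (simp add: power2_eq_iff)
    have "\<bar>Re p\<bar> < b" using p by (auto simp: ZF_def B_def in_box_complex_iff abs_less_iff)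
    then have "sqrt l < b" using pp l by auto
    then have "l < b\<^sup>2" using l by (metis less_imp_le real_sqrt_ge_0_iff real_sqrt_pow2 power_strict_mono zero_less_numeral)
    then have "l \<in> E" using \<open>char_fun q h H (p\<^sup>2) = 0\<close> l by (simp add: E_def)
    then show "p \<in> (\<lambda>l. of_real (sqrt l)) ` E \<union> (\<lambda>l. - of_real (sqrt l)) ` E" using pp by auto
  qed
  then have "card ZF \<le> card ((\<lambda>l. complex_of_real (sqrt l)) ` E \<union> (\<lambda>l. - of_real (sqrt l)) ` E)"
    using finE by (intro card_mono) auto
  also have "\<dots> \<le> card ((\<lambda>l. complex_of_real (sqrt l)) ` E) + card ((\<lambda>l. - complex_of_real (sqrt l)) ` E)"
    by (rule card_Un_le)
  also have "\<dots> \<le> card E + card E" using finE by (intro add_mono card_image_le)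
  finally show "N + 1 \<le> card E" using big by linarith
qed

text \<open>
  The element of index \<open>n\<close> is the one with exactly \<open>n\<close> elements below it.
\<close>

lemma increasing_enumeration:
  fixes S :: "real set" and l :: "nat \<Rightarrow> real"
  assumes inf: "infinite S" and fin: "\<And>r. finite {x \<in> S. x < r}"
  shows "\<exists>!l::nat \<Rightarrow> real. strict_mono l \<and> range l = S"
    and "strict_mono l \<Longrightarrow> range l = S \<Longrightarrow> card {x \<in> S. x < l n} = n"
proof -
  define rk where "rk x = card {y \<in> S. y < x}" for x
  have rk_mono: "rk x < rk y" if "x \<in> S" "x < y" for x y
    unfolding rk_def using that by (intro psubset_card_mono fin) auto
  have rk_le: "rk x \<le> rk y" if "x \<le> y" for x y
    unfolding rk_def using that by (intro card_mono fin) auto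
  have least: "\<exists>m\<in>A. \<forall>a\<in>A. m \<le> a" if A: "A \<subseteq> S" "A \<noteq> {}" for A
  proof -
    obtain a where a: "a \<in> A" using A by blast
    have "finite {x \<in> A. x < a + 1}" by (rule finite_subset[OF _ fin[of "a + 1"]]) (use A in auto)
    moreover have "{x \<in> A. x < a + 1} \<noteq> {}" using a by force
    ultimately have "Min {x \<in> A. x < a + 1} \<in> {x \<in> A. x < a + 1}" "\<forall>x\<in>{x \<in> A. x < a + 1}. Min {x \<in> A. x < a + 1} \<le> x"
      using Min_in Min_le by blast+
    then show ?thesis by (intro bexI[of _ "Min {x \<in> A. x < a + 1}"]) force+
  qed
  have ex: "\<exists>x\<in>S. rk x = n" for n
  proof (induction n)
    case 0
    obtain m where "m \<in> S" "\<forall>a\<in>S. m \<le> a" using least[of S] inf by force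
    then have "{y \<in> S. y < m} = {}" by force
    then show ?case using \<open>m \<in> S\<close> by (intro bexI[of _ m]) (simp_all only: rk_def card.empty)
  next
    case (Suc n)
    then obtain x where x: "x \<in> S" "rk x = n" by blast
    have fx: "finite {y \<in> S. y \<le> x}" using fin[of "x + 1"] by (rule finite_subset[rotated]) auto
    have "{y \<in> S. x < y} \<noteq> {}"
    proof
      assume "{y \<in> S. x < y} = {}"
      then have "S = {y \<in> S. y \<le> x}" by force
      with fx inf show False by simp
    qed
    then obtain y where y: "y \<in> S" "x < y" "\<forall>a\<in>{y \<in> S. x < y}. y \<le> a" using least[of "{y \<in> S. x < y}"] by auto
    then have "{z \<in> S. z < y} = insert x {z \<in> S. z < x}" using x by force
    then have "rk y = Suc n" using x fin[of x] by (simp add: rk_def)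
    then show ?case using y by blast
  qed
  have rk_eq: "rk (l n) = n" if l: "strict_mono l" "range l = S" for l n
  proof -
    have "{y \<in> S. y < l n} = l ` {..<n}"
      using l strict_mono_less[OF l(1)] by (auto simp flip: l(2))
    then show ?thesis using l(1) by (simp add: rk_def card_image strict_mono_on_imp_inj_on strict_mono_imp_inj_on inj_on_subset[OF strict_mono_imp_inj_on[OF l(1)]])
  qed
  then show "strict_mono l \<Longrightarrow> range l = S \<Longrightarrow> card {x \<in> S. x < l n} = n" unfolding rk_def .
  have uniq: "x = y" if "x \<in> S" "y \<in> S" "rk x = rk y" for x y
    using that rk_mono by (metis less_irrefl linorder_neqE)
  define l where "l n = (SOME x. x \<in> S \<and> rk x = n)" for n
  have l: "l n \<in> S" "rk (l n) = n" for n
    using someI_ex[of "\<lambda>x. x \<in> S \<and> rk x = n"] ex[of n] by (auto simp: l_def)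
  show "\<exists>!l::nat \<Rightarrow> real. strict_mono l \<and> range l = S"
  proof (rule ex1I[of _ l])
    have "strict_mono l"
      by (rule strict_monoI) (metis l(2) rk_le not_le)
    moreover have "range l = S"
    proof -
      have "x \<in> range l" if "x \<in> S" for x using uniq[OF that l(1), of "rk x"] l(2) by (metis rangeI)
      then show ?thesis using l(1) by auto
    qed
    ultimately show "strict_mono l \<and> range l = S" by blast
    fix l' :: "nat \<Rightarrow> real" assume l': "strict_mono l' \<and> range l' = S"
    show "l' = l"
    proof
      fix n
      show "l' n = l n" using l' rk_eq[of l' n] l by (intro uniq) auto
    qed
  qed
qed

text \<open>
  The eigenvalues form an infinite set with finitely many elements below any bound, so that they have a
  unique increasing enumeration, and the definition of \<open>schroedinger_lambda\<close> denotes it. They are counted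
  after adding a constant to \<open>q\<close> that makes them positive. The count shows that \<open>\<lambda>\<^sub>N\<close>, so shifted, is less than \<open>(N \<pi> + 2 C / N)\<^sup>2 = (N \<pi>)\<^sup>2 + O(1)\<close>.
\<close>

lemma schroedinger_lambda_properties:
  assumes q: "q absolutely_integrable_on {0..1}"
  shows "strict_mono (schroedinger_lambda q h H)"
    and "char_fun q h H (of_real (schroedinger_lambda q h H n)) = 0"
    and "\<exists>K. \<forall>n. schroedinger_lambda q h H n \<le> (real n * pi)\<^sup>2 + K"
proof -
  obtain c where c: "\<And>z. char_fun q h H z = 0 \<Longrightarrow> Re z > - c"
    using char_fun_zero_bounded_below[OF q, of h H] by blast
  define p where "p x = q x + c" for x
  have p: "p absolutely_integrable_on {0..1}" unfolding p_def
    by (rule set_integral_add(1)[OF q absolutely_integrable_continuous_real]) auto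
  have sh: "char_fun p h H z = char_fun q h H (z - of_real c)" for z
    using reg_shift(3)[of q c h H "z - of_real c"] by (simp add: p_def[abs_def])
  have pos: "Re z > 0" if "char_fun p h H z = 0" for z
    using c[of "z - of_real c"] that by (simp add: sh)
  obtain C where C: "C > 0" "\<And>k. cmod k \<ge> 1 \<Longrightarrow> cmod (char_fun p h H (k\<^sup>2) + k * sin k) \<le> C * exp \<bar>Im k\<bar>"
    using char_fun_asymp[OF p, of h H] by blast
  define S where "S = {x::real. char_fun q h H (of_real x) = 0}"
  define b where "b N = real N * pi + 2 * C / real N" for N :: nat
  \<comment> \<open>the count for the shifted potential, translated back\<close>
  have cnt: "finite {x \<in> S. x < (b N)\<^sup>2 - c} \<and> N + 1 \<le> card {x \<in> S. x < (b N)\<^sup>2 - c}"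
    if N: "real N \<ge> 2 * C" "N \<ge> 1" for N
  proof -
    define E where "E = {l. char_fun p h H (complex_of_real l) = 0 \<and> l < (b N)\<^sup>2}"
    have "finite E" "N + 1 \<le> card E"
      using eigenvalue_count[OF p pos C N] by (auto simp: E_def b_def)
    moreover have "E = (\<lambda>x. x + c) ` {x \<in> S. x < (b N)\<^sup>2 - c}"
    proof -
      have "l \<in> (\<lambda>x. x + c) ` {x \<in> S. x < (b N)\<^sup>2 - c}" if "l \<in> E" for l
        using that by (intro image_eqI[of _ _ "l - c"]) (auto simp: E_def S_def sh)
      then show ?thesis by (auto simp: E_def S_def sh)
    qed
    moreover have "inj_on (\<lambda>x. x + c) {x \<in> S. x < (b N)\<^sup>2 - c}" by (auto simp: inj_on_def)
    ultimately show ?thesis by (simp add: card_image finite_image_iff)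
  qed
  obtain N0 :: nat where "real N0 \<ge> max (2 * C) 1" using real_arch_simple by blast
  then have N0: "real N0 \<ge> 2 * C" "N0 \<ge> 1" by auto
  have fin: "finite {x \<in> S. x < r}" for r
  proof -
    obtain N :: nat where N: "real N \<ge> max (real N0) (r + c)" using real_arch_simple by blast
    have N': "real N \<ge> 2 * C" "N \<ge> 1" using N N0 by auto
    have "real N \<le> b N" using C(1) pi_gt3 mult_left_mono[of 1 pi "real N"] by (simp add: b_def add_increasing2)
    moreover have "b N \<ge> 1" using N' calculation by simp
    ultimately have "real N \<le> (b N)\<^sup>2" by (metis order_trans self_le_power zero_less_numeral)
    then have "r \<le> (b N)\<^sup>2 - c" using N by simp
    then show ?thesis using cnt[OF N'] by (auto intro: finite_subset[rotated])
  qed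
  have inf: "infinite S"
  proof
    assume f: "finite S"
    define N where "N = N0 + card S"
    have N': "real N \<ge> 2 * C" "N \<ge> 1" using N0 by (auto simp: N_def)
    have "card {x \<in> S. x < (b N)\<^sup>2 - c} \<le> card S" using f by (intro card_mono) auto
    then show False using cnt[OF N'] by (simp add: N_def)
  qed
  have ev: "{z. schroedinger_eigenvalue q h H z} = complex_of_real ` S"
  proof -
    have "z \<in> complex_of_real ` S" if "char_fun q h H z = 0" for z
    proof -
      have "z = of_real (Re z)" using char_fun_zero_real[OF q that] by (simp add: complex_eq_iff)
      moreover from this have "Re z \<in> S" using that by (simp add: S_def)
      ultimately show ?thesis by (rule image_eqI)
    qed
    then show ?thesis by (auto simp: eigenvalue_iff_char_fun[OF q] S_def)
  qed
  have iff: "range (\<lambda>j. complex_of_real (l j)) = {z. schroedinger_eigenvalue q h H z} \<longleftrightarrow> range l = S" for l :: "nat \<Rightarrow> real"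
  proof -
    have "range (\<lambda>j. complex_of_real (l j)) = complex_of_real ` range l" by auto
    then show ?thesis unfolding ev by (simp add: inj_image_eq_iff inj_of_real)
  qed
  note en = increasing_enumeration[OF inf fin]
  have th: "strict_mono (schroedinger_lambda q h H) \<and> range (schroedinger_lambda q h H) = S"
    unfolding schroedinger_lambda_def iff by (rule theI'[OF en(1)])
  then show sm: "strict_mono (schroedinger_lambda q h H)" by blast
  show "char_fun q h H (of_real (schroedinger_lambda q h H n)) = 0"
    using th S_def by blast
  define l where "l = schroedinger_lambda q h H"
  have rk: "card {x \<in> S. x < l n} = n" for n using en(2) th by (auto simp: l_def)
  have up: "l N < (b N)\<^sup>2 - c" if N: "real N \<ge> 2 * C" "N \<ge> 1" for N
  proof (rule ccontr)
    assume "\<not> l N < (b N)\<^sup>2 - c"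
    then have "card {x \<in> S. x < (b N)\<^sup>2 - c} \<le> card {x \<in> S. x < l N}" by (intro card_mono fin) auto
    then show False using cnt[OF N] rk[of N] by simp
  qed
  define K where "K = 4 * pi * C + 4 * C\<^sup>2 + \<bar>c\<bar> + \<bar>l N0\<bar>"
  have "l n \<le> (real n * pi)\<^sup>2 + K" for n
  proof (cases "n \<ge> N0")
    case True
    then have n: "real n \<ge> 2 * C" "n \<ge> 1" using N0 by auto
    have "(b n)\<^sup>2 = (real n * pi)\<^sup>2 + 4 * pi * C + (2 * C / real n)\<^sup>2"
      using n by (simp add: b_def power2_sum)
    moreover have "(2 * C / real n)\<^sup>2 \<le> (2 * C)\<^sup>2"
      using n C(1) by (intro power_mono) (auto simp: divide_le_eq)
    ultimately show ?thesis using up[OF n] by (simp add: K_def power_mult_distrib)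
  next
    case False
    then have "l n \<le> l N0" using sm by (simp add: l_def strict_mono_less_eq)
    moreover have "4 * pi * C + 4 * C\<^sup>2 \<ge> 0" "(real n * pi)\<^sup>2 \<ge> 0" using C(1) by auto
    ultimately show ?thesis unfolding K_def by linarith
  qed
  then show "\<exists>K. \<forall>n. schroedinger_lambda q h H n \<le> (real n * pi)\<^sup>2 + K" by (auto simp: l_def)
qed

section \<open>Entire functions with many zeros\<close>

lemma divide_out_zeros:
  assumes "finite A" "A \<subseteq> U" "open U" "f holomorphic_on U" "\<And>a. a \<in> A \<Longrightarrow> f a = 0"
  shows "\<exists>g. g holomorphic_on U \<and> (\<forall>z\<in>U. f z = g z * (\<Prod>a\<in>A. z - a))"
  using assms
proof (induction A rule: finite_induct)
  case empty
  then show ?case by (intro exI[of _ f]) auto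
next
  case (insert a A)
  then obtain g where g: "g holomorphic_on U" "\<And>z. z \<in> U \<Longrightarrow> f z = g z * (\<Prod>a\<in>A. z - a)" by auto
  have "(\<Prod>b\<in>A. a - b) \<noteq> 0" using insert.hyps by auto
  moreover have "f a = 0" "a \<in> U" using insert.prems by auto
  ultimately have ga: "g a = 0" using g(2)[of a] by simp
  define G where "G z = (if z = a then deriv g a else (g z - g a) / (z - a))" for z
  have "G holomorphic_on U" unfolding G_def
    using g(1) \<open>a \<in> U\<close> insert.prems(2) by (intro pole_lemma) (auto simp: interior_open)
  moreover have "f z = G z * (\<Prod>a\<in>insert a A. z - a)" if "z \<in> U" for z
    using insert.hyps g(2)[OF that] ga by (cases "z = a") (auto simp: G_def)
  ultimately show ?case by blast
qed

text \<open>
  Removing simple zeros leaves none: a remaining zero would be a double zero of \<open>f\<close>.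
\<close>

lemma divide_out_simple_zeros:
  assumes "finite A" "A \<subseteq> U" "open U" "f holomorphic_on U"
    and zeros: "\<And>z. z \<in> U \<Longrightarrow> f z = 0 \<longleftrightarrow> z \<in> A" and simple: "\<And>a. a \<in> A \<Longrightarrow> deriv f a \<noteq> 0"
  shows "\<exists>g. g holomorphic_on U \<and> (\<forall>z\<in>U. f z = g z * (\<Prod>a\<in>A. z - a) \<and> g z \<noteq> 0)"
proof -
  obtain g where g: "g holomorphic_on U" "\<And>z. z \<in> U \<Longrightarrow> f z = g z * (\<Prod>a\<in>A. z - a)"
    using divide_out_zeros[of A U f] assms by blast
  have "g z \<noteq> 0" if z: "z \<in> U" for z
  proof
    assume gz: "g z = 0"
    then have "f z = 0" using g z by simp
    then have zA: "z \<in> A" using zeros z by blast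
    define u where "u w = g w * (\<Prod>a\<in>A - {z}. w - a)" for w
    have uh: "u holomorphic_on U" unfolding u_def[abs_def] by (intro holomorphic_intros g)
    have feq: "f w = u w * (w - z)" if "w \<in> U" for w
      using g(2)[OF that] prod.remove[OF assms(1) zA, of "\<lambda>a. w - a"] by (simp add: u_def mult_ac)
    have du: "(u has_field_derivative deriv u z) (at z)"
      using holomorphic_derivI[OF uh assms(3) z] .
    have "u z = 0" using gz by (simp add: u_def)
    then have "((\<lambda>w. u w * (w - z)) has_field_derivative 0) (at z)"
      using DERIV_mult[OF du DERIV_diff[OF DERIV_ident DERIV_const[of z]]] by simp
    then have "(f has_field_derivative 0) (at z)"
      by (rule has_field_derivative_transform_within_open[OF _ assms(3) z]) (simp add: feq)
    then show False using simple[OF zA] by (simp add: DERIV_imp_deriv)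
  qed
  with g show ?thesis by blast
qed

lemma blaschke_factor_norm:
  assumes "cmod z = R" "R > 0"
  shows "cmod (of_real R - of_real a * z / of_real R) = cmod (z - of_real a)"
proof -
  have zz: "z * cnj z = of_real (R\<^sup>2)" using assms complex_norm_square[of z] by simp
  have "z \<noteq> 0" using assms by auto
  have "of_real R - of_real a * z / of_real R = (z * cnj z - of_real a * z) / of_real R"
    using assms by (simp add: zz field_simps power2_eq_square)
  also have "\<dots> = z * cnj (z - of_real a) / of_real R" by (simp add: algebra_simps)
  also have "cmod \<dots> = cmod (z - of_real a)"
    using assms by (simp only: norm_mult norm_divide complex_mod_cnj norm_of_real) simp
  finally show ?thesis .
qed

text \<open>
  Divide \<open>f\<close> and \<open>c\<close> by the linear factors of their zeros \<open>A\<close> and \<open>B\<close>, and multiply each by the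
  conjugate factors \<open>R - a z / R\<close>, which have the same modulus as \<open>z - a\<close> on the circle. The
  quotient \<open>M\<close> is then holomorphic, as large as \<open>f / c\<close> on the circle, and its value at \<open>0\<close> compares the
  two sets of zeros.
\<close>

lemma blaschke_comparison:
  fixes A B :: "real set"
  assumes U: "open U" "cball 0 R \<subseteq> U" and R: "R > 0"
    and f: "f holomorphic_on U" and c: "c holomorphic_on U"
    and fin: "finite A" "finite B" and card: "card A = card B"
    and A: "\<And>a. a \<in> A \<Longrightarrow> \<bar>a\<bar> < R \<and> f (of_real a) = 0"
    and B: "\<And>b. b \<in> B \<Longrightarrow> \<bar>b\<bar> < R \<and> deriv c (of_real b) \<noteq> 0"
    and zeros: "\<And>z. z \<in> U \<Longrightarrow> c z = 0 \<longleftrightarrow> z \<in> of_real ` B"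
    and nz: "0 \<notin> A" "0 \<notin> B"
  obtains M where "M holomorphic_on ball 0 R" "continuous_on (cball 0 R) M"
    "\<And>z. cmod z = R \<Longrightarrow> cmod (M z) = cmod (f z) / cmod (c z)"
    "cmod (M 0) = cmod (f 0) / cmod (c 0) * ((\<Prod>b\<in>B. \<bar>b\<bar>) / (\<Prod>a\<in>A. \<bar>a\<bar>))"
proof -
  have sub: "complex_of_real ` A \<subseteq> U" "complex_of_real ` B \<subseteq> U"
    using A B U(2) by (auto simp: subset_iff less_imp_le)
  have reind: "(\<Prod>a\<in>complex_of_real ` X. z - a) = (\<Prod>a\<in>X. z - of_real a)" for X z
    by (subst prod.reindex) (auto simp: inj_on_def)
  obtain g1 where g1: "g1 holomorphic_on U" "\<And>z. z \<in> U \<Longrightarrow> f z = g1 z * (\<Prod>a\<in>A. z - of_real a)"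
    using divide_out_zeros[OF _ sub(1) U(1) f] fin A unfolding reind by blast
  obtain g2 where g2: "g2 holomorphic_on U" "\<And>z. z \<in> U \<Longrightarrow> c z = g2 z * (\<Prod>b\<in>B. z - of_real b)"
    "\<And>z. z \<in> U \<Longrightarrow> g2 z \<noteq> 0"
    using divide_out_simple_zeros[OF _ sub(2) U(1) c zeros] fin B unfolding reind by blast
  define P where "P X z = (\<Prod>a\<in>X. of_real R - of_real a * z / of_real R)" for X :: "real set" and z :: complex
  have Pn: "cmod (P X z) = (\<Prod>a\<in>X. cmod (z - of_real a))" if "cmod z = R" for X z
    unfolding P_def prod_norm[symmetric] using blaschke_factor_norm[OF that R] by simp
  have PB: "P B z \<noteq> 0" if "z \<in> cball 0 R" for z
  proof
    assume "P B z = 0"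
    then obtain b where b: "b \<in> B" "of_real R - of_real b * z / of_real R = 0" using fin by (auto simp: P_def)
    then have "of_real b * z = of_real (R * R)" using R by (simp add: field_simps)
    then have "cmod (of_real b * z) = cmod (of_real (R * R))" by simp
    then have "\<bar>b\<bar> * cmod z = R * R" using R by (simp only: norm_mult norm_of_real) simp
    moreover have "\<bar>b\<bar> * cmod z \<le> \<bar>b\<bar> * R" using that by (intro mult_left_mono) auto
    moreover have "\<bar>b\<bar> * R < R * R" using B[OF b(1)] R by simp
    ultimately show False by simp
  qed
  define M where "M z = g1 z / g2 z * (P A z / P B z)" for z
  have Pholo: "P X holomorphic_on S" for X S unfolding P_def[abs_def] by (intro holomorphic_intros) (use R in auto)
  have bc: "ball 0 R \<subseteq> U" using U(2) by (metis ball_subset_cball order_trans)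
  show ?thesis
  proof (rule that[of M])
    show "M holomorphic_on ball 0 R"
      unfolding M_def[abs_def]
      using g2(3) bc PB by (intro holomorphic_intros Pholo holomorphic_on_subset[OF g1(1)] holomorphic_on_subset[OF g2(1)]) auto
    show "continuous_on (cball 0 R) M"
      unfolding M_def[abs_def]
      using g2(3) U(2) PB
      by (intro continuous_intros holomorphic_on_imp_continuous_on[OF Pholo]
          holomorphic_on_imp_continuous_on[OF holomorphic_on_subset[OF g1(1)]]
          holomorphic_on_imp_continuous_on[OF holomorphic_on_subset[OF g2(1)]]) auto
    show "cmod (M z) = cmod (f z) / cmod (c z)" if z: "cmod z = R" for z
    proof -
      have "z \<in> U" using z U(2) by auto
      then show ?thesis
        unfolding M_def by (simp add: norm_mult norm_divide Pn[OF z] g1 g2 prod_norm)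
    qed
    have P0: "P X 0 = of_real R ^ card X" for X by (simp add: P_def)
    have U0: "0 \<in> U" using U(2) R by auto
    have "cmod (f 0) = cmod (g1 0) * (\<Prod>a\<in>A. \<bar>a\<bar>)" "cmod (c 0) = cmod (g2 0) * (\<Prod>b\<in>B. \<bar>b\<bar>)"
      using g1(2)[OF U0] g2(2)[OF U0] by (simp_all add: norm_mult flip: prod_norm)
    moreover have "(\<Prod>a\<in>A. \<bar>a\<bar>) \<noteq> 0" "(\<Prod>b\<in>B. \<bar>b\<bar>) \<noteq> 0" using nz fin by auto
    ultimately show "cmod (M 0) = cmod (f 0) / cmod (c 0) * ((\<Prod>b\<in>B. \<bar>b\<bar>) / (\<Prod>a\<in>A. \<bar>a\<bar>))"
      using R g2(3)[OF U0] unfolding M_def P0 card by (simp add: norm_divide norm_mult)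
  qed
qed

text \<open>
  Where \<open>\<bar>Im w\<bar> \<ge> 1\<close> the bound comes from \<open>sinh\<close>. Elsewhere \<open>\<bar>Re w\<bar>\<close> lies within \<open>1/3\<close> of \<open>m \<pi>\<close>, where
  the cosine is at least \<open>1/2\<close> in modulus.
\<close>

lemma cos_large_on_circle:
  assumes w: "cmod w = real m * pi" and m: "m \<ge> 1"
  shows "exp \<bar>Im w\<bar> / 6 \<le> cmod (cos w)"
proof (cases "\<bar>Im w\<bar> \<ge> 1")
  case True
  have "\<bar>sinh (Im w)\<bar> = sinh \<bar>Im w\<bar>" by (simp add: abs_if)
  moreover have "exp \<bar>Im w\<bar> / 6 \<le> exp \<bar>Im w\<bar> / 4" by simp
  ultimately show ?thesis
    using exp_le_4_sinh[OF True] abs_sinh_le_cmod_cos[of w] by linarith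
next
  case False
  define x where "x = \<bar>Re w\<bar>"
  have mpi: "real m * pi \<ge> 3" using m pi_gt3 mult_mono[of 1 "real m" 3 pi] by simp
  have x: "0 \<le> x" "x \<le> real m * pi" using abs_Re_le_cmod[of w] w by (auto simp: x_def)
  have "(real m * pi)\<^sup>2 = x\<^sup>2 + (Im w)\<^sup>2" using cmod_power2[of w] w by (simp add: x_def)
  moreover have "(Im w)\<^sup>2 \<le> 1" using False by (simp add: abs_square_le_1)
  ultimately have "(real m * pi - x) * (real m * pi + x) \<le> 1" by (simp add: power2_eq_square algebra_simps)
  moreover have "(real m * pi - x) * 3 \<le> (real m * pi - x) * (real m * pi + x)"
    using x mpi by (intro mult_left_mono) auto
  ultimately have d: "real m * pi - x \<le> 1 / 3" by simp
  have "cos (pi / 3) \<le> cos (real m * pi - x)" using d x pi_gt3 by (intro cos_monotone_0_pi_le) auto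
  then have "1 / 2 \<le> \<bar>cos (real m * pi - x)\<bar>" by (simp add: cos_60)
  also have "\<dots> = \<bar>cos x\<bar>" by (simp add: cos_diff cos_npi sin_npi abs_mult power_abs)
  also have "\<dots> = \<bar>cos (Re w)\<bar>" by (auto simp: x_def abs_if)
  also have "\<dots> \<le> cmod (cos w)" by (rule power2_le_imp_le) (auto simp: cmod_cos_power2)
  finally have "1 / 2 \<le> cmod (cos w)" .
  moreover have "exp \<bar>Im w\<bar> \<le> exp 1" using False by simp
  moreover have "exp 1 \<le> (3::real)" by (rule exp_le)
  ultimately show ?thesis by linarith
qed

text \<open>
  The product of the factors \<open>1 + K / b\<^sub>j\<^sup>2\<close> converges, as \<open>b\<^sub>j\<close> grows linearly.
\<close>

lemma prod_ratio_bounded_below: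
  assumes K: "K \<ge> 0" and \<alpha>: "\<And>j. 0 < \<alpha> j" "\<And>j. \<alpha> j \<le> (real (2 * j + 1) * pi)\<^sup>2 + K"
  obtains \<kappa> where "\<kappa> > 0" "\<And>m. \<kappa> \<le> (\<Prod>j<m. (real (2 * j + 1) * pi)\<^sup>2 / \<alpha> j)"
proof -
  define S where "S = (\<Sum>j. 1 / (real (Suc j))\<^sup>2)"
  have sm: "summable (\<lambda>j. 1 / (real (Suc j))\<^sup>2)"
    using inverse_power_summable[of 2, where 'a=real] by (subst summable_Suc_iff) (simp add: inverse_eq_divide)
  show ?thesis
  proof (rule that[of "exp (- (K * S))"])
    fix m
    have "exp (- (K * S)) \<le> exp (- (K * (\<Sum>j<m. 1 / (real (Suc j))\<^sup>2)))"
      using K sum_le_suminf[OF sm, of "{..<m}"] by (simp add: S_def mult_left_mono)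
    also have "\<dots> = (\<Prod>j<m. exp (- (K * (1 / (real (Suc j))\<^sup>2))))"
      by (simp add: exp_sum sum_distrib_left flip: sum_negf)
    also have "\<dots> \<le> (\<Prod>j<m. (real (2 * j + 1) * pi)\<^sup>2 / \<alpha> j)"
    proof (rule prod_mono, safe)
      fix j
      define b where "b = (real (2 * j + 1) * pi)\<^sup>2"
      have b: "b > 0" by (simp add: b_def)
      have "real (Suc j) * 1 \<le> real (2 * j + 1) * pi" using pi_gt3 by (intro mult_mono) auto
      then have sj: "(real (Suc j))\<^sup>2 \<le> b" unfolding b_def by (intro power_mono) auto
      have "1 + K / b \<le> exp (K / b)" by (rule exp_ge_add_one_self)
      also have "\<dots> \<le> exp (K * (1 / (real (Suc j))\<^sup>2))"
        using K b sj divide_left_mono[OF sj K] by simp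
      finally have e: "1 + K / b \<le> exp (K * (1 / (real (Suc j))\<^sup>2))" .
      have "\<alpha> j \<le> b * (1 + K / b)" using \<alpha>(2)[of j, folded b_def] b by (simp add: distrib_left)
      also have "\<dots> \<le> b * exp (K * (1 / (real (Suc j))\<^sup>2))" using e b by (intro mult_left_mono) auto
      finally have "\<alpha> j * exp (- (K * (1 / (real (Suc j))\<^sup>2))) \<le> b * exp (K * (1 / (real (Suc j))\<^sup>2)) * exp (- (K * (1 / (real (Suc j))\<^sup>2)))"
        by (intro mult_right_mono) auto
      also have "\<dots> = b" by (simp add: exp_minus)
      finally show "exp (- (K * (1 / (real (Suc j))\<^sup>2))) \<le> (real (2 * j + 1) * pi)\<^sup>2 / \<alpha> j"
        unfolding b_def[symmetric] using \<alpha>(1)[of j] by (simp add: pos_le_divide_eq mult.commute)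
    qed auto
    finally show "exp (- (K * S)) \<le> (\<Prod>j<m. (real (2 * j + 1) * pi)\<^sup>2 / \<alpha> j)" .
  qed simp
qed

text \<open>
  A function of \<open>k\<^sup>2\<close> has its zeros in pairs \<open>\<plusminus> a\<^sub>j\<close>.
\<close>

lemma plus_minus_set:
  fixes a :: "nat \<Rightarrow> real" and m :: nat
  assumes pos: "\<And>j. 0 < a j" and inj: "inj a"
  defines "X \<equiv> a ` {..<m} \<union> (\<lambda>j. - a j) ` {..<m}"
  shows "card X = 2 * m" "(\<Prod>x\<in>X. \<bar>x\<bar>) = (\<Prod>j<m. (a j)\<^sup>2)" "finite X" "0 \<notin> X"
proof -
  have dis: "a ` {..<m} \<inter> (\<lambda>j. - a j) ` {..<m} = {}"
  proof -
    have "a i \<noteq> - a j" for i j using pos[of i] pos[of j] by linarith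
    then show ?thesis by auto
  qed
  have i1: "inj_on a {..<m}" and i2: "inj_on (\<lambda>j. - a j) {..<m}" using inj by (auto simp: inj_on_def inj_def)
  show "card X = 2 * m" unfolding X_def by (subst card_Un_disjoint) (use dis i1 i2 in \<open>auto simp: card_image\<close>)
  have "(\<Prod>x\<in>X. \<bar>x\<bar>) = (\<Prod>j<m. \<bar>a j\<bar>) * (\<Prod>j<m. \<bar>- a j\<bar>)"
    unfolding X_def by (subst prod.union_disjoint) (use dis i1 i2 in \<open>auto simp: prod.reindex\<close>)
  also have "\<dots> = (\<Prod>j<m. (a j)\<^sup>2)" by (simp add: power2_eq_square flip: prod.distrib)
  finally show "(\<Prod>x\<in>X. \<bar>x\<bar>) = (\<Prod>j<m. (a j)\<^sup>2)" .
  show "finite X" by (simp add: X_def)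
  have "a j \<noteq> 0" for j using pos[of j] by simp
  then show "0 \<notin> X" by (auto simp: X_def)
qed

text \<open>
  Compare \<open>f\<close> on the circle of radius \<open>R = 2 m \<pi>\<close> with \<open>c(k) = cos (k/2)\<close>, which has the \<open>2 m\<close> zeros
  \<open>\<plusminus> (2 j + 1) \<pi>\<close> inside. By \<open>blaschke_comparison\<close> there is \<open>M\<close> with \<open>\<bar>M\<bar> = \<bar>f / c\<bar>\<close> on the circle and
  \<open>\<bar>M(0)\<bar> \<ge> \<kappa> \<bar>f(0)\<bar>\<close>, where \<open>\<kappa>\<close> does not depend on \<open>R\<close>. On the circle \<open>\<bar>M\<bar> \<le> 6 C\<close>, and
  \<open>\<bar>M\<bar> \<le> 6 e\<close> where \<open>\<bar>Im k\<bar> \<ge> t\<close>. Of any two points \<open>z\<close> and \<open>\<i> z\<close> of the circle at least one is in the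
  latter region, so \<open>\<bar>M(z) M(\<i> z)\<bar> \<le> 36 C e\<close>, and the maximum principle bounds \<open>M(0)\<^sup>2\<close> by
  \<open>36 C e\<close> with \<open>e\<close> arbitrarily small.
\<close>

lemma half_type_with_odd_pi_zeros:
  assumes f: "f holomorphic_on UNIV"
    and C: "C > 0" "\<And>k. cmod k \<ge> 1 \<Longrightarrow> cmod (f k) \<le> C * exp (\<bar>Im k\<bar> / 2)"
    and small: "\<And>e. e > 0 \<Longrightarrow> \<exists>t. \<forall>k. cmod k \<ge> 1 \<longrightarrow> \<bar>Im k\<bar> \<ge> t \<longrightarrow> cmod (f k) \<le> e * exp (\<bar>Im k\<bar> / 2)"
    and K: "K \<ge> 0" and \<alpha>: "\<And>j. 0 < \<alpha> j" "\<And>j. \<alpha> j \<le> (real (2 * j + 1) * pi)\<^sup>2 + K" and inj: "inj \<alpha>"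
    and zero: "\<And>j. f (of_real (sqrt (\<alpha> j))) = 0" "\<And>j. f (- of_real (sqrt (\<alpha> j))) = 0"
  shows "f 0 = 0"
proof (rule ccontr)
  assume f0: "f 0 \<noteq> 0"
  obtain \<kappa> where \<kappa>: "\<kappa> > 0" "\<And>m. \<kappa> \<le> (\<Prod>j<m. (real (2 * j + 1) * pi)\<^sup>2 / \<alpha> j)"
    using prod_ratio_bounded_below[OF K \<alpha>] by blast
  \<comment> \<open>so that the final estimate reads \<open>(\<bar>f 0\<bar> \<kappa>)\<^sup>2 \<le> 36 C e = (\<bar>f 0\<bar> \<kappa>)\<^sup>2 / 2\<close>\<close>
  define e where "e = (cmod (f 0) * \<kappa>)\<^sup>2 / (72 * C)"
  have e: "e > 0" using f0 \<kappa> C by (simp add: e_def)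
  obtain t where t: "\<And>k. cmod k \<ge> 1 \<Longrightarrow> \<bar>Im k\<bar> \<ge> t \<Longrightarrow> cmod (f k) \<le> e * exp (\<bar>Im k\<bar> / 2)"
    using small[OF e] by blast
  obtain m :: nat where m: "real m \<ge> max (K + 1) t" using real_arch_simple by blast
  have m1: "m \<ge> 1" using m K by auto
  define R where "R = 2 * (real m * pi)"
  have mpi: "real m * pi \<ge> real m * 3" using pi_gt3 by (intro mult_left_mono) auto
  have R: "R \<ge> 6" "R > 0" "R \<ge> 2 * t" using mpi m of_nat_mono[OF m1, where 'a=real] unfolding R_def by linarith+
  define a where "a j = sqrt (\<alpha> j)" for j
  define b where "b j = real (2 * j + 1) * pi" for j
  define A where "A = a ` {..<m} \<union> (\<lambda>j. - a j) ` {..<m}"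
  define B where "B = b ` {..<m} \<union> (\<lambda>j. - b j) ` {..<m}"
  have apos: "0 < a j" for j using \<alpha> by (simp add: a_def)
  have bpos: "0 < b j" for j by (simp add: b_def)
  have inja: "inj a" using inj by (auto simp: a_def inj_def)
  have injb: "inj b" by (auto simp: b_def inj_def)
  note A = plus_minus_set[OF apos inja, of m, folded A_def] and B = plus_minus_set[OF bpos injb, of m, folded B_def]
  have aR: "a j < R" if "j < m" for j
  proof -
    have "real (2 * j + 1) \<le> 2 * real m - 1" using that by linarith
    then have "(real (2 * j + 1) * pi)\<^sup>2 \<le> ((2 * real m - 1) * pi)\<^sup>2" by (intro power_mono mult_right_mono) auto
    then have "\<alpha> j \<le> ((2 * real m - 1) * pi)\<^sup>2 + K" using \<alpha>(2)[of j] by simp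
    also have "K < (4 * real m - 1) * pi\<^sup>2"
    proof -
      have "K * 1 < (4 * real m - 1) * pi\<^sup>2"
        using m m1 K pi_gt3 by (intro mult_less_le_imp_less) (auto simp: power2_eq_square intro: order_trans[OF _ mult_mono[of 1 pi 1 pi]])
      then show ?thesis by simp
    qed
    also have "((2 * real m - 1) * pi)\<^sup>2 + (4 * real m - 1) * pi\<^sup>2 = R\<^sup>2"
      by (simp add: R_def power2_eq_square algebra_simps)
    finally have "\<alpha> j < R\<^sup>2" by simp
    then have "sqrt (\<alpha> j) < sqrt (R\<^sup>2)" by (rule real_sqrt_less_mono)
    then show ?thesis using R by (simp add: a_def)
  qed
  have bR: "b j < R" if "j < m" for j
  proof -
    have "real (2 * j + 1) < 2 * real m" using that by linarith
    then have "real (2 * j + 1) * pi < 2 * real m * pi" by (intro mult_strict_right_mono) auto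
    then show ?thesis by (simp add: b_def R_def)
  qed
  define c where "c k = cos (k / 2)" for k :: complex
  \<comment> \<open>small enough to contain no further zero of \<open>c\<close>, as the next one is at \<open>R + \<pi>\<close>\<close>
  define U where "U = ball (0::complex) (R + 1)"
  have chol: "c holomorphic_on S" for S unfolding c_def[abs_def] by (intro holomorphic_intros) auto
  have cb: "c (of_real (real_of_int (2 * n + 1) * pi)) = 0" for n
  proof -
    have "complex_of_real (real_of_int (2 * n + 1) * pi) / 2 = of_real (real_of_int n * pi) + of_real pi / 2"
      by (simp add: field_simps)
    then show ?thesis unfolding c_def by (subst cos_eq_0) blast
  qed
  have Bint: "x \<in> B \<longleftrightarrow> (\<exists>n::int. x = real_of_int (2 * n + 1) * pi \<and> - int m \<le> n \<and> n < int m)" for x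
  proof
    assume "x \<in> B"
    then obtain j where j: "j < m" "x = b j \<or> x = - b j" by (auto simp: B_def)
    then show "\<exists>n::int. x = real_of_int (2 * n + 1) * pi \<and> - int m \<le> n \<and> n < int m"
    proof (elim disjE)
      assume "x = b j" then show ?thesis using j by (intro exI[of _ "int j"]) (auto simp: b_def)
    next
      assume "x = - b j" then show ?thesis using j by (intro exI[of _ "- int j - 1"]) (auto simp: b_def algebra_simps)
    qed
  next
    assume "\<exists>n::int. x = real_of_int (2 * n + 1) * pi \<and> - int m \<le> n \<and> n < int m"
    then obtain n :: int where n: "x = real_of_int (2 * n + 1) * pi" "- int m \<le> n" "n < int m" by blast
    show "x \<in> B"
    proof (cases "n \<ge> 0")
      case True
      then have "x = b (nat n)" "nat n < m" using n by (auto simp: b_def)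
      then show ?thesis by (auto simp: B_def)
    next
      case False
      then have "x = - b (nat (- n - 1))" "nat (- n - 1) < m" using n by (auto simp: b_def algebra_simps)
      then show ?thesis by (auto simp: B_def)
    qed
  qed
  have zeros: "c z = 0 \<longleftrightarrow> z \<in> of_real ` B" if z: "z \<in> U" for z
  proof
    assume "c z = 0"
    then obtain n :: int where "z / 2 = of_real (real_of_int n * pi) + of_real pi / 2" unfolding c_def cos_eq_0 by blast
    then have zn: "z = of_real (real_of_int (2 * n + 1) * pi)" by (simp add: field_simps)
    have "\<bar>real_of_int (2 * n + 1)\<bar> * pi < R + 1"
      using z zn by (simp add: U_def norm_mult abs_mult del: of_real_mult of_int_add of_int_mult)
    also have "\<dots> < (2 * real m + 1) * pi" using pi_gt3 by (simp add: R_def algebra_simps)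
    finally have "\<bar>real_of_int (2 * n + 1)\<bar> < 2 * real m + 1" by (simp add: mult_less_cancel_right)
    then have "\<bar>2 * n + 1\<bar> < 2 * int m + 1" by linarith
    then have "- int m \<le> n \<and> n < int m" by linarith
    then show "z \<in> of_real ` B" using zn Bint by blast
  next
    assume "z \<in> of_real ` B"
    then obtain x where "x \<in> B" "z = of_real x" by blast
    then show "c z = 0" using Bint[of x] cb by blast
  qed
  have derivc: "deriv c (of_real x) \<noteq> 0" if "x \<in> B" for x
  proof -
    have cz: "cos (complex_of_real x / 2) = 0"
      using Bint[of x] cb that unfolding c_def by blast
    have "deriv c (of_real x) = - sin (of_real x / 2) / 2"
      unfolding c_def[abs_def] by (rule DERIV_imp_deriv) (auto intro!: derivative_eq_intros)
    moreover have "w = 0 \<Longrightarrow> v = 0 \<Longrightarrow> w\<^sup>2 + v\<^sup>2 \<noteq> 1" for w v :: complex by simp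
    then have "sin (complex_of_real x / 2) \<noteq> 0" using sin_cos_squared_add[of "complex_of_real x / 2"] cz by metis
    ultimately show ?thesis by simp
  qed
  obtain M where M: "M holomorphic_on ball 0 R" "continuous_on (cball 0 R) M"
    and Mz: "\<And>z. cmod z = R \<Longrightarrow> cmod (M z) = cmod (f z) / cmod (c z)"
    and M0: "cmod (M 0) = cmod (f 0) / cmod (c 0) * ((\<Prod>b\<in>B. \<bar>b\<bar>) / (\<Prod>a\<in>A. \<bar>a\<bar>))"
  proof (rule blaschke_comparison[of U R f c A B])
    show "\<bar>x\<bar> < R \<and> f (of_real x) = 0" if xA: "x \<in> A" for x
    proof -
      obtain j where j: "j < m" "x = a j \<or> x = - a j" using xA by (auto simp: A_def)
      then have "\<bar>x\<bar> = a j" using apos[of j] by auto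
      then show ?thesis using j(2) aR[OF j(1)] zero[of j] by (auto simp: a_def)
    qed
    show "\<bar>x\<bar> < R \<and> deriv c (of_real x) \<noteq> 0" if xB: "x \<in> B" for x
    proof
      obtain j where j: "j < m" "x = b j \<or> x = - b j" using xB by (auto simp: B_def)
      then have "\<bar>x\<bar> = b j" using bpos[of j] by auto
      then show "\<bar>x\<bar> < R" using bR[OF j(1)] by simp
    qed (rule derivc[OF xB])
    show "f holomorphic_on U" using f by (rule holomorphic_on_subset) auto
  qed (use R A B zeros chol in \<open>auto simp: U_def\<close>)
  have "cmod (f 0) * \<kappa> \<le> cmod (M 0)"
  proof -
    have "cmod (M 0) = cmod (f 0) * (\<Prod>j<m. (real (2 * j + 1) * pi)\<^sup>2 / \<alpha> j)"
      unfolding M0 A B using \<alpha>(1) by (simp add: c_def prod_dividef a_def b_def less_imp_le)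
    then show ?thesis using \<kappa>(2)[of m] by (simp add: mult_left_mono)
  qed
  have cbig: "exp (\<bar>Im z\<bar> / 2) / 6 \<le> cmod (c z)" if "cmod z = R" for z
    using cos_large_on_circle[of "z / 2" m] m1 that by (simp add: c_def norm_divide R_def)
  have Mb: "cmod (M z) \<le> 6 * D" if "cmod z = R" "cmod (f z) \<le> D * exp (\<bar>Im z\<bar> / 2)" for z D
  proof -
    have cp: "0 < cmod (c z)" using cbig[OF that(1)] by (rule less_le_trans[rotated]) simp
    have "D \<ge> 0"
    proof -
      have "0 \<le> D * exp (\<bar>Im z\<bar> / 2)" using that(2) norm_ge_zero order_trans by blast
      then show ?thesis by (simp add: zero_le_mult_iff)
    qed
    then have "D * exp (\<bar>Im z\<bar> / 2) \<le> D * (6 * cmod (c z))" using cbig[OF that(1)] by (intro mult_left_mono) auto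
    then have "cmod (f z) \<le> 6 * D * cmod (c z)" using that(2) by simp
    then show ?thesis unfolding Mz[OF that(1)] using cp by (simp add: pos_divide_le_eq)
  qed
  define N where "N z = M z * M (\<i> * z)" for z
  have "cmod (N 0) \<le> 36 * C * e"
  proof (rule maximum_modulus_frontier[of N "ball 0 R"])
    have "(\<lambda>z. M (\<i> * z)) holomorphic_on ball 0 R"
    proof -
      have "(\<lambda>z. \<i> * z) holomorphic_on ball 0 R" by (intro holomorphic_intros)
      moreover have "(\<lambda>z. \<i> * z) ` ball 0 R \<subseteq> ball 0 R" by (auto simp: norm_mult)
      ultimately show ?thesis using holomorphic_on_compose_gen[OF _ M(1)] by (fastforce simp: o_def)
    qed
    then show "N holomorphic_on interior (ball 0 R)" unfolding N_def[abs_def] using M(1) by (auto intro: holomorphic_intros)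
    have "continuous_on (cball 0 R) (\<lambda>z. M (\<i> * z))"
      by (rule continuous_on_compose2[OF M(2)]) (auto intro!: continuous_intros simp: norm_mult)
    then show "continuous_on (closure (ball 0 R)) N" unfolding N_def[abs_def] using M(2) R by (auto intro: continuous_intros)
    fix z :: complex assume "z \<in> frontier (ball 0 R)"
    then have z: "cmod z = R" using R by (auto simp: frontier_def)
    then have iz: "cmod (\<i> * z) = R" by (simp add: norm_mult)
    have k1: "cmod z \<ge> 1" "cmod (\<i> * z) \<ge> 1" using z iz R by auto
    have "cmod z \<le> \<bar>Re z\<bar> + \<bar>Im z\<bar>" by (rule cmod_le)
    then have "\<bar>Im z\<bar> \<ge> t \<or> \<bar>Im (\<i> * z)\<bar> \<ge> t" using z R by auto
    then show "cmod (N z) \<le> 36 * C * e"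
    proof
      assume "\<bar>Im z\<bar> \<ge> t"
      then have "cmod (M z) * cmod (M (\<i> * z)) \<le> (6 * e) * (6 * C)"
        using Mb[OF z t[OF k1(1)]] Mb[OF iz C(2)[OF k1(2)]] e C(1) by (intro mult_mono) auto
      then show ?thesis by (simp add: N_def norm_mult mult_ac)
    next
      assume "\<bar>Im (\<i> * z)\<bar> \<ge> t"
      then have "cmod (M z) * cmod (M (\<i> * z)) \<le> (6 * C) * (6 * e)"
        using Mb[OF z C(2)[OF k1(1)]] Mb[OF iz t[OF k1(2)]] e C(1) by (intro mult_mono) auto
      then show ?thesis by (simp add: N_def norm_mult mult_ac)
    qed
  qed (use R in auto)
  moreover have "(cmod (f 0) * \<kappa>)\<^sup>2 \<le> cmod (N 0)"
    using \<open>cmod (f 0) * \<kappa> \<le> cmod (M 0)\<close> \<kappa>(1) by (simp add: N_def norm_mult power2_eq_square mult_mono)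
  moreover have "36 * C * e = (cmod (f 0) * \<kappa>)\<^sup>2 / 2" using C(1) by (simp add: e_def)
  moreover have "(cmod (f 0) * \<kappa>)\<^sup>2 > 0" using f0 \<kappa> by simp
  ultimately show False by linarith
qed

section \<open>The Wronskian of two problems with common eigenvalues\<close>

definition cross_wronskian :: "(real \<Rightarrow> real) \<Rightarrow> real \<Rightarrow> (real \<Rightarrow> real) \<Rightarrow> real \<Rightarrow> complex \<Rightarrow> real \<Rightarrow> complex" where
  "cross_wronskian q1 h1 q2 h2 z x = reg_sol q1 h1 z x * reg_der q2 h2 z x - reg_der q1 h1 z x * reg_sol q2 h2 z x"

lemma cross_wronskian_holomorphic:
  assumes "q1 absolutely_integrable_on {0..1}" "q2 absolutely_integrable_on {0..1}" "x \<in> {0..1}"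
  shows "(\<lambda>z. cross_wronskian q1 h1 q2 h2 z x) holomorphic_on A"
  unfolding cross_wronskian_def by (intro holomorphic_intros reg_holomorphic assms)

lemma cross_wronskian_eq:
  assumes q1: "q1 absolutely_integrable_on {0..1}" and q2: "q2 absolutely_integrable_on {0..1}" and x: "x \<in> {0..1}"
  shows "cross_wronskian q1 h1 q2 h2 z x = of_real (h1 - h2)
     + integral {0..x} (\<lambda>t. of_real (q2 t - q1 t) * (reg_sol q1 h1 z t * reg_sol q2 h2 z t))"
proof -
  have "cross_wronskian q1 h1 q2 h2 z x = cross_wronskian q1 h1 q2 h2 z 0
     + integral {0..x} (\<lambda>t. ((of_real (q2 t) - z) - (of_real (q1 t) - z)) * (reg_sol q1 h1 z t * reg_sol q2 h2 z t))"
    unfolding cross_wronskian_def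
    by (rule ac_derivD[OF wronskian_deriv[OF reg_solution(1)[OF q1] reg_solution(1)[OF q2]]]) (use x in auto)
  then show ?thesis by (simp add: cross_wronskian_def reg_solution[OF q1] reg_solution[OF q2])
qed

lemma cross_wronskian_eq_at_1:
  assumes q1: "q1 absolutely_integrable_on {0..1}" and q2: "q2 absolutely_integrable_on {0..1}"
    and a: "0 \<le> a" "a \<le> 1" and eq: "AE x in lebesgue_on {a..1}. q1 x = q2 x"
  shows "cross_wronskian q1 h1 q2 h2 z 1 = cross_wronskian q1 h1 q2 h2 z a"
proof -
  have d: "ac_deriv 1 (cross_wronskian q1 h1 q2 h2 z)
    (\<lambda>t. ((of_real (q2 t) - z) - (of_real (q1 t) - z)) * (reg_sol q1 h1 z t * reg_sol q2 h2 z t))"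
    unfolding cross_wronskian_def[abs_def] by (rule wronskian_deriv[OF reg_solution(1)[OF q1] reg_solution(1)[OF q2]])
  obtain N where N: "negligible N" "\<And>x. x \<in> {a..1} - N \<Longrightarrow> q1 x = q2 x"
    using AE_lebesgue_on_negligible[OF eq] by auto
  have "integral {a..1} (\<lambda>t. ((of_real (q2 t) - z) - (of_real (q1 t) - z)) * (reg_sol q1 h1 z t * reg_sol q2 h2 z t))
      = integral {a..1} (\<lambda>t::real. 0)"
    by (rule integral_spike[OF N(1)]) (use N(2) in auto)
  then show ?thesis using ac_deriv_diff[OF d a order_refl] by simp
qed

lemma cross_wronskian_zero_at_common_eigenvalue:
  assumes "char_fun q1 h1 H z = 0" "char_fun q2 h2 H z = 0"
  shows "cross_wronskian q1 h1 q2 h2 z 1 = 0"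
proof -
  have "reg_der q1 h1 z 1 = - of_real H * reg_sol q1 h1 z 1" "reg_der q2 h2 z 1 = - of_real H * reg_sol q2 h2 z 1"
    using assms by (simp_all add: char_fun_def eq_neg_iff_add_eq_0)
  then show ?thesis by (simp add: cross_wronskian_def)
qed

lemma reg_sol_growth:
  assumes q: "q absolutely_integrable_on {0..1}"
  obtains M where "M > 0" "\<And>k x. cmod k \<ge> 1 \<Longrightarrow> x \<in> {0..1} \<Longrightarrow> cmod (reg_sol q h (k\<^sup>2) x) \<le> M * exp (\<bar>Im k\<bar> * x)"
proof -
  define E where "E = exp (integral {0..1} (\<lambda>t. cmod (complex_of_real (q t))))"
  show ?thesis
  proof (rule that[of "(1 + \<bar>h\<bar>) * E"])
    show "(1 + \<bar>h\<bar>) * E > 0" by (simp add: E_def add_pos_nonneg)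
    fix k :: complex and x :: real assume k: "cmod k \<ge> 1" and x: "x \<in> {0..1}"
    have "cmod (reg_sol q h (k\<^sup>2) x) \<le> (1 + \<bar>h\<bar> / cmod k) * E * exp (\<bar>Im k\<bar> * x)"
      using solution_growth[OF abs_integrable_of_real[OF q] k reg_solution(1)[OF q, of "k\<^sup>2" h] x]
      by (simp add: reg_solution[OF q] E_def)
    also have "\<bar>h\<bar> / cmod k \<le> \<bar>h\<bar> / 1" using k by (intro divide_left_mono) auto
    then have "(1 + \<bar>h\<bar> / cmod k) * E * exp (\<bar>Im k\<bar> * x) \<le> (1 + \<bar>h\<bar>) * E * exp (\<bar>Im k\<bar> * x)"
      by (intro mult_right_mono) (auto simp: E_def)
    finally show "cmod (reg_sol q h (k\<^sup>2) x) \<le> (1 + \<bar>h\<bar>) * E * exp (\<bar>Im k\<bar> * x)" .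
  qed
qed

lemma reg_sol_near_cos:
  assumes q: "q absolutely_integrable_on {0..1}"
  obtains D where "D \<ge> 0" "\<And>k x. cmod k \<ge> 1 \<Longrightarrow> x \<in> {0..1} \<Longrightarrow>
    cmod (reg_sol q h (k\<^sup>2) x - cos (k * of_real x)) \<le> D / cmod k * exp (\<bar>Im k\<bar> * x)"
proof -
  define Q where "Q = integral {0..1} (\<lambda>t. cmod (complex_of_real (q t)))"
  have Q0: "Q \<ge> 0" unfolding Q_def using q
    by (intro hk_integral_nonneg) (auto simp: absolutely_integrable_on_def)
  define D where "D = \<bar>h\<bar> + Q * ((1 + \<bar>h\<bar>) * exp Q)"
  show ?thesis
  proof (rule that[of D])
    show "0 \<le> D" using Q0 by (simp add: D_def)
    fix k :: complex and x :: real assume k: "cmod k \<ge> 1" and x: "x \<in> {0..1}"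
    have "cmod (reg_sol q h (k\<^sup>2) x - cos (k * of_real x)) \<le> (\<bar>h\<bar> + Q * ((1 + \<bar>h\<bar> / cmod k) * exp Q)) / cmod k * exp (\<bar>Im k\<bar> * x)"
      using solution_near_cos[OF abs_integrable_of_real[OF q] k reg_solution(1)[OF q, of "k\<^sup>2" h] x]
      by (simp add: reg_solution[OF q] Q_def)
    also have "\<bar>h\<bar> / cmod k \<le> \<bar>h\<bar> / 1" using k by (intro divide_left_mono) auto
    then have "(\<bar>h\<bar> + Q * ((1 + \<bar>h\<bar> / cmod k) * exp Q)) / cmod k * exp (\<bar>Im k\<bar> * x) \<le> D / cmod k * exp (\<bar>Im k\<bar> * x)"
      unfolding D_def using Q0 k by (intro mult_right_mono divide_right_mono add_left_mono mult_left_mono) auto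
    finally show "cmod (reg_sol q h (k\<^sup>2) x - cos (k * of_real x)) \<le> D / cmod k * exp (\<bar>Im k\<bar> * x)" .
  qed
qed

text \<open>
  Dominated convergence: the weight tends to \<open>0\<close> except at the single point \<open>x = a\<close>.
\<close>

lemma exp_weighted_integral_small:
  fixes g :: "real \<Rightarrow> real"
  assumes g: "g absolutely_integrable_on {0..a}" "\<And>x. g x \<ge> 0" and a: "0 \<le> a" and e: "e > 0"
  shows "\<exists>t\<ge>0. \<forall>\<tau>\<ge>t. integral {0..a} (\<lambda>x. g x * exp (- 2 * \<tau> * (a - x))) \<le> e"
proof -
  have gi: "(\<lambda>x. g x * exp (- 2 * \<tau> * (a - x))) integrable_on {0..a}" for \<tau>
  proof -
    have "continuous_on {0..a} (\<lambda>x. exp (- 2 * \<tau> * (a - x)))" by (intro continuous_intros)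
    from abs_integrable_mult_continuous[OF g(1) this] show ?thesis by (simp add: absolutely_integrable_on_def)
  qed
  have "(\<lambda>n. integral {0..a} (\<lambda>x. g x * exp (- 2 * real n * (a - x)))) \<longlonglongrightarrow> integral {0..a} (\<lambda>x. if x = a then g x else 0)"
  proof (rule dominated_convergence(2)[where h=g])
    show "g integrable_on {0..a}" using g by (simp add: absolutely_integrable_on_def)
    show "norm (g x * exp (- 2 * real k * (a - x))) \<le> g x" if "x \<in> {0..a}" for k x
      using that g(2)[of x] by (simp add: mult_left_le abs_mult)
    show "(\<lambda>k. g x * exp (- 2 * real k * (a - x))) \<longlonglongrightarrow> (if x = a then g x else 0)" if "x \<in> {0..a}" for x
    proof (cases "x = a")
      case False
      then have "exp (- 2 * (a - x)) < 1" "0 \<le> exp (- 2 * (a - x))" using that by auto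
      then have "(\<lambda>k. g x * exp (- 2 * (a - x)) ^ k) \<longlonglongrightarrow> g x * 0" by (intro tendsto_intros LIMSEQ_power_zero) auto
      moreover have "exp (- 2 * (a - x)) ^ k = exp (- 2 * real k * (a - x))" for k
        by (simp add: exp_of_nat_mult[symmetric] algebra_simps)
      ultimately show ?thesis using False by simp
    qed simp
  qed (rule gi)
  moreover have "integral {0..a} (\<lambda>x. if x = a then g x else 0) = integral {0..a} (\<lambda>x. 0)"
    by (rule integral_spike[of "{a}"]) auto
  ultimately have "(\<lambda>n. integral {0..a} (\<lambda>x. g x * exp (- 2 * real n * (a - x)))) \<longlonglongrightarrow> 0" by simp
  then have "eventually (\<lambda>n. integral {0..a} (\<lambda>x. g x * exp (- 2 * real n * (a - x))) < e) sequentially"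
    using e by (rule order_tendstoD)
  then obtain n where n: "integral {0..a} (\<lambda>x. g x * exp (- 2 * real n * (a - x))) < e"
    by (auto simp: eventually_sequentially)
  show ?thesis
  proof (intro exI[of _ "real n"] conjI allI impI)
    fix \<tau> assume "\<tau> \<ge> real n"
    then have "integral {0..a} (\<lambda>x. g x * exp (- 2 * \<tau> * (a - x))) \<le> integral {0..a} (\<lambda>x. g x * exp (- 2 * real n * (a - x)))"
      using g(2) by (intro integral_le gi) (auto intro!: mult_left_mono mult_right_mono)
    then show "integral {0..a} (\<lambda>x. g x * exp (- 2 * \<tau> * (a - x))) \<le> e" using n by simp
  qed simp
qed

text \<open>
  The refined bound rests on \<open>\<bar>\<phi>\<^sub>1 \<phi>\<^sub>2\<bar> \<le> M exp (2 \<bar>Im k\<bar> x)\<close>, whose mass against \<open>q\<^sub>2 - q\<^sub>1\<close> concentrates at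
  \<open>x = a\<close> as \<open>\<bar>Im k\<bar>\<close> grows; the constant \<open>h\<^sub>1 - h\<^sub>2\<close> is dominated by any growing exponential.
\<close>

lemma cross_wronskian_growth:
  assumes q1: "q1 absolutely_integrable_on {0..1}" and q2: "q2 absolutely_integrable_on {0..1}"
    and a: "0 < a" "a \<le> 1"
  obtains C where "C > 0" "\<And>k. cmod k \<ge> 1 \<Longrightarrow> cmod (cross_wronskian q1 h1 q2 h2 (k\<^sup>2) a) \<le> C * exp (\<bar>Im k\<bar> * (2 * a))"
    "\<And>e. e > 0 \<Longrightarrow> \<exists>t. \<forall>k. cmod k \<ge> 1 \<longrightarrow> \<bar>Im k\<bar> \<ge> t \<longrightarrow> cmod (cross_wronskian q1 h1 q2 h2 (k\<^sup>2) a) \<le> e * exp (\<bar>Im k\<bar> * (2 * a))"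
proof -
  obtain M1 where M1: "M1 > 0" "\<And>k x. cmod k \<ge> 1 \<Longrightarrow> x \<in> {0..1} \<Longrightarrow> cmod (reg_sol q1 h1 (k\<^sup>2) x) \<le> M1 * exp (\<bar>Im k\<bar> * x)"
    using reg_sol_growth[OF q1, of h1] by blast
  obtain M2 where M2: "M2 > 0" "\<And>k x. cmod k \<ge> 1 \<Longrightarrow> x \<in> {0..1} \<Longrightarrow> cmod (reg_sol q2 h2 (k\<^sup>2) x) \<le> M2 * exp (\<bar>Im k\<bar> * x)"
    using reg_sol_growth[OF q2, of h2] by blast
  define g where "g x = \<bar>q2 x - q1 x\<bar>" for x
  have d1: "(\<lambda>x. q2 x - q1 x) absolutely_integrable_on {0..1}" using q1 q2 by (rule set_integral_diff(1)[rotated])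
  then have "g absolutely_integrable_on {0..1}"
    unfolding g_def using absolutely_integrable_norm[OF d1] by (simp add: o_def)
  then have g: "g absolutely_integrable_on {0..a}" by (rule absolutely_integrable_on_subinterval) (use a in auto)
  define \<eta> where "\<eta> \<tau> = integral {0..a} (\<lambda>x. g x * exp (- 2 * \<tau> * (a - x)))" for \<tau>
  have gi: "(\<lambda>x. g x * exp (- 2 * \<tau> * (a - x))) integrable_on {0..a}" for \<tau>
  proof -
    have "continuous_on {0..a} (\<lambda>x. exp (- 2 * \<tau> * (a - x)))" by (intro continuous_intros)
    from abs_integrable_mult_continuous[OF g this] show ?thesis by (simp add: absolutely_integrable_on_def)
  qed
  have bound: "cmod (cross_wronskian q1 h1 q2 h2 (k\<^sup>2) a) \<le> \<bar>h1 - h2\<bar> + M1 * M2 * \<eta> \<bar>Im k\<bar> * exp (\<bar>Im k\<bar> * (2 * a))"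
    if k: "cmod k \<ge> 1" for k
  proof -
    define \<tau> where "\<tau> = \<bar>Im k\<bar>"
    have "cmod (integral {0..a} (\<lambda>t. of_real (q2 t - q1 t) * (reg_sol q1 h1 (k\<^sup>2) t * reg_sol q2 h2 (k\<^sup>2) t)))
       \<le> integral {0..a} (\<lambda>x. (M1 * M2 * exp (\<tau> * (2 * a))) * (g x * exp (- 2 * \<tau> * (a - x))))"
    proof (rule hk_integral_norm_bound_integral)
      have "continuous_on {0..1} (\<lambda>t. reg_sol q1 h1 (k\<^sup>2) t * reg_sol q2 h2 (k\<^sup>2) t)"
        by (intro continuous_intros sl_solution_continuous(1)[OF reg_solution(1)] q1 q2)
      from abs_integrable_mult_continuous[OF abs_integrable_of_real[OF d1] this]
      show "(\<lambda>t. of_real (q2 t - q1 t) * (reg_sol q1 h1 (k\<^sup>2) t * reg_sol q2 h2 (k\<^sup>2) t)) integrable_on {0..a}"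
        by (rule abs_integrable_sub(2)) (use a in auto)
      show "(\<lambda>x. (M1 * M2 * exp (\<tau> * (2 * a))) * (g x * exp (- 2 * \<tau> * (a - x)))) integrable_on {0..a}"
        by (rule integrable_on_mult_right[OF gi])
      fix x assume "x \<in> {0..a}"
      then have x: "x \<in> {0..1}" using a by auto
      have "cmod (of_real (q2 x - q1 x) * (reg_sol q1 h1 (k\<^sup>2) x * reg_sol q2 h2 (k\<^sup>2) x))
        = g x * (cmod (reg_sol q1 h1 (k\<^sup>2) x) * cmod (reg_sol q2 h2 (k\<^sup>2) x))"
        by (simp only: norm_mult norm_of_real g_def)
      also have "\<dots> \<le> g x * ((M1 * exp (\<tau> * x)) * (M2 * exp (\<tau> * x)))"
        using M1(2)[OF k x] M2(2)[OF k x] M1(1) M2(1) unfolding \<tau>_def by (intro mult_left_mono mult_mono) (auto simp: g_def)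
      also have "\<dots> = (M1 * M2 * exp (\<tau> * (2 * a))) * (g x * exp (- 2 * \<tau> * (a - x)))"
      proof -
        have "exp (\<tau> * x) * exp (\<tau> * x) = exp (\<tau> * (2 * a)) * exp (- 2 * \<tau> * (a - x))"
          by (simp add: algebra_simps flip: exp_add)
        then show ?thesis by (simp only: mult_ac)
      qed
      finally show "cmod (of_real (q2 x - q1 x) * (reg_sol q1 h1 (k\<^sup>2) x * reg_sol q2 h2 (k\<^sup>2) x))
         \<le> (M1 * M2 * exp (\<tau> * (2 * a))) * (g x * exp (- 2 * \<tau> * (a - x)))" .
    qed
    also have "\<dots> = M1 * M2 * \<eta> \<tau> * exp (\<tau> * (2 * a))" by (simp add: \<eta>_def)
    finally have i: "cmod (integral {0..a} (\<lambda>t. of_real (q2 t - q1 t) * (reg_sol q1 h1 (k\<^sup>2) t * reg_sol q2 h2 (k\<^sup>2) t)))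
       \<le> M1 * M2 * \<eta> \<tau> * exp (\<tau> * (2 * a))" .
    have "cross_wronskian q1 h1 q2 h2 (k\<^sup>2) a = of_real (h1 - h2)
      + integral {0..a} (\<lambda>t. of_real (q2 t - q1 t) * (reg_sol q1 h1 (k\<^sup>2) t * reg_sol q2 h2 (k\<^sup>2) t))"
      by (rule cross_wronskian_eq[OF q1 q2]) (use a in auto)
    then have "cmod (cross_wronskian q1 h1 q2 h2 (k\<^sup>2) a) \<le> cmod (complex_of_real (h1 - h2))
      + cmod (integral {0..a} (\<lambda>t. of_real (q2 t - q1 t) * (reg_sol q1 h1 (k\<^sup>2) t * reg_sol q2 h2 (k\<^sup>2) t)))"
      by (simp only: norm_triangle_ineq)
    then show ?thesis using i by (simp only: norm_of_real \<tau>_def)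
  qed
  have g0: "g x \<ge> 0" for x by (simp add: g_def)
  define G where "G = integral {0..a} g"
  have \<eta>G: "\<eta> \<tau> \<le> G" if "\<tau> \<ge> 0" for \<tau>
    unfolding \<eta>_def G_def using that g0 gi g
    by (intro integral_le) (auto simp: absolutely_integrable_on_def mult_left_le)
  have e1: "1 \<le> exp (\<bar>Im k\<bar> * (2 * a))" for k using a by simp
  show ?thesis
  proof (rule that[of "\<bar>h1 - h2\<bar> + M1 * M2 * G + 1"])
    have "G \<ge> 0" unfolding G_def using g g0 by (intro hk_integral_nonneg) (auto simp: absolutely_integrable_on_def)
    then show "\<bar>h1 - h2\<bar> + M1 * M2 * G + 1 > 0" using M1 M2 by (simp add: add_nonneg_pos)
    fix k :: complex assume k: "cmod k \<ge> 1"
    have "\<bar>h1 - h2\<bar> * 1 \<le> \<bar>h1 - h2\<bar> * exp (\<bar>Im k\<bar> * (2 * a))" using e1 by (intro mult_left_mono) auto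
    moreover have "M1 * M2 * \<eta> \<bar>Im k\<bar> * exp (\<bar>Im k\<bar> * (2 * a)) \<le> M1 * M2 * G * exp (\<bar>Im k\<bar> * (2 * a))"
      using \<eta>G[of "\<bar>Im k\<bar>"] M1 M2 by (intro mult_right_mono mult_left_mono) auto
    moreover have "exp (\<bar>Im k\<bar> * (2 * a)) \<ge> 0" by simp
    ultimately show "cmod (cross_wronskian q1 h1 q2 h2 (k\<^sup>2) a) \<le> (\<bar>h1 - h2\<bar> + M1 * M2 * G + 1) * exp (\<bar>Im k\<bar> * (2 * a))"
      using bound[OF k] unfolding distrib_right by linarith
  next
    fix e :: real assume e: "e > 0"
    obtain t where t: "t \<ge> 0" "\<And>\<tau>. \<tau> \<ge> t \<Longrightarrow> \<eta> \<tau> \<le> e / (2 * (M1 * M2))"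
      using exp_weighted_integral_small[OF g g0, of "e / (2 * (M1 * M2))"] a e M1 M2 unfolding \<eta>_def by auto
    define s where "s = max t (\<bar>h1 - h2\<bar> / (e * a))"
    show "\<exists>t. \<forall>k. cmod k \<ge> 1 \<longrightarrow> \<bar>Im k\<bar> \<ge> t \<longrightarrow> cmod (cross_wronskian q1 h1 q2 h2 (k\<^sup>2) a) \<le> e * exp (\<bar>Im k\<bar> * (2 * a))"
    proof (intro exI[of _ s] allI impI)
      fix k :: complex assume k: "cmod k \<ge> 1" "\<bar>Im k\<bar> \<ge> s"
      define X where "X = exp (\<bar>Im k\<bar> * (2 * a))"
      have "\<bar>h1 - h2\<bar> / (e * a) \<le> \<bar>Im k\<bar>" using k by (simp add: s_def)
      then have "\<bar>h1 - h2\<bar> \<le> \<bar>Im k\<bar> * (e * a)" using e a by (simp add: pos_divide_le_eq)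
      also have "\<dots> = e / 2 * (\<bar>Im k\<bar> * (2 * a))" by simp
      also have "\<dots> \<le> e / 2 * X" unfolding X_def using exp_ge_add_one_self[of "\<bar>Im k\<bar> * (2 * a)"] e by (intro mult_left_mono) linarith+
      finally have 1: "\<bar>h1 - h2\<bar> \<le> e / 2 * X" .
      have "M1 * M2 * \<eta> \<bar>Im k\<bar> \<le> M1 * M2 * (e / (2 * (M1 * M2)))"
        using t(2)[of "\<bar>Im k\<bar>"] k M1 M2 by (intro mult_left_mono) (auto simp: s_def)
      also have "\<dots> = e / 2" using M1 M2 by simp
      finally have "M1 * M2 * \<eta> \<bar>Im k\<bar> * X \<le> e / 2 * X" by (intro mult_right_mono) (auto simp: X_def)
      then show "cmod (cross_wronskian q1 h1 q2 h2 (k\<^sup>2) a) \<le> e * exp (\<bar>Im k\<bar> * (2 * a))"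
        using bound[OF k(1)] 1 unfolding X_def[symmetric] by linarith
    qed
  qed
qed

lemma cross_wronskian_shift:
  "cross_wronskian (\<lambda>x. q1 x + c) h1 (\<lambda>x. q2 x + c) h2 (z + of_real c) x = cross_wronskian q1 h1 q2 h2 z x"
  by (simp add: cross_wronskian_def reg_shift)

text \<open>
  A shift of the spectral parameter by a constant \<open>c\<close> makes the common eigenvalues positive and moves a
  point where the Wronskian does not vanish to the origin; then \<open>half_type_with_odd_pi_zeros\<close>
  applies to \<open>k \<mapsto> W(k\<^sup>2 - c)\<close>. The enumerations \<open>n j = 2 j\<close> and \<open>n j = 2 j + 1\<close> both satisfy
  \<open>n j \<le> 2 j + 1\<close>, which gives the required density of the zeros.
\<close>

lemma cross_wronskian_vanishes:
  assumes q1: "q1 absolutely_integrable_on {0..1}" and q2: "q2 absolutely_integrable_on {0..1}"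
    and eq: "AE x in lebesgue_on {1/4..1}. q1 x = q2 x"
    and n: "strict_mono n" "\<And>j. n j \<le> 2 * j + 1"
    and lam: "\<And>j. schroedinger_lambda q1 h1 H (n j) = schroedinger_lambda q2 h2 H (n j)"
  shows "cross_wronskian q1 h1 q2 h2 z (1/4) = 0"
proof (rule ccontr)
  define W where "W z = cross_wronskian q1 h1 q2 h2 z (1/4)" for z
  assume "cross_wronskian q1 h1 q2 h2 z (1/4) \<noteq> 0"
  then have Wz: "W z \<noteq> 0" by (simp add: W_def)
  define l where "l = schroedinger_lambda q1 h1 H"
  note props1 = schroedinger_lambda_properties[OF q1, of h1 H, folded l_def]
  note props2 = schroedinger_lambda_properties[OF q2, of h2 H]
  obtain K where K: "\<And>n. l n \<le> (real n * pi)\<^sup>2 + K" using props1(3) by blast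
  have Wl: "W (of_real (l (n j))) = 0" for j
  proof -
    have "cross_wronskian q1 h1 q2 h2 (of_real (l (n j))) 1 = 0"
      using props1(2)[of "n j"] props2(2)[of "n j"] lam[of j]
      by (intro cross_wronskian_zero_at_common_eigenvalue) (auto simp: l_def)
    then show ?thesis using cross_wronskian_eq_at_1[OF q1 q2 _ _ eq] by (simp add: W_def)
  qed
  have Wh: "W holomorphic_on UNIV" unfolding W_def[abs_def] by (rule cross_wronskian_holomorphic[OF q1 q2]) auto
  have "\<not> W constant_on UNIV" using Wz Wl[of 0] by (metis UNIV_I constant_on_def)
  then have cnt: "countable {z. W z = 0}"
    using holomorphic_countable_zeros[OF Wh] connected_UNIV by simp
  obtain B where B: "\<And>z. char_fun q1 h1 H z = 0 \<Longrightarrow> Re z > - B"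
    using char_fun_zero_bounded_below[OF q1, of h1 H] by blast
  \<comment> \<open>the zeros of the entire function \<open>W\<close> are countable, so they cannot fill a half line\<close>
  obtain c where c: "c > B" "W (- of_real c) \<noteq> 0"
  proof (rule ccontr)
    assume "\<not> thesis"
    then have "(\<lambda>c. - complex_of_real c) ` {B<..} \<subseteq> {z. W z = 0}" using that by blast
    then have "countable ((\<lambda>c. - complex_of_real c) ` {B<..})" using cnt by (rule countable_subset)
    then have "countable {B<..}" by (rule countable_image_inj_on) (auto simp: inj_on_def)
    then have "countable {B<..<B+1}" by (rule countable_subset[rotated]) auto
    then show False using uncountable_open_interval[of B "B + 1"] by simp
  qed
  define p1 where "p1 x = q1 x + c" for x
  define p2 where "p2 x = q2 x + c" for x
  have p1: "p1 absolutely_integrable_on {0..1}" unfolding p1_def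
    by (rule set_integral_add(1)[OF q1 absolutely_integrable_continuous_real]) auto
  have p2: "p2 absolutely_integrable_on {0..1}" unfolding p2_def
    by (rule set_integral_add(1)[OF q2 absolutely_integrable_continuous_real]) auto
  have sh: "cross_wronskian p1 h1 p2 h2 w (1/4) = W (w - of_real c)" for w
    using cross_wronskian_shift[of q1 c h1 q2 h2 "w - of_real c" "1/4"]
    by (simp add: p1_def[abs_def] p2_def[abs_def] W_def)
  define f where "f k = cross_wronskian p1 h1 p2 h2 (k\<^sup>2) (1/4)" for k
  have ff: "f k = W (k\<^sup>2 - of_real c)" for k by (simp add: f_def sh)
  obtain C where C: "C > 0" "\<And>k. cmod k \<ge> 1 \<Longrightarrow> cmod (f k) \<le> C * exp (\<bar>Im k\<bar> * (2 * (1/4)))"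
    "\<And>e. e > 0 \<Longrightarrow> \<exists>t. \<forall>k. cmod k \<ge> 1 \<longrightarrow> \<bar>Im k\<bar> \<ge> t \<longrightarrow> cmod (f k) \<le> e * exp (\<bar>Im k\<bar> * (2 * (1/4)))"
    using cross_wronskian_growth[OF p1 p2, of "1/4" h1 h2] unfolding f_def by auto
  define \<alpha> where "\<alpha> j = l (n j) + c" for j
  have \<alpha>pos: "0 < \<alpha> j" for j using B[OF props1(2), of "n j"] c by (simp add: \<alpha>_def)
  have f\<alpha>: "f s = 0" if "s\<^sup>2 = of_real (\<alpha> j)" for s j
    unfolding ff that by (simp add: \<alpha>_def Wl)
  have "f 0 = 0"
  proof (rule half_type_with_odd_pi_zeros[of f C "\<bar>K + c\<bar>" \<alpha>])
    have "(\<lambda>k. W (k\<^sup>2 - of_real c)) holomorphic_on UNIV"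
    proof -
      have "(\<lambda>k. k\<^sup>2 - complex_of_real c) holomorphic_on UNIV" by (intro holomorphic_intros)
      from holomorphic_on_compose_gen[OF this Wh] show ?thesis by (simp add: o_def)
    qed
    then show "f holomorphic_on UNIV" by (simp add: ff[abs_def])
    show "\<alpha> j \<le> (real (2 * j + 1) * pi)\<^sup>2 + \<bar>K + c\<bar>" for j
    proof -
      have "l (n j) \<le> l (2 * j + 1)" using n(2)[of j] props1(1) by (simp add: strict_mono_less_eq)
      then show ?thesis using K[of "2 * j + 1"] by (simp add: \<alpha>_def)
    qed
    show "inj \<alpha>"
      using strict_mono_eq[OF props1(1)] strict_mono_eq[OF n(1)] by (simp add: \<alpha>_def inj_def)
    show "f (of_real (sqrt (\<alpha> j))) = 0" "f (- of_real (sqrt (\<alpha> j))) = 0" for j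
      by (rule f\<alpha>[of _ j]; use \<alpha>pos[of j] in \<open>simp flip: of_real_power\<close>)+
  qed (use C \<alpha>pos in auto)
  then show False using c by (simp add: ff)
qed

section \<open>The Weyl function determines the potential\<close>

lemma ac_deriv_vanishes:
  assumes "ac_deriv b f g" "continuous_on {0..b} g" "\<And>x. x \<in> {0..b} \<Longrightarrow> f x = 0" and b: "0 < b" and x: "x \<in> {0..b}"
  shows "g x = 0"
proof -
  have d: "((\<lambda>u. integral {0..u} g) has_vector_derivative g x) (at x within {0..b})"
    by (rule integral_has_vector_derivative[OF assms(2) x])
  have z: "0 = integral {0..u} g" if "u \<in> {0..b}" for u
    using ac_derivD[OF assms(1), of u] assms(3)[of u] assms(3)[of 0] that b by simp
  have "((\<lambda>u. 0) has_vector_derivative g x) (at x within {0..b})"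
    by (rule has_vector_derivative_transform[OF x z d])
  moreover have "((\<lambda>u. 0) has_vector_derivative 0) (at x within {0..b})" by simp
  moreover have "at x within {0..b} \<noteq> bot" using b x by (auto simp: trivial_limit_within islimpt_Icc)
  ultimately show ?thesis by (metis vector_derivative_unique_within)
qed

text \<open>
  Lebesgue's differentiation theorem, applied to the difference of the two derivatives.
\<close>

lemma ac_deriv_unique_AE:
  assumes f1: "ac_deriv b f g1" and f2: "ac_deriv b f g2" and b: "0 \<le> b"
  obtains N where "negligible N" "\<And>x. x \<in> {0..b} - N \<Longrightarrow> g1 x = g2 x"
proof -
  define d where "d x = (if x \<in> {0..b} then g1 x - g2 x else 0)" for x
  have i: "g1 integrable_on {0..b}" "g2 integrable_on {0..b}"
    using ac_deriv_integrable[OF f1] ac_deriv_integrable[OF f2] by (auto simp: absolutely_integrable_on_def)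
  then have "(\<lambda>x. g1 x - g2 x) integrable_on {0..b}" by (rule integrable_diff)
  then have dU: "d integrable_on UNIV" unfolding d_def by (simp only: integrable_restrict_UNIV)
  then have di: "d integrable_on cbox u v" for u v by (rule integrable_on_subcbox) auto
  obtain N where N: "negligible N" "\<And>x e. \<lbrakk>x \<notin> N; 0 < e\<rbrakk> \<Longrightarrow>
       \<exists>r>0. \<forall>h. 0 < h \<and> h < r \<longrightarrow> norm (integral (cbox x (x + h *\<^sub>R One)) d /\<^sub>R h ^ DIM(real) - d x) < e"
    using integrable_ccontinuous_explicit[OF di] by metis
  show ?thesis
  proof (rule that[of "N \<union> {b}"])
    show "negligible (N \<union> {b})" using N(1) by (simp add: negligible_Un)
    fix x assume x: "x \<in> {0..b} - (N \<union> {b})"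
    have "cmod (d x) < e" if e: "e > 0" for e
    proof -
      obtain r where r: "r > 0" "\<And>h. 0 < h \<Longrightarrow> h < r \<Longrightarrow> norm (integral (cbox x (x + h *\<^sub>R One)) d /\<^sub>R h ^ DIM(real) - d x) < e"
        using N(2)[of x e] x e by auto
      define h where "h = min (r / 2) (b - x)"
      have h: "0 < h" "h < r" "x + h \<le> b" using r x by (auto simp: h_def)
      have "integral {x..x+h} d = integral {x..x+h} (\<lambda>x. g1 x - g2 x)"
        using x h by (intro hk_integral_cong) (auto simp: d_def)
      also have "\<dots> = integral {x..x+h} g1 - integral {x..x+h} g2"
        using x h abs_integrable_sub(2)[OF ac_deriv_integrable[OF f1], of x "x + h"] abs_integrable_sub(2)[OF ac_deriv_integrable[OF f2], of x "x + h"]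
        by (intro hk_integral_diff) auto
      also have "\<dots> = 0"
        using ac_deriv_diff[OF f1, of x "x + h"] ac_deriv_diff[OF f2, of x "x + h"] x h by simp
      finally show ?thesis using r(2)[OF h(1,2)] by simp
    qed
    then have "d x = 0" by (metis less_irrefl zero_less_norm_iff)
    then show "g1 x = g2 x" using x by (simp add: d_def)
  qed
qed

lemma abs_integrable_reflected_potential:
  fixes q :: "real \<Rightarrow> real"
  assumes q: "q absolutely_integrable_on {0..1}" and a: "0 < a" "a \<le> 1"
  shows "(\<lambda>t. complex_of_real (q (a - t))) absolutely_integrable_on {0..a}"
proof -
  have qq: "(\<lambda>t. complex_of_real (q t)) absolutely_integrable_on {0..a}"
    by (rule absolutely_integrable_on_subinterval[OF abs_integrable_of_real[OF q]]) (use a in auto)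
  have "ac_deriv a (\<lambda>x. integral {0..x} (\<lambda>t. complex_of_real (q t))) (\<lambda>t. complex_of_real (q t))"
    by (rule ac_derivI[OF qq]) simp
  from ac_deriv_integrable[OF ac_deriv_reflect[OF this]] a show ?thesis
    using absolutely_integrable_linear[OF _ bounded_linear_minus[OF bounded_linear_ident]] by (fastforce simp: o_def)
qed

text \<open>
  Both sides solve the reflected equation with the same data at \<open>t = 0\<close>.
\<close>

lemma reg_sol_from_right_end:
  fixes q :: "real \<Rightarrow> real"
  assumes q: "q absolutely_integrable_on {0..1}" and a: "0 < a" "a \<le> 1" and t: "t \<in> {0..a}"
  shows "reg_sol q h z (a - t) = reg_sol q h z a * ivp_val a (\<lambda>t. complex_of_real (q (a - t)) - z) 1 0 t
        - reg_der q h z a * ivp_val a (\<lambda>t. complex_of_real (q (a - t)) - z) 0 1 t"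
proof -
  note qz = abs_integrable_minus_const[OF abs_integrable_reflected_potential[OF q a], of z]
  note ii = ivp_solution[OF qz less_imp_le[OF a(1)] a(2)]
  have 1: "sl_solution a (\<lambda>t. complex_of_real (q (a - t)) - z) (\<lambda>t. reg_sol q h z (a - t)) (\<lambda>t. - reg_der q h z (a - t))"
    using sl_solution_reflect[OF sl_solution_restrict[OF reg_solution(1)[OF q] a(2)]] a by simp
  have 2: "sl_solution a (\<lambda>t. complex_of_real (q (a - t)) - z)
     (\<lambda>t. reg_sol q h z a * ivp_val a (\<lambda>t. complex_of_real (q (a - t)) - z) 1 0 t + (- reg_der q h z a) * ivp_val a (\<lambda>t. complex_of_real (q (a - t)) - z) 0 1 t)
     (\<lambda>t. reg_sol q h z a * ivp_der a (\<lambda>t. complex_of_real (q (a - t)) - z) 1 0 t + (- reg_der q h z a) * ivp_der a (\<lambda>t. complex_of_real (q (a - t)) - z) 0 1 t)"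
    by (rule sl_solution_linear[OF ii(1) ii(1)])
  from sl_solution_unique(1)[OF 1 2 qz a(2) _ _ t] show ?thesis by (simp add: ii)
qed

text \<open>
  Write \<open>\<phi>\<^sub>i(a - t) = \<phi>\<^sub>i(a) C\<^sub>i(t) - \<phi>\<^sub>i'(a) S\<^sub>i(t)\<close>. As the ratios \<open>\<phi>\<^sub>i'(a) / \<phi>\<^sub>i(a)\<close> agree,
  \<open>F = C\<^sub>1 S\<^sub>2 - C\<^sub>2 S\<^sub>1\<close> does not change when each \<open>C\<^sub>i(t)\<close> is replaced by \<open>\<phi>\<^sub>i(a - t) / \<phi>\<^sub>i(a)\<close>, of size
  \<open>exp (- \<bar>Im k\<bar> t)\<close> on circles where \<open>\<phi>\<^sub>i(a)\<close> is comparable to \<open>cos (k a)\<close>. Since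
  \<open>S\<^sub>i(t)\<close> is of size \<open>exp (\<bar>Im k\<bar> t) / \<bar>k\<bar>\<close>, the entire function \<open>F\<close> is \<open>O(1/\<bar>k\<bar>)\<close> on these circles.
\<close>

lemma backward_solutions_agree:
  fixes q1 q2 :: "real \<Rightarrow> real" and h1 h2 a :: real
  assumes q1: "q1 absolutely_integrable_on {0..1}" and q2: "q2 absolutely_integrable_on {0..1}"
    and a: "0 < a" "a \<le> 1" and W: "\<And>z. cross_wronskian q1 h1 q2 h2 z a = 0"
    and t: "t \<in> {0..a}"
  defines "r1 \<equiv> \<lambda>t. complex_of_real (q1 (a - t))" and "r2 \<equiv> \<lambda>t. complex_of_real (q2 (a - t))"
  shows "ivp_val a (\<lambda>t. r1 t - z) 1 0 t * ivp_val a (\<lambda>t. r2 t - z) 0 1 t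
       = ivp_val a (\<lambda>t. r2 t - z) 1 0 t * ivp_val a (\<lambda>t. r1 t - z) 0 1 t"
proof -
  have r1: "r1 absolutely_integrable_on {0..a}" and r2: "r2 absolutely_integrable_on {0..a}"
    unfolding r1_def r2_def using abs_integrable_reflected_potential q1 q2 a by auto
  define C1 where "C1 z = ivp_val a (\<lambda>t. r1 t - z) 1 0" for z
  define S1 where "S1 z = ivp_val a (\<lambda>t. r1 t - z) 0 1" for z
  define C2 where "C2 z = ivp_val a (\<lambda>t. r2 t - z) 1 0" for z
  define S2 where "S2 z = ivp_val a (\<lambda>t. r2 t - z) 0 1" for z
  define F where "F z = C1 z t * S2 z t - C2 z t * S1 z t" for z
  have Fh: "F holomorphic_on A" for A
    unfolding F_def[abs_def] C1_def S1_def C2_def S2_def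
    using a t by (intro holomorphic_intros ivp_holomorphic r1 r2) auto
  obtain M1 where M1: "M1 > 0" "\<And>k x. cmod k \<ge> 1 \<Longrightarrow> x \<in> {0..1} \<Longrightarrow> cmod (reg_sol q1 h1 (k\<^sup>2) x) \<le> M1 * exp (\<bar>Im k\<bar> * x)"
    using reg_sol_growth[OF q1, of h1] by blast
  obtain M2 where M2: "M2 > 0" "\<And>k x. cmod k \<ge> 1 \<Longrightarrow> x \<in> {0..1} \<Longrightarrow> cmod (reg_sol q2 h2 (k\<^sup>2) x) \<le> M2 * exp (\<bar>Im k\<bar> * x)"
    using reg_sol_growth[OF q2, of h2] by blast
  obtain D1 where D1: "D1 \<ge> 0" "\<And>k x. cmod k \<ge> 1 \<Longrightarrow> x \<in> {0..1} \<Longrightarrow>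
    cmod (reg_sol q1 h1 (k\<^sup>2) x - cos (k * of_real x)) \<le> D1 / cmod k * exp (\<bar>Im k\<bar> * x)"
    using reg_sol_near_cos[OF q1, of h1] by blast
  obtain D2 where D2: "D2 \<ge> 0" "\<And>k x. cmod k \<ge> 1 \<Longrightarrow> x \<in> {0..1} \<Longrightarrow>
    cmod (reg_sol q2 h2 (k\<^sup>2) x - cos (k * of_real x)) \<le> D2 / cmod k * exp (\<bar>Im k\<bar> * x)"
    using reg_sol_near_cos[OF q2, of h2] by blast
  have aa: "a \<in> {0..1}" using a by simp
  have Sb: "\<exists>B>0. \<forall>k. cmod k \<ge> 1 \<longrightarrow> cmod (ivp_val a (\<lambda>t. r t - k\<^sup>2) 0 1 t) \<le> B / cmod k * exp (\<bar>Im k\<bar> * t)"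
    if r: "r absolutely_integrable_on {0..a}" for r :: "real \<Rightarrow> complex"
  proof (intro exI[of _ "exp (integral {0..a} (\<lambda>t. cmod (r t)))"] conjI allI impI)
    fix k :: complex assume k: "cmod k \<ge> 1"
    note ii = ivp_solution[OF abs_integrable_minus_const[OF r, of "k\<^sup>2"] less_imp_le[OF a(1)] a(2), of 0 1]
    show "cmod (ivp_val a (\<lambda>t. r t - k\<^sup>2) 0 1 t) \<le> exp (integral {0..a} (\<lambda>t. cmod (r t))) / cmod k * exp (\<bar>Im k\<bar> * t)"
      using solution_growth[OF r k ii(1) t] by (simp add: ii(2,3))
  qed simp
  obtain B1 B2 where B: "B1 > 0" "B2 > 0"
     "\<And>k. cmod k \<ge> 1 \<Longrightarrow> cmod (S1 (k\<^sup>2) t) \<le> B1 / cmod k * exp (\<bar>Im k\<bar> * t)"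
     "\<And>k. cmod k \<ge> 1 \<Longrightarrow> cmod (S2 (k\<^sup>2) t) \<le> B2 / cmod k * exp (\<bar>Im k\<bar> * t)"
    using Sb[OF r1] Sb[OF r2] unfolding S1_def S2_def by blast
  define D where "D = max D1 D2"
  define L where "L = 12 * (M1 * B2 + M2 * B1)"
  have circ: "cmod (F (k\<^sup>2)) \<le> L / cmod k"
    if k: "cmod k = real m * pi / a" "cmod k \<ge> 1" "cmod k \<ge> 12 * D" and m: "m \<ge> 1" for k and m :: nat
  proof -
    define E where "E = exp (\<bar>Im k\<bar> * a)"
    have ck: "E / 6 \<le> cmod (cos (k * of_real a))"
      using cos_large_on_circle[of "k * of_real a" m] m k(1) a by (simp add: norm_mult E_def abs_mult)
    have Dk: "D' / cmod k * E \<le> E / 12" if "D' \<le> D" for D'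
    proof -
      have "D' \<le> 1 / 12 * cmod k" using that k(3) by linarith
      then have "D' / cmod k \<le> 1 / 12" using k(2) by (subst pos_divide_le_eq) auto
      then have "D' / cmod k * E \<le> 1 / 12 * E" by (intro mult_right_mono) (auto simp: E_def)
      then show ?thesis by simp
    qed
    have low: "E / 12 \<le> cmod \<phi>" if "cmod (\<phi> - cos (k * of_real a)) \<le> E / 12" for \<phi>
      using norm_triangle_ineq3[of "\<phi>" "cos (k * of_real a)"] that ck by linarith
    have l1: "E / 12 \<le> cmod (reg_sol q1 h1 (k\<^sup>2) a)" and l2: "E / 12 \<le> cmod (reg_sol q2 h2 (k\<^sup>2) a)"
      using low[OF order_trans[OF D1(2)[OF k(2) aa, folded E_def] Dk[of D1]]]
        low[OF order_trans[OF D2(2)[OF k(2) aa, folded E_def] Dk[of D2]]] by (simp_all add: D_def)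
    have Ep: "E > 0" by (simp add: E_def)
    define \<phi>1 where "\<phi>1 = reg_sol q1 h1 (k\<^sup>2) a"
    define \<phi>2 where "\<phi>2 = reg_sol q2 h2 (k\<^sup>2) a"
    define \<psi>1 where "\<psi>1 = reg_der q1 h1 (k\<^sup>2) a"
    define \<psi>2 where "\<psi>2 = reg_der q2 h2 (k\<^sup>2) a"
    have nz: "\<phi>1 \<noteq> 0" "\<phi>2 \<noteq> 0" using l1 l2 Ep by (auto simp: \<phi>1_def \<phi>2_def)
    have d1: "reg_sol q1 h1 (k\<^sup>2) (a - t) = \<phi>1 * C1 (k\<^sup>2) t - \<psi>1 * S1 (k\<^sup>2) t"
      using reg_sol_from_right_end[OF q1 a t, of h1 "k\<^sup>2"] by (simp add: \<phi>1_def \<psi>1_def C1_def S1_def r1_def)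
    have d2: "reg_sol q2 h2 (k\<^sup>2) (a - t) = \<phi>2 * C2 (k\<^sup>2) t - \<psi>2 * S2 (k\<^sup>2) t"
      using reg_sol_from_right_end[OF q2 a t, of h2 "k\<^sup>2"] by (simp add: \<phi>2_def \<psi>2_def C2_def S2_def r2_def)
    have w: "\<phi>1 * \<psi>2 = \<psi>1 * \<phi>2" using W[of "k\<^sup>2"] by (simp add: cross_wronskian_def \<phi>1_def \<phi>2_def \<psi>1_def \<psi>2_def)
    \<comment> \<open>the equality \<open>w\<close> of the Weyl functions removes the products \<open>S1 S2\<close>\<close>
    have "\<phi>1 * \<phi>2 * F (k\<^sup>2) = \<phi>2 * S2 (k\<^sup>2) t * (\<phi>1 * C1 (k\<^sup>2) t) - \<phi>1 * S1 (k\<^sup>2) t * (\<phi>2 * C2 (k\<^sup>2) t)"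
      by (simp add: F_def algebra_simps)
    also have "\<dots> = \<phi>2 * S2 (k\<^sup>2) t * (reg_sol q1 h1 (k\<^sup>2) (a - t) + \<psi>1 * S1 (k\<^sup>2) t) - \<phi>1 * S1 (k\<^sup>2) t * (reg_sol q2 h2 (k\<^sup>2) (a - t) + \<psi>2 * S2 (k\<^sup>2) t)"
      by (simp add: d1 d2)
    also have "\<dots> = \<phi>2 * S2 (k\<^sup>2) t * reg_sol q1 h1 (k\<^sup>2) (a - t) - \<phi>1 * S1 (k\<^sup>2) t * reg_sol q2 h2 (k\<^sup>2) (a - t)
        + (\<psi>1 * \<phi>2 - \<phi>1 * \<psi>2) * (S1 (k\<^sup>2) t * S2 (k\<^sup>2) t)"
      by (simp add: algebra_simps)
    finally have "\<phi>1 * \<phi>2 * F (k\<^sup>2) = \<phi>2 * S2 (k\<^sup>2) t * reg_sol q1 h1 (k\<^sup>2) (a - t) - \<phi>1 * S1 (k\<^sup>2) t * reg_sol q2 h2 (k\<^sup>2) (a - t)"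
      by (simp add: w)
    then have Feq: "F (k\<^sup>2) = S2 (k\<^sup>2) t * (reg_sol q1 h1 (k\<^sup>2) (a - t) / \<phi>1) - S1 (k\<^sup>2) t * (reg_sol q2 h2 (k\<^sup>2) (a - t) / \<phi>2)"
      using nz by (simp add: field_simps)
    have at: "a - t \<in> {0..1}" using t a by auto
    have quot: "cmod (\<xi> / \<phi>) \<le> 12 * M * exp (- (\<bar>Im k\<bar> * t))"
      if "cmod \<xi> \<le> M * exp (\<bar>Im k\<bar> * (a - t))" "E / 12 \<le> cmod \<phi>" for \<xi> \<phi> M
    proof -
      have p: "cmod \<phi> > 0" using that(2) Ep by linarith
      have "M * exp (\<bar>Im k\<bar> * (a - t)) = 12 * M * exp (- (\<bar>Im k\<bar> * t)) * (E / 12)"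
        by (simp add: E_def right_diff_distrib exp_diff exp_minus field_simps)
      also have "\<dots> \<le> 12 * M * exp (- (\<bar>Im k\<bar> * t)) * cmod \<phi>"
      proof (rule mult_left_mono[OF that(2)])
        have "0 \<le> M * exp (\<bar>Im k\<bar> * (a - t))" using that(1) norm_ge_zero order_trans by blast
        then have "0 \<le> M" by (simp add: zero_le_mult_iff)
        then show "0 \<le> 12 * M * exp (- (\<bar>Im k\<bar> * t))" by simp
      qed
      finally show ?thesis using that(1) p by (simp add: norm_divide pos_divide_le_eq)
    qed
    have prodb: "cmod (s * \<xi>) \<le> 12 * M * B' / cmod k"
      if "cmod s \<le> B' / cmod k * exp (\<bar>Im k\<bar> * t)" "cmod \<xi> \<le> 12 * M * exp (- (\<bar>Im k\<bar> * t))" "B' > 0" for s \<xi> M B'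
    proof -
      have "cmod s * cmod \<xi> \<le> (B' / cmod k * exp (\<bar>Im k\<bar> * t)) * (12 * M * exp (- (\<bar>Im k\<bar> * t)))"
        using that(1,2) by (rule mult_mono) (use that(3) in auto)
      also have "\<dots> = 12 * M * B' / cmod k" by (simp add: exp_minus field_simps)
      finally show ?thesis by (simp add: norm_mult)
    qed
    have "cmod (F (k\<^sup>2)) \<le> 12 * M1 * B2 / cmod k + 12 * M2 * B1 / cmod k"
      unfolding Feq
      by (intro order_trans[OF norm_triangle_ineq4] add_mono prodb quot B M1(2)[OF k(2) at] M2(2)[OF k(2) at] k(2)
           l1[folded \<phi>1_def] l2[folded \<phi>2_def])
    then show ?thesis by (simp add: L_def add_divide_distrib distrib_left mult.assoc)
  qed
  \<comment> \<open>the maximum principle in the variable \<open>k\<close>, on circles of radius \<open>m \<pi> / a\<close>\<close>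
  have "cmod (F (k0\<^sup>2)) \<le> e" if e: "e > 0" for k0 e
  proof -
    obtain m :: nat where m: "real m \<ge> max (max 1 (12 * D)) (max (cmod k0 + 1) (L / e))" using real_arch_simple by blast
    have m1: "m \<ge> 1" using m by auto
    define R where "R = real m * pi / a"
    have "real m * a \<le> real m * pi" using a pi_gt3 by (intro mult_left_mono) auto
    then have Rm: "R \<ge> real m" using a by (simp add: R_def pos_le_divide_eq)
    then have R: "R \<ge> 1" "R \<ge> 12 * D" "cmod k0 < R" "L / e \<le> R" "R > 0" using m by auto
    show ?thesis
    proof (rule maximum_modulus_frontier[of "\<lambda>k. F (k\<^sup>2)" "ball 0 R"])
      have "(\<lambda>k::complex. k\<^sup>2) holomorphic_on ball 0 R" by (intro holomorphic_intros)
      then show "(\<lambda>k. F (k\<^sup>2)) holomorphic_on interior (ball 0 R)"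
        using holomorphic_on_compose[OF _ Fh] by (fastforce simp: o_def)
      have "continuous_on UNIV F" using Fh by (rule holomorphic_on_imp_continuous_on)
      then show "continuous_on (closure (ball 0 R)) (\<lambda>k. F (k\<^sup>2))"
        by (rule continuous_on_compose2) (auto intro!: continuous_intros)
      fix k :: complex assume "k \<in> frontier (ball 0 R)"
      then have kR: "cmod k = R" using R by (auto simp: frontier_def)
      have "cmod (F (k\<^sup>2)) \<le> L / cmod k" using kR R m1 by (intro circ[of k m]) (auto simp: R_def)
      also have "\<dots> \<le> e" using R e by (simp add: kR divide_le_eq mult.commute)
      finally show "cmod (F (k\<^sup>2)) \<le> e" .
    qed (use R in auto)
  qed
  from this[of _ "csqrt z"] have "cmod (F z) \<le> e" if "e > 0" for e using that by simp
  then have "F z = 0" by (metis dense_le norm_le_zero_iff field_le_epsilon add_0)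
  then show ?thesis by (simp add: F_def C1_def S1_def C2_def S2_def)
qed

text \<open>
  The parameter \<open>z = \<i>\<close> is chosen because it is not real, so that \<open>S\<^sub>1\<close> has no zero besides \<open>t = 0\<close>. From
  \<open>C\<^sub>1 S\<^sub>2 = C\<^sub>2 S\<^sub>1\<close>, its derivative, and \<open>C\<^sub>i S\<^sub>i' - C\<^sub>i' S\<^sub>i = 1\<close> one gets \<open>S\<^sub>1\<^sup>2 = S\<^sub>2\<^sup>2\<close>, then
  \<open>S\<^sub>1 S\<^sub>1' = S\<^sub>2 S\<^sub>2'\<close>, and the derivative of the latter equates the potentials.
\<close>

lemma potential_eq_if_cross_wronskian_zero:
  fixes q1 q2 :: "real \<Rightarrow> real" and h1 h2 a :: real
  assumes q1: "q1 absolutely_integrable_on {0..1}" and q2: "q2 absolutely_integrable_on {0..1}"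
    and a: "0 < a" "a \<le> 1" and W: "\<And>z. cross_wronskian q1 h1 q2 h2 z a = 0"
  obtains N where "negligible N" "\<And>x. x \<in> {0..a} - N \<Longrightarrow> q1 x = q2 x"
proof -
  define r1 where "r1 t = q1 (a - t)" for t
  define r2 where "r2 t = q2 (a - t)" for t
  note i1 = ivp_solution[OF abs_integrable_minus_const[OF abs_integrable_reflected_potential[OF q1 a, folded r1_def], of \<i>] less_imp_le[OF a(1)] a(2)]
  note i2 = ivp_solution[OF abs_integrable_minus_const[OF abs_integrable_reflected_potential[OF q2 a, folded r2_def], of \<i>] less_imp_le[OF a(1)] a(2)]
  define C1 where "C1 = ivp_val a (\<lambda>t. complex_of_real (r1 t) - \<i>) 1 0"
  define S1 where "S1 = ivp_val a (\<lambda>t. complex_of_real (r1 t) - \<i>) 0 1"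
  define C2 where "C2 = ivp_val a (\<lambda>t. complex_of_real (r2 t) - \<i>) 1 0"
  define S2 where "S2 = ivp_val a (\<lambda>t. complex_of_real (r2 t) - \<i>) 0 1"
  define C1' where "C1' = ivp_der a (\<lambda>t. complex_of_real (r1 t) - \<i>) 1 0"
  define S1' where "S1' = ivp_der a (\<lambda>t. complex_of_real (r1 t) - \<i>) 0 1"
  define C2' where "C2' = ivp_der a (\<lambda>t. complex_of_real (r2 t) - \<i>) 1 0"
  define S2' where "S2' = ivp_der a (\<lambda>t. complex_of_real (r2 t) - \<i>) 0 1"
  have sC1: "sl_solution a (\<lambda>t. complex_of_real (r1 t) - \<i>) C1 C1'" "C1 0 = 1" "C1' 0 = 0"
    and sS1: "sl_solution a (\<lambda>t. complex_of_real (r1 t) - \<i>) S1 S1'" "S1 0 = 0" "S1' 0 = 1"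
    and sC2: "sl_solution a (\<lambda>t. complex_of_real (r2 t) - \<i>) C2 C2'" "C2 0 = 1" "C2' 0 = 0"
    and sS2: "sl_solution a (\<lambda>t. complex_of_real (r2 t) - \<i>) S2 S2'" "S2 0 = 0" "S2' 0 = 1"
    unfolding C1_def C1'_def S1_def S1'_def C2_def C2'_def S2_def S2'_def using i1 i2 by auto
  note ct = sl_solution_continuous[OF sC1(1)] sl_solution_continuous[OF sS1(1)]
            sl_solution_continuous[OF sC2(1)] sl_solution_continuous[OF sS2(1)]
  have dC1: "ac_deriv a C1 C1'" and dC2: "ac_deriv a C2 C2'" and dS1: "ac_deriv a S1 S1'" and dS2: "ac_deriv a S2 S2'"
    and ddS1: "ac_deriv a S1' (\<lambda>t. (complex_of_real (r1 t) - \<i>) * S1 t)"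
    and ddS2: "ac_deriv a S2' (\<lambda>t. (complex_of_real (r2 t) - \<i>) * S2 t)"
    using sC1 sC2 sS1 sS2 by (auto simp: sl_solution_def)
  have w1: "C1 t * S1' t - C1' t * S1 t = 1" and w2: "C2 t * S2' t - C2' t * S2 t = 1" if "t \<in> {0..a}" for t
    using wronskian_const[OF sC1(1) sS1(1) that] wronskian_const[OF sC2(1) sS2(1) that] sC1 sC2 sS1 sS2 by auto
  have agree: "C1 t * S2 t = C2 t * S1 t" if "t \<in> {0..a}" for t
    using backward_solutions_agree[OF q1 q2 a W that, of \<i>]
    by (simp add: C1_def S1_def C2_def S2_def r1_def r2_def)
  have agree': "C1' t * S2 t + S2' t * C1 t = C2' t * S1 t + S1' t * C2 t" if t: "t \<in> {0..a}" for t
  proof -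
    have c: "continuous_on {0..a} (\<lambda>t. 1 * (C1' t * S2 t + S2' t * C1 t) + (-1) * (C2' t * S1 t + S1' t * C2 t))"
      by (intro continuous_intros ct)
    have d: "ac_deriv a (\<lambda>t. 1 * (C1 t * S2 t) + (-1) * (C2 t * S1 t))
       (\<lambda>t. 1 * (C1' t * S2 t + S2' t * C1 t) + (-1) * (C2' t * S1 t + S1' t * C2 t))"
      by (intro ac_deriv_linear ac_deriv_mult dC1 dS2 dC2 dS1)
    have "1 * (C1' t * S2 t + S2' t * C1 t) + (-1) * (C2' t * S1 t + S1' t * C2 t) = 0"
      by (rule ac_deriv_vanishes[OF d c _ a(1) t]) (simp add: agree)
    then show ?thesis by (simp only: mult_1 mult_minus1 add_uminus_conv_diff right_minus_eq)
  qed
  have sq: "(S1 t)\<^sup>2 = (S2 t)\<^sup>2" if t: "t \<in> {0..a}" for t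
  proof -
    \<comment> \<open>insert the two Wronskians, both equal to \<open>1\<close>; the result is a combination of the two relations above\<close>
    have "(S2 t)\<^sup>2 - (S1 t)\<^sup>2 = (C1 t * S1' t - C1' t * S1 t) * (S2 t)\<^sup>2 - (C2 t * S2' t - C2' t * S2 t) * (S1 t)\<^sup>2"
      by (simp add: w1[OF t] w2[OF t])
    also have "\<dots> = (C1 t * S2 t - C2 t * S1 t) * (S1' t * S2 t + S2' t * S1 t)
         - S1 t * S2 t * (C1' t * S2 t + S2' t * C1 t - (C2' t * S1 t + S1' t * C2 t))"
      by (simp add: algebra_simps power2_eq_square)
    also have "\<dots> = 0" using agree[OF t] agree'[OF t] by simp
    finally show ?thesis by simp
  qed
  have sq': "S1 t * S1' t = S2 t * S2' t" if t: "t \<in> {0..a}" for t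
  proof -
    have c: "continuous_on {0..a} (\<lambda>t. 1 * (S1' t * S1 t + S1' t * S1 t) + (-1) * (S2' t * S2 t + S2' t * S2 t))"
      by (intro continuous_intros ct)
    have d: "ac_deriv a (\<lambda>t. 1 * (S1 t * S1 t) + (-1) * (S2 t * S2 t))
       (\<lambda>t. 1 * (S1' t * S1 t + S1' t * S1 t) + (-1) * (S2' t * S2 t + S2' t * S2 t))"
      by (intro ac_deriv_linear ac_deriv_mult dS2 dS1)
    have "1 * (S1' t * S1 t + S1' t * S1 t) + (-1) * (S2' t * S2 t + S2' t * S2 t) = 0"
      by (rule ac_deriv_vanishes[OF d c _ a(1) t]) (use sq in \<open>simp add: power2_eq_square\<close>)
    then have "2 * (S1 t * S1' t - S2 t * S2' t) = 0" by (simp add: algebra_simps)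
    then show ?thesis by simp
  qed
  have d1: "ac_deriv a (\<lambda>t. S1 t * S1' t) (\<lambda>t. S1' t * S1' t + (complex_of_real (r1 t) - \<i>) * S1 t * S1 t)"
    by (rule ac_deriv_mult[OF dS1 ddS1])
  have "ac_deriv a (\<lambda>t. S2 t * S2' t) (\<lambda>t. S2' t * S2' t + (complex_of_real (r2 t) - \<i>) * S2 t * S2 t)"
    by (rule ac_deriv_mult[OF dS2 ddS2])
  then have d2: "ac_deriv a (\<lambda>t. S1 t * S1' t) (\<lambda>t. S2' t * S2' t + (complex_of_real (r2 t) - \<i>) * S2 t * S2 t)"
    by (rule ac_deriv_cong) (simp_all add: sq')
  obtain N where N: "negligible N" "\<And>t. t \<in> {0..a} - N \<Longrightarrow>
      S1' t * S1' t + (complex_of_real (r1 t) - \<i>) * S1 t * S1 t = S2' t * S2' t + (complex_of_real (r2 t) - \<i>) * S2 t * S2 t"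
    using ac_deriv_unique_AE[OF d1 d2 less_imp_le[OF a(1)]] by blast
  have S1nz: "S1 t \<noteq> 0" if t: "t \<in> {0<..a}" for t
  proof
    assume 0: "S1 t = 0"
    have sub: "sl_solution t (\<lambda>t. complex_of_real (r1 t) - \<i>) S1 S1'" using sS1(1) t by (auto intro: sl_solution_restrict)
    have z: "S1 s = 0" if "s \<in> {0..t}" for s
      by (rule solution_zero_if_nonreal[OF sub]) (use t 0 that sS1 in auto)
    have "S1' 0 = 0"
      by (rule ac_deriv_vanishes[of t S1 S1'])
         (use t z ac_deriv_restrict[OF dS1, of t] continuous_on_subset[OF ct(4), of "{0..t}"] in auto)
    then show False using sS1 by simp
  qed
  have req: "r1 t = r2 t" if t: "t \<in> {0<..a} - N" for t
  proof -
    have t': "t \<in> {0..a}" and nz: "S1 t \<noteq> 0" using t S1nz by auto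
    have "(S1 t)\<^sup>2 * (S1' t)\<^sup>2 = (S2 t)\<^sup>2 * (S2' t)\<^sup>2" using sq'[OF t'] by (metis power_mult_distrib)
    then have "(S1 t)\<^sup>2 * (S1' t)\<^sup>2 = (S1 t)\<^sup>2 * (S2' t)\<^sup>2" by (simp only: sq[OF t'])
    then have "(S1' t)\<^sup>2 = (S2' t)\<^sup>2" using nz by simp
    moreover have "(S1' t)\<^sup>2 + (complex_of_real (r1 t) - \<i>) * (S1 t)\<^sup>2 = (S2' t)\<^sup>2 + (complex_of_real (r2 t) - \<i>) * (S2 t)\<^sup>2"
      using N(2)[of t] t by (auto simp: power2_eq_square mult.assoc)
    ultimately have "(complex_of_real (r1 t) - \<i>) * (S1 t)\<^sup>2 = (complex_of_real (r2 t) - \<i>) * (S1 t)\<^sup>2"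
      by (simp add: sq[OF t'])
    then show ?thesis using nz by simp
  qed
  show ?thesis
  proof (rule that[of "insert a ((\<lambda>t. a - t) ` N)"])
    have "negligible ((\<lambda>t. a - t) ` N)"
      by (intro negligible_differentiable_image_negligible N(1)) (auto intro!: derivative_intros)
    then show "negligible (insert a ((\<lambda>t. a - t) ` N))" by simp
    fix x assume x: "x \<in> {0..a} - insert a ((\<lambda>t. a - t) ` N)"
    have "a - x \<notin> N"
    proof
      assume "a - x \<in> N"
      then have "a - (a - x) \<in> (\<lambda>t. a - t) ` N" by (rule imageI)
      then show False using x by simp
    qed
    then have "r1 (a - x) = r2 (a - x)" using x by (intro req) auto
    then show "q1 x = q2 x" by (simp add: r1_def r2_def)
  qed
qed

theorem corollary1p2:
  fixes q1 q2 :: "real \<Rightarrow> real" and h1 h2 H :: real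
  assumes "q1 absolutely_integrable_on {0..1}"
    and "q2 absolutely_integrable_on {0..1}"
    and "AE x in lebesgue_on {1/4..1}. q1 x = q2 x"
    and "(\<forall>j. schroedinger_lambda q1 h1 H (2 * j) = schroedinger_lambda q2 h2 H (2 * j)) \<or>
         (\<forall>j. schroedinger_lambda q1 h1 H (2 * j + 1) = schroedinger_lambda q2 h2 H (2 * j + 1))"
  shows "AE x in lebesgue_on {0..1}. q1 x = q2 x"
proof -
  obtain n :: "nat \<Rightarrow> nat" where n: "strict_mono n" "\<And>j. n j \<le> 2 * j + 1"
    and lam: "\<And>j. schroedinger_lambda q1 h1 H (n j) = schroedinger_lambda q2 h2 H (n j)"
    using assms(4)
  proof (elim disjE)
    assume "\<forall>j. schroedinger_lambda q1 h1 H (2 * j) = schroedinger_lambda q2 h2 H (2 * j)"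
    then show thesis by (intro that[of "\<lambda>j. 2 * j"]) (auto simp: strict_mono_def)
  next
    assume "\<forall>j. schroedinger_lambda q1 h1 H (2 * j + 1) = schroedinger_lambda q2 h2 H (2 * j + 1)"
    then show thesis by (intro that[of "\<lambda>j. 2 * j + 1"]) (auto simp: strict_mono_def)
  qed
  have W: "cross_wronskian q1 h1 q2 h2 z (1/4) = 0" for z
    by (rule cross_wronskian_vanishes[OF assms(1-3) n lam])
  obtain N where N: "negligible N" "\<And>x. x \<in> {0..1/4} - N \<Longrightarrow> q1 x = q2 x"
    using potential_eq_if_cross_wronskian_zero[OF assms(1,2) _ _ W] by auto
  obtain N' where N': "negligible N'" "\<And>x. x \<in> {1/4..1} - N' \<Longrightarrow> q1 x = q2 x"
    using AE_lebesgue_on_negligible[OF assms(3)] by auto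
  show ?thesis
  proof (rule negligible_imp_AE_lebesgue_on[of "N \<union> N'"])
    show "negligible (N \<union> N')" using N(1) N'(1) by (simp add: negligible_Un)
    show "q1 x = q2 x" if "x \<in> {0..1} - (N \<union> N')" for x
      using that N(2)[of x] N'(2)[of x] by (cases "x \<le> 1/4") auto
  qed auto
qed

end
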